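(* Let $k$ be a field and let $A$ be a finite dimensional $k$-algebra. Let $A/r(A)=\bigoplus_{i=1}^{p}\overline{A}_i$ with simple algebras $\overline{A}_i$, where $r(A)$ is the radical of $A$. Suppose there are a quiver $\Delta$, a generalized path algebra $k(\Delta,\mathcal{B})$ with a set of simple $k$-algebras $\mathcal{B}=\{B_1,\dots,B_q\}$ (indexed by the vertices of $\Delta$), and a set $\rho$ of relations on it such that $$A\cong k(\Delta,\mathcal{B},\rho)\quad\text{with}\quad J_\Delta^{t}\subset\langle\rho\rangle\subset J_\Delta^{2}\ \text{ for some } t,$$ where $J_\Delta$ is the ideal of $k(\Delta,\mathcal{B})$ generated by all $\mathcal{B}$-paths of length $1$. Then $\Delta$ is the quiver of $A$, and $p=q$ with $\overline{A}_i\cong B_i$ for $i=1,\dots,p$ after reindexing.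
   Context: Algebras are associative with identity, modules are unital, quivers are finite, $\subset$ denotes not necessarily strict inclusion. Rank: the rank of a finitely generated bimodule is the least cardinality of a generating set (zero bimodule: rank $0$). Quiver of $A$: its vertices are $1,\dots,p$ and, with $r=r(A)$, the number of arrows from $i$ to $j$ is the rank of the (finitely generated) $\overline{A}_i$-$\overline{A}_j$-bimodule $\overline{A}_i\cdot(r/r^2)\cdot\overline{A}_j$. Generalized path algebra: for a finite quiver $\Delta=(\Delta_0,\Delta_1)$ (an arrow $\beta$ goes from $s(\beta)$ to $e(\beta)$; paths $\beta_1\cdots\beta_n$ satisfy $e(\beta_i)=s(\beta_{i+1})$) and a family $\mathcal{B}=\{B_i:i\in\Delta_0\}$ of $k$-algebras with identities $e_i$, a $\mathcal{B}$-path of length $0$ is an element of $\bigcup_iB_i$ (elements of $B_i$ start and end at $i$), and a $\mathcal{B}$-path of length $n\ge1$ is $a_1\beta_1a_2\beta_2\cdots a_n\beta_na_{n+1}$ with $\beta_1\cdots\beta_n$ a path in $\Delta$, $a_i\in B_{s(\beta_i)}$ for $i\le n$, and $a_{n+1}\in B_{e(\beta_n)}$. $k(\Delta,\mathcal{B})$ is the $k$-space spanned by all $\mathcal{B}$-paths modulo $k$-multilinearity in the entries $a_i$, with product $(a_1\beta_1\cdots\beta_na_{n+1})(b_1\gamma_1\cdots\gamma_mb_{m+1})=a_1\beta_1\cdots\beta_n(a_{n+1}b_1)\gamma_1\cdots\gamma_mb_{m+1}$ if $a_{n+1},b_1$ lie in the same $B_i$, and $0$ otherwise. A relation on $k(\Delta,\mathcal{B})$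 is a $k$-linear combination of $\mathcal{B}$-paths with the same start vertex and the same end vertex; $\langle\rho\rangle$ is the ideal generated by $\rho$, and $k(\Delta,\mathcal{B},\rho)=k(\Delta,\mathcal{B})/\langle\rho\rangle$. *)

theory Defs
  imports "Graph_Theory.Digraph_Isomorphism" "HOL-Algebra.Module" "HOL-Algebra.QuotRing"
    "HOL-Algebra.Ideal_Product" "HOL-Algebra.Generated_Groups"
begin

section \<open>Algebras over a field\<close>

text \<open>
  The library locale \<^locale>\<open>algebra\<close> is restricted to commutative algebras; here
  the multiplication of \<open>A\<close> need not be commutative.
\<close>

locale k_algebra = module K A + field K + ring A
  for K (structure) and A (structure) +
  assumes smult_mult_left:
      "\<lbrakk>c \<in> carrier K; x \<in> carrier A; y \<in> carrier A\<rbrakk> \<Longrightarrow>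
        (c \<odot>\<^bsub>A\<^esub> x) \<otimes>\<^bsub>A\<^esub> y = c \<odot>\<^bsub>A\<^esub> (x \<otimes>\<^bsub>A\<^esub> y)"
    and smult_mult_right:
      "\<lbrakk>c \<in> carrier K; x \<in> carrier A; y \<in> carrier A\<rbrakk> \<Longrightarrow>
        x \<otimes>\<^bsub>A\<^esub> (c \<odot>\<^bsub>A\<^esub> y) = c \<odot>\<^bsub>A\<^esub> (x \<otimes>\<^bsub>A\<^esub> y)"

definition lin_span :: "('k, 'm) ring_scheme \<Rightarrow> ('k, 'a, 'n) module_scheme \<Rightarrow> 'a set \<Rightarrow> 'a set" where
  "lin_span K M X = \<Inter> {N. submodule N K M \<and> X \<subseteq> N}"

definition finite_dimensional :: "('k, 'm) ring_scheme \<Rightarrow> ('k, 'a, 'n) module_scheme \<Rightarrow> bool" where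
  "finite_dimensional K M \<longleftrightarrow> (\<exists>X. finite X \<and> X \<subseteq> carrier M \<and> lin_span K M X = carrier M)"

definition algebra_iso ::
  "('k, 'm) ring_scheme \<Rightarrow> ('k, 'a, 'n) module_scheme \<Rightarrow> ('k, 'b, 'l) module_scheme \<Rightarrow> ('a \<Rightarrow> 'b) set" where
  "algebra_iso K A B =
    {h \<in> ring_iso A B. \<forall>c\<in>carrier K. \<forall>x\<in>carrier A. h (c \<odot>\<^bsub>A\<^esub> x) = c \<odot>\<^bsub>B\<^esub> h x}"

definition algebra_isomorphic ::
  "('k, 'm) ring_scheme \<Rightarrow> ('k, 'a, 'n) module_scheme \<Rightarrow> ('k, 'b, 'l) module_scheme \<Rightarrow> bool" where
  "algebra_isomorphic K A B \<longleftrightarrow> algebra_iso K A B \<noteq> {}"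

text \<open>
  \<^const>\<open>FactRing\<close> together with the induced scalar multiplication
  \<open>c \<odot> (I + x) = I + c \<odot> x\<close>, written on cosets in the same style as \<^const>\<open>rcoset_mult\<close>.
\<close>

definition quot_algebra :: "('k, 'a, 'n) module_scheme \<Rightarrow> 'a set \<Rightarrow> ('k, 'a set) module" where
  "quot_algebra A I =
    \<lparr>carrier = carrier (A Quot I), mult = mult (A Quot I), one = one (A Quot I),
     zero = zero (A Quot I), add = add (A Quot I),
     smult = (\<lambda>c X. \<Union>x\<in>X. I +>\<^bsub>A\<^esub> (c \<odot>\<^bsub>A\<^esub> x))\<rparr>"

definition simple_algebra :: "('k, 'm) ring_scheme \<Rightarrow> ('k, 'a, 'n) module_scheme \<Rightarrow> bool" where
  "simple_algebra K B \<longleftrightarrow> k_algebra K B \<and> carrier B \<noteq> {\<zero>\<^bsub>B\<^esub>} \<and>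
    (\<forall>I. ideal I B \<longrightarrow> I = {\<zero>\<^bsub>B\<^esub>} \<or> I = carrier B)"

text \<open>
  A two-sided ideal \<open>S\<close> of \<open>Q\<close> viewed as an algebra in its own right. Its identity is in
  general not the identity of \<open>Q\<close>.
\<close>

definition ideal_algebra :: "('k, 'a) module \<Rightarrow> 'a set \<Rightarrow> ('k, 'a) module" where
  "ideal_algebra Q S =
    Q\<lparr>carrier := S, one := (THE e. e \<in> S \<and> (\<forall>x\<in>S. e \<otimes>\<^bsub>Q\<^esub> x = x \<and> x \<otimes>\<^bsub>Q\<^esub> e = x))\<rparr>"

definition is_direct_sum_of_ideals :: "('a, 'n) ring_scheme \<Rightarrow> 'i set \<Rightarrow> ('i \<Rightarrow> 'a set) \<Rightarrow> bool" where
  "is_direct_sum_of_ideals Q I S \<longleftrightarrow> (\<forall>i\<in>I. ideal (S i) Q) \<and>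
    (\<forall>x\<in>carrier Q. \<exists>!f. f \<in> (\<Pi>\<^sub>E i\<in>I. S i) \<and> x = finsum Q f I)"


section \<open>The Jacobson radical\<close>

definition left_ideal :: "'a set \<Rightarrow> ('a, 'n) ring_scheme \<Rightarrow> bool" where
  "left_ideal I R \<longleftrightarrow> additive_subgroup I R \<and> (\<forall>r\<in>carrier R. \<forall>x\<in>I. r \<otimes>\<^bsub>R\<^esub> x \<in> I)"

definition maximal_left_ideal :: "'a set \<Rightarrow> ('a, 'n) ring_scheme \<Rightarrow> bool" where
  "maximal_left_ideal I R \<longleftrightarrow> left_ideal I R \<and> I \<noteq> carrier R \<and>
    (\<forall>J. left_ideal J R \<and> I \<subseteq> J \<longrightarrow> J = I \<or> J = carrier R)"

definition radical :: "('a, 'n) ring_scheme \<Rightarrow> 'a set" where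
  "radical R = carrier R \<inter> \<Inter> {I. maximal_left_ideal I R}"

text \<open>\<open>ideal_power R I 0\<close> is the whole ring.\<close>

definition ideal_power :: "('a, 'n) ring_scheme \<Rightarrow> 'a set \<Rightarrow> nat \<Rightarrow> 'a set" where
  "ideal_power R I n = I [^]\<^bsub>ideals_set R\<^esub> n"


section \<open>The quiver of an algebra\<close>

text \<open>
  A bimodule over \<open>R\<close> (left) and \<open>S\<close> (right) is given by an additive group \<open>V\<close>, a subset
  \<open>M\<close> of \<open>V\<close> and the two actions. Closure under scalars from the ground field is
  implied by closure under the actions of the unital algebras \<open>R\<close> and \<open>S\<close>.
\<close>

definition sub_bimodule ::
  "('r, 'm) ring_scheme \<Rightarrow> ('s, 'n) ring_scheme \<Rightarrow> ('x, 'l) ring_scheme \<Rightarrow>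
   ('r \<Rightarrow> 'x \<Rightarrow> 'x) \<Rightarrow> ('x \<Rightarrow> 's \<Rightarrow> 'x) \<Rightarrow> 'x set \<Rightarrow> bool" where
  "sub_bimodule R S V lact ract N \<longleftrightarrow> additive_subgroup N V \<and>
    (\<forall>a\<in>carrier R. \<forall>x\<in>N. lact a x \<in> N) \<and> (\<forall>b\<in>carrier S. \<forall>x\<in>N. ract x b \<in> N)"

definition bimodule_rank ::
  "('r, 'm) ring_scheme \<Rightarrow> ('s, 'n) ring_scheme \<Rightarrow> ('x, 'l) ring_scheme \<Rightarrow>
   ('r \<Rightarrow> 'x \<Rightarrow> 'x) \<Rightarrow> ('x \<Rightarrow> 's \<Rightarrow> 'x) \<Rightarrow> 'x set \<Rightarrow> nat" where
  "bimodule_rank R S V lact ract M =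
    (LEAST n. \<exists>X. finite X \<and> card X = n \<and> X \<subseteq> M \<and>
       \<Inter> {N. sub_bimodule R S V lact ract N \<and> X \<subseteq> N} = M)"

definition rad_sq :: "('a, 'n) ring_scheme \<Rightarrow> 'a set" where
  "rad_sq A = ideal_power A (radical A) 2"

text \<open>\<open>r/r\<^sup>2\<close>, as an additive subgroup of \<open>A/r\<^sup>2\<close>.\<close>

definition rad_layer :: "('a, 'n) ring_scheme \<Rightarrow> 'a set set" where
  "rad_layer A = (\<lambda>x. rad_sq A +>\<^bsub>A\<^esub> x) ` radical A"

text \<open>
  The action of \<open>A/r\<close> on \<open>r/r\<^sup>2\<close> from the left is
  \<open>(r + a)(r\<^sup>2 + x) = r\<^sup>2 + a x\<close>, and similarly from the right. Both are
  \<^const>\<open>rcoset_mult\<close> modulo \<open>r\<^sup>2\<close>: on a coset of \<open>r\<close> and a coset of \<open>r\<^sup>2\<close> inside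
  \<open>r\<close> it yields a single coset of \<open>r\<^sup>2\<close>.
\<close>

definition rad_lact :: "('a, 'n) ring_scheme \<Rightarrow> 'a set \<Rightarrow> 'a set \<Rightarrow> 'a set" where
  "rad_lact A X m = rcoset_mult A (rad_sq A) X m"

definition rad_ract :: "('a, 'n) ring_scheme \<Rightarrow> 'a set \<Rightarrow> 'a set \<Rightarrow> 'a set" where
  "rad_ract A m X = rcoset_mult A (rad_sq A) m X"

text \<open>\<open>S \<cdot> (r/r\<^sup>2) \<cdot> T\<close> for subsets \<open>S\<close>, \<open>T\<close> of \<open>A/r\<close>: all finite sums of products.\<close>

definition rad_component :: "('a, 'n) ring_scheme \<Rightarrow> 'a set set \<Rightarrow> 'a set set \<Rightarrow> 'a set set" where
  "rad_component A S T = generate (add_monoid (A Quot rad_sq A))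
     {rad_ract A (rad_lact A a m) b | a m b. a \<in> S \<and> m \<in> rad_layer A \<and> b \<in> T}"

definition quiver_arrow_number ::
  "('k, 'a) module \<Rightarrow> (nat \<Rightarrow> 'a set set) \<Rightarrow> nat \<Rightarrow> nat \<Rightarrow> nat" where
  "quiver_arrow_number A Abar i j =
    bimodule_rank (ideal_algebra (quot_algebra A (radical A)) (Abar i))
      (ideal_algebra (quot_algebra A (radical A)) (Abar j))
      (A Quot rad_sq A) (rad_lact A) (rad_ract A)
      (rad_component A (Abar i) (Abar j))"

text \<open>
  The quiver of \<open>A\<close> with respect to a decomposition of \<open>A/r\<close> into the simple components
  \<open>Abar 1, \<dots>, Abar p\<close>. The arrows from \<open>i\<close> to \<open>j\<close> are \<open>(i, j, l)\<close> with
  \<open>l\<close> below the number of arrows.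
\<close>

definition quiver_of ::
  "('k, 'a) module \<Rightarrow> nat \<Rightarrow> (nat \<Rightarrow> 'a set set) \<Rightarrow> (nat, nat \<times> nat \<times> nat) pre_digraph" where
  "quiver_of A p Abar =
    \<lparr>verts = {1..p},
     arcs = {(i, j, l). i \<in> {1..p} \<and> j \<in> {1..p} \<and> l < quiver_arrow_number A Abar i j},
     tail = (\<lambda>(i, j, l). i), head = (\<lambda>(i, j, l). j)\<rparr>"


section \<open>Generalized path algebras\<close>

text \<open>
  \<open>Triv i a\<close> is the path \<open>a \<in> B i\<close> of length 0, and \<open>Step a \<beta> p\<close> is the path
  \<open>a \<beta> p\<close>. Paths of length 0 carry their vertex, so that the members of the family
  \<open>B\<close> are kept apart even when their carriers overlap.
\<close>

datatype ('v, 'e, 'b) bpath = Triv 'v 'b | Step 'b 'e "('v, 'e, 'b) bpath"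

primrec bp_start :: "('v, 'e) pre_digraph \<Rightarrow> ('v, 'e, 'b) bpath \<Rightarrow> 'v" where
  "bp_start \<Delta> (Triv v a) = v"
| "bp_start \<Delta> (Step a \<beta> p) = tail \<Delta> \<beta>"

primrec bp_end :: "('v, 'e, 'b) bpath \<Rightarrow> 'v" where
  "bp_end (Triv v a) = v"
| "bp_end (Step a \<beta> p) = bp_end p"

primrec bp_length :: "('v, 'e, 'b) bpath \<Rightarrow> nat" where
  "bp_length (Triv v a) = 0"
| "bp_length (Step a \<beta> p) = Suc (bp_length p)"

primrec is_bpath ::
  "('v, 'e) pre_digraph \<Rightarrow> ('v \<Rightarrow> ('k, 'b) module) \<Rightarrow> ('v, 'e, 'b) bpath \<Rightarrow> bool" where
  "is_bpath \<Delta> B (Triv v a) \<longleftrightarrow> v \<in> verts \<Delta> \<and> a \<in> carrier (B v)"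
| "is_bpath \<Delta> B (Step a \<beta> p) \<longleftrightarrow> \<beta> \<in> arcs \<Delta> \<and> a \<in> carrier (B (tail \<Delta> \<beta>)) \<and>
     is_bpath \<Delta> B p \<and> head \<Delta> \<beta> = bp_start \<Delta> p"

text \<open>Meaningful only if the first path ends where the second one starts.\<close>

fun bp_mult ::
  "('v \<Rightarrow> ('k, 'b) module) \<Rightarrow> ('v, 'e, 'b) bpath \<Rightarrow> ('v, 'e, 'b) bpath \<Rightarrow> ('v, 'e, 'b) bpath" where
  "bp_mult B (Triv v a) (Triv w b) = Triv v (a \<otimes>\<^bsub>B v\<^esub> b)"
| "bp_mult B (Triv v a) (Step b \<beta> p) = Step (a \<otimes>\<^bsub>B v\<^esub> b) \<beta> p"
| "bp_mult B (Step a \<beta> p) q = Step a \<beta> (bp_mult B p q)"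

text \<open>
  The vector space with basis the set of all \<open>B\<close>-paths, as finitely supported functions,
  with the bilinear extension of the product of paths. Its identity is the sum of the
  identities \<open>e\<^sub>i\<close>, regarded as paths of length 0.
\<close>

definition free_bpath_algebra ::
  "'k ring \<Rightarrow> ('v, 'e) pre_digraph \<Rightarrow> ('v \<Rightarrow> ('k, 'b) module) \<Rightarrow>
   ('k, ('v, 'e, 'b) bpath \<Rightarrow> 'k) module" where
  "free_bpath_algebra K \<Delta> B =
    \<lparr>carrier = {f. range f \<subseteq> carrier K \<and> finite {p. f p \<noteq> \<zero>\<^bsub>K\<^esub>} \<and>
                   (\<forall>p. f p \<noteq> \<zero>\<^bsub>K\<^esub> \<longrightarrow> is_bpath \<Delta> B p)},
     mult = (\<lambda>f g p. finsum K (\<lambda>(q, r). f q \<otimes>\<^bsub>K\<^esub> g r)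
        {(q, r). f q \<noteq> \<zero>\<^bsub>K\<^esub> \<and> g r \<noteq> \<zero>\<^bsub>K\<^esub> \<and> bp_end q = bp_start \<Delta> r \<and> bp_mult B q r = p}),
     one = (\<lambda>p. if \<exists>v\<in>verts \<Delta>. p = Triv v \<one>\<^bsub>B v\<^esub> then \<one>\<^bsub>K\<^esub> else \<zero>\<^bsub>K\<^esub>),
     zero = (\<lambda>p. \<zero>\<^bsub>K\<^esub>),
     add = (\<lambda>f g p. f p \<oplus>\<^bsub>K\<^esub> g p),
     smult = (\<lambda>c f p. c \<otimes>\<^bsub>K\<^esub> f p)\<rparr>"

definition bp_basis :: "'k ring \<Rightarrow> ('v, 'e, 'b) bpath \<Rightarrow> ('v, 'e, 'b) bpath \<Rightarrow> 'k" where
  "bp_basis K p = (\<lambda>q. if q = p then \<one>\<^bsub>K\<^esub> else \<zero>\<^bsub>K\<^esub>)"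

text \<open>
  \<open>entry_sum \<Delta> B p p' p''\<close>: the three paths agree except in one entry, which is
  \<open>a\<close> in \<open>p\<close>, \<open>b\<close> in \<open>p'\<close> and \<open>a + b\<close> in \<open>p''\<close>. Similarly
  \<open>entry_smult \<Delta> B c p p'\<close> with \<open>a\<close> in \<open>p\<close> and \<open>c a\<close> in \<open>p'\<close>.
\<close>

inductive entry_sum ::
  "('v, 'e) pre_digraph \<Rightarrow> ('v \<Rightarrow> ('k, 'b) module) \<Rightarrow>
   ('v, 'e, 'b) bpath \<Rightarrow> ('v, 'e, 'b) bpath \<Rightarrow> ('v, 'e, 'b) bpath \<Rightarrow> bool"
  for \<Delta> B where
  "entry_sum \<Delta> B (Triv v a) (Triv v b) (Triv v (a \<oplus>\<^bsub>B v\<^esub> b))"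
| "entry_sum \<Delta> B (Step a \<beta> p) (Step b \<beta> p) (Step (a \<oplus>\<^bsub>B (tail \<Delta> \<beta>)\<^esub> b) \<beta> p)"
| "entry_sum \<Delta> B p p' p'' \<Longrightarrow> entry_sum \<Delta> B (Step a \<beta> p) (Step a \<beta> p') (Step a \<beta> p'')"

inductive entry_smult ::
  "('v, 'e) pre_digraph \<Rightarrow> ('v \<Rightarrow> ('k, 'b) module) \<Rightarrow> 'k \<Rightarrow>
   ('v, 'e, 'b) bpath \<Rightarrow> ('v, 'e, 'b) bpath \<Rightarrow> bool"
  for \<Delta> B c where
  "entry_smult \<Delta> B c (Triv v a) (Triv v (c \<odot>\<^bsub>B v\<^esub> a))"
| "entry_smult \<Delta> B c (Step a \<beta> p) (Step (c \<odot>\<^bsub>B (tail \<Delta> \<beta>)\<^esub> a) \<beta> p)"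
| "entry_smult \<Delta> B c p p' \<Longrightarrow> entry_smult \<Delta> B c (Step a \<beta> p) (Step a \<beta> p')"

definition multilinearity ::
  "'k ring \<Rightarrow> ('v, 'e) pre_digraph \<Rightarrow> ('v \<Rightarrow> ('k, 'b) module) \<Rightarrow> (('v, 'e, 'b) bpath \<Rightarrow> 'k) set" where
  "multilinearity K \<Delta> B =
    (let F = free_bpath_algebra K \<Delta> B in
     lin_span K F
      ({bp_basis K p'' \<ominus>\<^bsub>F\<^esub> (bp_basis K p \<oplus>\<^bsub>F\<^esub> bp_basis K p') | p p' p''.
          is_bpath \<Delta> B p \<and> is_bpath \<Delta> B p' \<and> entry_sum \<Delta> B p p' p''} \<union>
       {bp_basis K p' \<ominus>\<^bsub>F\<^esub> c \<odot>\<^bsub>F\<^esub> bp_basis K p | c p p'.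
          c \<in> carrier K \<and> is_bpath \<Delta> B p \<and> entry_smult \<Delta> B c p p'}))"

definition gen_path_algebra ::
  "'k ring \<Rightarrow> ('v, 'e) pre_digraph \<Rightarrow> ('v \<Rightarrow> ('k, 'b) module) \<Rightarrow>
   ('k, (('v, 'e, 'b) bpath \<Rightarrow> 'k) set) module" where
  "gen_path_algebra K \<Delta> B = quot_algebra (free_bpath_algebra K \<Delta> B) (multilinearity K \<Delta> B)"

definition bp_class ::
  "'k ring \<Rightarrow> ('v, 'e) pre_digraph \<Rightarrow> ('v \<Rightarrow> ('k, 'b) module) \<Rightarrow>
   ('v, 'e, 'b) bpath \<Rightarrow> (('v, 'e, 'b) bpath \<Rightarrow> 'k) set" where
  "bp_class K \<Delta> B p = multilinearity K \<Delta> B +>\<^bsub>free_bpath_algebra K \<Delta> B\<^esub> bp_basis K p"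

definition arrow_ideal ::
  "'k ring \<Rightarrow> ('v, 'e) pre_digraph \<Rightarrow> ('v \<Rightarrow> ('k, 'b) module) \<Rightarrow>
   (('v, 'e, 'b) bpath \<Rightarrow> 'k) set set" where
  "arrow_ideal K \<Delta> B = genideal (gen_path_algebra K \<Delta> B)
     {bp_class K \<Delta> B p | p. is_bpath \<Delta> B p \<and> bp_length p = 1}"

definition gpa_relations ::
  "'k ring \<Rightarrow> ('v, 'e) pre_digraph \<Rightarrow> ('v \<Rightarrow> ('k, 'b) module) \<Rightarrow>
   (('v, 'e, 'b) bpath \<Rightarrow> 'k) set set" where
  "gpa_relations K \<Delta> B = (\<Union>u\<in>verts \<Delta>. \<Union>w\<in>verts \<Delta>.
     lin_span K (gen_path_algebra K \<Delta> B)
       {bp_class K \<Delta> B p | p. is_bpath \<Delta> B p \<and> bp_start \<Delta> p = u \<and> bp_end p = w})"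

definition gen_path_algebra_rel ::
  "'k ring \<Rightarrow> ('v, 'e) pre_digraph \<Rightarrow> ('v \<Rightarrow> ('k, 'b) module) \<Rightarrow>
   (('v, 'e, 'b) bpath \<Rightarrow> 'k) set set \<Rightarrow>
   ('k, (('v, 'e, 'b) bpath \<Rightarrow> 'k) set set) module" where
  "gen_path_algebra_rel K \<Delta> B \<rho> =
    quot_algebra (gen_path_algebra K \<Delta> B) (genideal (gen_path_algebra K \<Delta> B) \<rho>)"

end

(*
  The images x p in A of the B-paths p span A, multiply like paths and vanish on long paths. As
  the relations lie in J^2, every function on paths that is multilinear in the entries and
  vanishes on the paths of length at least 2 induces a linear map on A. Such maps show that A
  modulo the nilpotent ideal R 1 spanned by the paths of positive length is the direct sum of
  the B v, so that r(A) = R 1, r(A)^2 = R 2, and the given simple components of A/r(A) are the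
  images of the B v in some order. They also show that e_v (r/r^2) e_w has dimension
  n * dim (B v) * dim (B w), where n is the number of arrows from v to w. The n arrows generate
  this bimodule, and a set of m elements generates at most m * dim (B v) * dim (B w) dimensions,
  hence the rank is n.
*)
theory Submission
  imports Defs
begin

section \<open>Linear maps and quotient algebras\<close>

text \<open>Elements of \<open>A\<close> have no normal form: the quotient is taken in stages, and
  the ideal of relations is known only up to the bounds J^t and J^2. The upper bound is what
  matters: lengths 0 and 1 acquire no relation beyond multilinearity. So every claim that an element
  does not vanish, or avoids an ideal, is settled by a linear map out of \<open>A\<close>, obtained
  by prescribing values on paths; no tensor product is constructed.

  Modulo r^2, the part of length 1 from v to w is morally the free bimodule on the arrows, a sum of
  copies of \<open>B v\<close> tensor \<open>B w\<close>. The \<open>B v\<close> need not be central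
  over k, so this tensor product need not be simple, and the number of copies cannot be read off as
  a multiplicity of a simple module. This is why the rank is bounded by counting k-dimensions. The
  count is meaningful because every \<open>B v\<close> is an image of \<open>A\<close>, hence finite
  dimensional, and nonzero, hence a factor that can be cancelled. It takes the form of one
  homogeneous linear system with more unknowns than equations, so no dimension of r/r^2 has to be
  defined.\<close>

lemma k_algebraD:
  assumes "k_algebra K A"
  shows "field K" "cring K" "ring A" "module K A"
  using assms by (auto simp: k_algebra_def module_def)

lemma k_algebra_smult:
  assumes "k_algebra K A" "c \<in> carrier K" "x \<in> carrier A" "y \<in> carrier A"
  shows "(c \<odot>\<^bsub>A\<^esub> x) \<otimes>\<^bsub>A\<^esub> y = c \<odot>\<^bsub>A\<^esub> (x \<otimes>\<^bsub>A\<^esub> y)" "x \<otimes>\<^bsub>A\<^esub> (c \<odot>\<^bsub>A\<^esub> y) = c \<odot>\<^bsub>A\<^esub> (x \<otimes>\<^bsub>A\<^esub> y)"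
  using assms by (auto simp: k_algebra_def k_algebra_axioms_def)

lemma k_algebraI:
  assumes "field K" "ring A" "module K A"
    and "\<And>c x y. c \<in> carrier K \<Longrightarrow> x \<in> carrier A \<Longrightarrow> y \<in> carrier A \<Longrightarrow>
      (c \<odot>\<^bsub>A\<^esub> x) \<otimes>\<^bsub>A\<^esub> y = c \<odot>\<^bsub>A\<^esub> (x \<otimes>\<^bsub>A\<^esub> y)"
    and "\<And>c x y. c \<in> carrier K \<Longrightarrow> x \<in> carrier A \<Longrightarrow> y \<in> carrier A \<Longrightarrow>
      x \<otimes>\<^bsub>A\<^esub> (c \<odot>\<^bsub>A\<^esub> y) = c \<odot>\<^bsub>A\<^esub> (x \<otimes>\<^bsub>A\<^esub> y)"
  shows "k_algebra K A"
  using assms by (auto simp: k_algebra_def k_algebra_axioms_def)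

text \<open>Linearity is asked on the carriers only, so ordinary total functions such as
  multiplication by a fixed element qualify as they are.\<close>

definition lin_maps ::
  "('k, 'm) ring_scheme \<Rightarrow> ('k, 'a, 'n) module_scheme \<Rightarrow> ('k, 'b, 'l) module_scheme \<Rightarrow> ('a \<Rightarrow> 'b) set" where
  "lin_maps K M N = {h. (\<forall>x\<in>carrier M. h x \<in> carrier N) \<and>
     (\<forall>x\<in>carrier M. \<forall>y\<in>carrier M. h (x \<oplus>\<^bsub>M\<^esub> y) = h x \<oplus>\<^bsub>N\<^esub> h y) \<and>
     (\<forall>c\<in>carrier K. \<forall>x\<in>carrier M. h (c \<odot>\<^bsub>M\<^esub> x) = c \<odot>\<^bsub>N\<^esub> h x)}"

lemma lin_mapsI:
  assumes "\<And>x. x \<in> carrier M \<Longrightarrow> h x \<in> carrier N"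
    and "\<And>x y. x \<in> carrier M \<Longrightarrow> y \<in> carrier M \<Longrightarrow> h (x \<oplus>\<^bsub>M\<^esub> y) = h x \<oplus>\<^bsub>N\<^esub> h y"
    and "\<And>c x. c \<in> carrier K \<Longrightarrow> x \<in> carrier M \<Longrightarrow> h (c \<odot>\<^bsub>M\<^esub> x) = c \<odot>\<^bsub>N\<^esub> h x"
  shows "h \<in> lin_maps K M N"
  using assms by (auto simp: lin_maps_def)

lemma lin_maps_closed: "h \<in> lin_maps K M N \<Longrightarrow> x \<in> carrier M \<Longrightarrow> h x \<in> carrier N"
  and lin_maps_add: "h \<in> lin_maps K M N \<Longrightarrow> x \<in> carrier M \<Longrightarrow> y \<in> carrier M \<Longrightarrow> h (x \<oplus>\<^bsub>M\<^esub> y) = h x \<oplus>\<^bsub>N\<^esub> h y"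
  and lin_maps_smult: "h \<in> lin_maps K M N \<Longrightarrow> c \<in> carrier K \<Longrightarrow> x \<in> carrier M \<Longrightarrow> h (c \<odot>\<^bsub>M\<^esub> x) = c \<odot>\<^bsub>N\<^esub> h x"
  by (auto simp: lin_maps_def)

lemma lin_maps_comp: "h \<in> lin_maps K M N \<Longrightarrow> g \<in> lin_maps K N P \<Longrightarrow> g \<circ> h \<in> lin_maps K M P"
  by (auto simp: lin_maps_def Pi_def)

lemma lin_maps_zero:
  assumes "module K M" "module K N" "h \<in> lin_maps K M N"
  shows "h \<zero>\<^bsub>M\<^esub> = \<zero>\<^bsub>N\<^esub>"
proof -
  interpret M: module K M by fact
  interpret N: module K N by fact
  have "h (\<zero>\<^bsub>K\<^esub> \<odot>\<^bsub>M\<^esub> \<zero>\<^bsub>M\<^esub>) = \<zero>\<^bsub>K\<^esub> \<odot>\<^bsub>N\<^esub> h \<zero>\<^bsub>M\<^esub>"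
    by (rule lin_maps_smult[OF assms(3)]) auto
  then show ?thesis using lin_maps_closed[OF assms(3)] by simp
qed

lemma lin_maps_uminus:
  assumes "module K M" "module K N" "h \<in> lin_maps K M N" "x \<in> carrier M"
  shows "h (\<ominus>\<^bsub>M\<^esub> x) = \<ominus>\<^bsub>N\<^esub> h x"
proof -
  interpret M: module K M by fact
  interpret N: module K N by fact
  have "h x \<oplus>\<^bsub>N\<^esub> h (\<ominus>\<^bsub>M\<^esub> x) = \<zero>\<^bsub>N\<^esub>"
    using lin_maps_add[OF assms(3,4), of "\<ominus>\<^bsub>M\<^esub> x"] assms(4) lin_maps_zero[OF assms(1-3)]
    by (simp add: M.M.r_neg)
  then show ?thesis
    using lin_maps_closed[OF assms(3)] assms(4)
    by (intro N.M.minus_equality[symmetric]) (simp_all add: N.M.a_comm)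
qed

lemma lin_maps_minus:
  assumes "module K M" "module K N" "h \<in> lin_maps K M N" "x \<in> carrier M" "y \<in> carrier M"
  shows "h (x \<ominus>\<^bsub>M\<^esub> y) = h x \<ominus>\<^bsub>N\<^esub> h y"
proof -
  interpret M: module K M by fact
  interpret N: module K N by fact
  show ?thesis
    unfolding M.M.minus_eq N.M.minus_eq
    using assms(4,5) lin_maps_add[OF assms(3,4), of "\<ominus>\<^bsub>M\<^esub> y"] lin_maps_uminus[OF assms(1-3,5)] by simp
qed

lemma lin_maps_finsum:
  assumes "module K M" "module K N" "h \<in> lin_maps K M N" "f \<in> I \<rightarrow> carrier M"
  shows "h (finsum M f I) = finsum N (\<lambda>i. h (f i)) I"
proof -
  interpret M: module K M by fact
  interpret N: module K N by fact
  show ?thesis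
    using assms(4)
  proof (induct I rule: infinite_finite_induct)
    case (insert i I)
    then have "(\<lambda>i. h (f i)) \<in> I \<rightarrow> carrier N" "h (f i) \<in> carrier N"
      using lin_maps_closed[OF assms(3)] by auto
    with insert show ?case by (simp add: lin_maps_add[OF assms(3)] Pi_def)
  qed (simp_all add: lin_maps_zero[OF assms(1-3)])
qed

lemma lin_maps_kernel_submodule:
  assumes "module K M" "module K N" "h \<in> lin_maps K M N"
  shows "submodule {x \<in> carrier M. h x = \<zero>\<^bsub>N\<^esub>} K M"
proof -
  interpret M: module K M by fact
  interpret N: module K N by fact
  show ?thesis
    by (rule M.submoduleI)
      (auto simp: lin_maps_zero[OF assms] lin_maps_uminus[OF assms] lin_maps_add[OF assms(3)]
        lin_maps_smult[OF assms(3)])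
qed

section \<open>Spans and submodules\<close>

lemma lin_span_least: "submodule N K M \<Longrightarrow> X \<subseteq> N \<Longrightarrow> lin_span K M X \<subseteq> N"
  by (auto simp: lin_span_def)

lemma lin_span_superset: "X \<subseteq> lin_span K M X"
  by (auto simp: lin_span_def)

lemma submodule_memD:
  assumes "module K M" "submodule N K M"
  shows "\<zero>\<^bsub>M\<^esub> \<in> N" "x \<in> N \<Longrightarrow> x \<in> carrier M" "x \<in> N \<Longrightarrow> y \<in> N \<Longrightarrow> x \<oplus>\<^bsub>M\<^esub> y \<in> N"
    "x \<in> N \<Longrightarrow> \<ominus>\<^bsub>M\<^esub> x \<in> N" "x \<in> N \<Longrightarrow> y \<in> N \<Longrightarrow> x \<ominus>\<^bsub>M\<^esub> y \<in> N" "c \<in> carrier K \<Longrightarrow> x \<in> N \<Longrightarrow> c \<odot>\<^bsub>M\<^esub> x \<in> N"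
proof -
  interpret M: module K M by fact
  show "\<zero>\<^bsub>M\<^esub> \<in> N" using subgroup.one_closed[OF submodule.axioms(1)[OF assms(2)]] by simp
  show "x \<in> N \<Longrightarrow> x \<in> carrier M" "x \<in> N \<Longrightarrow> y \<in> N \<Longrightarrow> x \<oplus>\<^bsub>M\<^esub> y \<in> N"
    "x \<in> N \<Longrightarrow> \<ominus>\<^bsub>M\<^esub> x \<in> N" "c \<in> carrier K \<Longrightarrow> x \<in> N \<Longrightarrow> c \<odot>\<^bsub>M\<^esub> x \<in> N"
    using M.submoduleE[OF assms(2)] by auto
  show "x \<in> N \<Longrightarrow> y \<in> N \<Longrightarrow> x \<ominus>\<^bsub>M\<^esub> y \<in> N"
    using M.submoduleE[OF assms(2)] by (simp add: M.M.minus_eq)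
qed

lemma lin_span_submodule:
  assumes "module K M" "X \<subseteq> carrier M"
  shows "submodule (lin_span K M X) K M"
proof -
  interpret M: module K M by fact
  have "lin_span K M X \<subseteq> carrier M"
    by (rule lin_span_least[OF M.carrier_is_submodule assms(2)])
  then show ?thesis
    by (rule M.submoduleI) (simp_all add: lin_span_def submodule_memD[OF assms(1)])
qed

text \<open>A quotient algebra repackages the fields of the quotient ring in a module record; being
  a ring depends on these fields alone and so carries over.\<close>

lemma ring_cong:
  assumes "ring R" "carrier S = carrier R" "mult S = mult R" "one S = one R" "zero S = zero R" "add S = add R"
  shows "ring S"
proof -
  interpret R: ring R by fact
  have "\<exists>y\<in>carrier R. y \<oplus>\<^bsub>R\<^esub> x = \<zero>\<^bsub>R\<^esub>" if "x \<in> carrier R" for x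
    using R.l_neg[OF that] R.a_inv_closed[OF that] by blast
  then have "abelian_group S"
    by (intro abelian_groupI) (simp_all add: assms R.a_ac)
  moreover have "Group.monoid S"
    by (intro monoidI) (simp_all add: assms R.m_assoc)
  ultimately show ?thesis
    by (intro ringI) (simp_all add: assms R.l_distr R.r_distr)
qed

text \<open>Because \<open>c x = (c 1) x\<close>, two-sided ideals of a unital algebra are
  subspaces; this lets ideals be handled as submodules throughout.\<close>

lemma ideal_smult_closed:
  assumes "k_algebra K A" "ideal I A" "c \<in> carrier K" "x \<in> I"
  shows "c \<odot>\<^bsub>A\<^esub> x \<in> I"
proof -
  interpret A: ring A using k_algebraD[OF assms(1)] by simp
  interpret M: module K A using k_algebraD[OF assms(1)] by simp
  interpret I: ideal I A by fact
  have "c \<odot>\<^bsub>A\<^esub> x = (c \<odot>\<^bsub>A\<^esub> \<one>\<^bsub>A\<^esub>) \<otimes>\<^bsub>A\<^esub> x"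
    using k_algebra_smult(1)[OF assms(1,3), of "\<one>\<^bsub>A\<^esub>" x] I.Icarr[OF assms(4)] by simp
  then show ?thesis using I.I_l_closed[OF assms(4)] assms(3) by simp
qed

section \<open>Quotients by ideals\<close>

lemma quot_algebra_simps:
  "carrier (quot_algebra A I) = (\<lambda>x. I +>\<^bsub>A\<^esub> x) ` carrier A"
  "zero (quot_algebra A I) = I" "one (quot_algebra A I) = I +>\<^bsub>A\<^esub> \<one>\<^bsub>A\<^esub>"
  "mult (quot_algebra A I) = rcoset_mult A I"
  by (auto simp: quot_algebra_def FactRing_def A_RCOSETS_def')

lemma (in ideal) coset_eq_iff:
  assumes "x \<in> carrier R" "y \<in> carrier R"
  shows "I +> x = I +> y \<longleftrightarrow> x \<ominus> y \<in> I"
  using assms quotient_eq_iff_same_a_r_cos[OF is_ideal] by simp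

lemma quot_algebra_ops:
  assumes "k_algebra K A" "ideal I A" "x \<in> carrier A" "y \<in> carrier A" 
  shows "(I +>\<^bsub>A\<^esub> x) \<oplus>\<^bsub>quot_algebra A I\<^esub> (I +>\<^bsub>A\<^esub> y) = I +>\<^bsub>A\<^esub> (x \<oplus>\<^bsub>A\<^esub> y)"
    "(I +>\<^bsub>A\<^esub> x) \<otimes>\<^bsub>quot_algebra A I\<^esub> (I +>\<^bsub>A\<^esub> y) = I +>\<^bsub>A\<^esub> (x \<otimes>\<^bsub>A\<^esub> y)"
    "c \<in> carrier K \<Longrightarrow> c \<odot>\<^bsub>quot_algebra A I\<^esub> (I +>\<^bsub>A\<^esub> x) = I +>\<^bsub>A\<^esub> (c \<odot>\<^bsub>A\<^esub> x)"
proof -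
  interpret I: ideal I A by fact
  interpret M: module K A using k_algebraD[OF assms(1)] by simp
  show "(I +>\<^bsub>A\<^esub> x) \<oplus>\<^bsub>quot_algebra A I\<^esub> (I +>\<^bsub>A\<^esub> y) = I +>\<^bsub>A\<^esub> (x \<oplus>\<^bsub>A\<^esub> y)"
    using assms by (simp add: quot_algebra_def FactRing_def I.a_rcos_sum)
  show "(I +>\<^bsub>A\<^esub> x) \<otimes>\<^bsub>quot_algebra A I\<^esub> (I +>\<^bsub>A\<^esub> y) = I +>\<^bsub>A\<^esub> (x \<otimes>\<^bsub>A\<^esub> y)"
    using assms by (simp add: quot_algebra_def FactRing_def I.rcoset_mult_add)
  assume c: "c \<in> carrier K"
  \<comment> \<open>A scalar multiple of a coset is a union over representatives. Since
    \<open>x' - x\<close> lies in the subspace \<open>I\<close>, all members of this union are the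
    same coset.\<close>
  have eq: "I +>\<^bsub>A\<^esub> (c \<odot>\<^bsub>A\<^esub> x') = I +>\<^bsub>A\<^esub> (c \<odot>\<^bsub>A\<^esub> x)" if "x' \<in> I +>\<^bsub>A\<^esub> x" for x'
  proof -
    have x': "x' \<in> carrier A" using I.a_elemrcos_carrier[OF assms(3) that] .
    have "x' \<ominus>\<^bsub>A\<^esub> x \<in> I" using I.a_rcos_module_minus[OF I.ring_axioms assms(3) x'] that by simp
    then have "c \<odot>\<^bsub>A\<^esub> (x' \<ominus>\<^bsub>A\<^esub> x) \<in> I" by (rule ideal_smult_closed[OF assms(1,2) c])
    moreover have "c \<odot>\<^bsub>A\<^esub> (x' \<ominus>\<^bsub>A\<^esub> x) = c \<odot>\<^bsub>A\<^esub> x' \<ominus>\<^bsub>A\<^esub> c \<odot>\<^bsub>A\<^esub> x"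
      using c x' assms(3) by (simp add: I.minus_eq M.smult_r_distr M.smult_r_minus)
    ultimately show ?thesis using c x' assms(3) by (simp add: I.coset_eq_iff)
  qed
  have "x \<in> I +>\<^bsub>A\<^esub> x" using I.a_rcos_self assms(3) .
  then have "(\<Union>x'\<in>I +>\<^bsub>A\<^esub> x. I +>\<^bsub>A\<^esub> (c \<odot>\<^bsub>A\<^esub> x')) = I +>\<^bsub>A\<^esub> (c \<odot>\<^bsub>A\<^esub> x)"
    using eq by (metis (no_types, lifting) SUP_eq_const empty_iff)
  then show "c \<odot>\<^bsub>quot_algebra A I\<^esub> (I +>\<^bsub>A\<^esub> x) = I +>\<^bsub>A\<^esub> (c \<odot>\<^bsub>A\<^esub> x)"
    by (simp add: quot_algebra_def)
qed

lemma quot_algebra_ring: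
  assumes "ideal I A" shows "ring (quot_algebra A I)"
  by (rule ring_cong[OF ideal.quotient_is_ring[OF assms]]) (auto simp: quot_algebra_def)

lemma quot_algebra_k_algebra:
  assumes "k_algebra K A" "ideal I A"
  shows "k_algebra K (quot_algebra A I)"
proof -
  interpret I: ideal I A by fact
  interpret M: module K A using k_algebraD[OF assms(1)] by simp
  interpret Q: ring "quot_algebra A I" by (rule quot_algebra_ring[OF assms(2)])
  note ops = quot_algebra_ops[OF assms]
  have "module K (quot_algebra A I)"
    by (rule moduleI[OF k_algebraD(2)[OF assms(1)] Q.is_abelian_group])
      (auto simp: quot_algebra_simps(1) ops M.smult_l_distr M.smult_r_distr M.smult_assoc1)
  then show ?thesis
    by (rule k_algebraI[OF k_algebraD(1)[OF assms(1)] Q.ring_axioms])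
      (auto simp: quot_algebra_simps(1) ops k_algebra_smult[OF assms(1)])
qed

lemma quot_algebra_lin_map:
  assumes "k_algebra K A" "ideal I A"
  shows "(+>\<^bsub>A\<^esub>) I \<in> lin_maps K A (quot_algebra A I)"
  by (rule lin_mapsI) (auto simp: quot_algebra_simps(1) quot_algebra_ops[OF assms])

section \<open>The algebra spanned by all paths\<close>

lemma (in abelian_monoid) finsum_single:
  assumes "finite I" "i \<in> I" "\<And>j. j \<in> I \<Longrightarrow> f j \<in> carrier G" "\<And>j. j \<in> I \<Longrightarrow> j \<noteq> i \<Longrightarrow> f j = \<zero>"
  shows "finsum G f I = f i"
proof -
  have "finsum G f I = (\<Oplus>j\<in>I. if j = i then f j else \<zero>)"
    using assms by (intro finsum_cong') auto
  also have "\<dots> = f i" using assms by (intro add.finprod_singleton_swap) auto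
  finally show ?thesis .
qed

locale path_data =
  fixes K :: "'k ring" and \<Delta> :: "('v, 'e) pre_digraph" and B :: "'v \<Rightarrow> ('k, 'b) module"
  assumes K_field: "field K" and fin_digraph: "fin_digraph \<Delta>"
    and B_alg: "v \<in> verts \<Delta> \<Longrightarrow> k_algebra K (B v)"
begin

sublocale K: field K by (rule K_field)
sublocale Q: fin_digraph \<Delta> by (rule fin_digraph)

abbreviation bp where "bp \<equiv> is_bpath \<Delta> B"
abbreviation F where "F \<equiv> free_bpath_algebra K \<Delta> B"
abbreviation bas where "bas \<equiv> bp_basis K"

lemma B_ring: "v \<in> verts \<Delta> \<Longrightarrow> ring (B v)" and B_module: "v \<in> verts \<Delta> \<Longrightarrow> module K (B v)"
  using B_alg k_algebraD by blast+

section \<open>Composition of paths\<close>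

lemma bp_start_vert: "bp p \<Longrightarrow> bp_start \<Delta> p \<in> verts \<Delta>"
  by (cases p) auto

lemma bp_end_vert: "bp p \<Longrightarrow> bp_end p \<in> verts \<Delta>"
  by (induct p) auto

lemma bp_mult_start: "bp_end p = bp_start \<Delta> q \<Longrightarrow> bp_start \<Delta> (bp_mult B p q) = bp_start \<Delta> p"
  and bp_mult_end: "bp_end p = bp_start \<Delta> q \<Longrightarrow> bp_end (bp_mult B p q) = bp_end q"
  and bp_mult_length: "bp_length (bp_mult B p q) = bp_length p + bp_length q"
  by (induct B p q rule: bp_mult.induct) auto

lemma bp_mult_bp: "bp p \<Longrightarrow> bp q \<Longrightarrow> bp_end p = bp_start \<Delta> q \<Longrightarrow> bp (bp_mult B p q)"
proof (induct p)
  case (Triv v a)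
  then interpret ring "B v" using B_ring by simp
  show ?case using Triv m_closed by (cases q) auto
qed (auto simp: bp_mult_start)

text \<open>The recursion walks along \<open>p\<close> and multiplies entries only at its last one,
  the \<open>Triv\<close> case. There the claim is associativity in \<open>B v\<close> if
  \<open>q\<close> has length 0, and both sides agree outright otherwise.\<close>

lemma bp_mult_assoc:
  "bp p \<Longrightarrow> bp q \<Longrightarrow> bp r \<Longrightarrow> bp_end p = bp_start \<Delta> q \<Longrightarrow> bp_end q = bp_start \<Delta> r \<Longrightarrow>
    bp_mult B (bp_mult B p q) r = bp_mult B p (bp_mult B q r)"
proof (induct p)
  case (Triv v a)
  then interpret ring "B v" using B_ring by simp
  show ?case using Triv m_assoc by (cases q; cases r) auto
qed auto

lemma bp_mult_unit_left: "bp p \<Longrightarrow> bp_mult B (Triv (bp_start \<Delta> p) \<one>\<^bsub>B (bp_start \<Delta> p)\<^esub>) p = p"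
proof -
  assume p: "bp p"
  then interpret ring "B (bp_start \<Delta> p)" using B_ring bp_start_vert by simp
  show ?thesis using p l_one by (cases p) auto
qed

lemma bp_mult_unit_right: "bp p \<Longrightarrow> bp_mult B p (Triv (bp_end p) \<one>\<^bsub>B (bp_end p)\<^esub>) = p"
proof (induct p)
  case (Triv v a)
  then interpret ring "B v" using B_ring by simp
  show ?case using Triv by auto
qed auto

section \<open>The space of finitely supported functions on paths\<close>

lemma F_carrier: "f \<in> carrier F \<longleftrightarrow>
    (\<forall>p. f p \<in> carrier K) \<and> finite {p. f p \<noteq> \<zero>\<^bsub>K\<^esub>} \<and> (\<forall>p. f p \<noteq> \<zero>\<^bsub>K\<^esub> \<longrightarrow> bp p)"
  by (auto simp: free_bpath_algebra_def)

lemma F_simps: "\<zero>\<^bsub>F\<^esub> = (\<lambda>p. \<zero>\<^bsub>K\<^esub>)" "f \<oplus>\<^bsub>F\<^esub> g = (\<lambda>p. f p \<oplus>\<^bsub>K\<^esub> g p)" "c \<odot>\<^bsub>F\<^esub> f = (\<lambda>p. c \<otimes>\<^bsub>K\<^esub> f p)"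
  by (simp_all add: free_bpath_algebra_def)

lemma F_closed: "f \<in> carrier F \<Longrightarrow> f p \<in> carrier K"
  and F_finite: "f \<in> carrier F \<Longrightarrow> finite {p. f p \<noteq> \<zero>\<^bsub>K\<^esub>}"
  and F_bp: "f \<in> carrier F \<Longrightarrow> f p \<noteq> \<zero>\<^bsub>K\<^esub> \<Longrightarrow> bp p"
  by (auto simp: F_carrier)

lemma F_add_closed: "f \<in> carrier F \<Longrightarrow> g \<in> carrier F \<Longrightarrow> f \<oplus>\<^bsub>F\<^esub> g \<in> carrier F"
proof -
  assume f: "f \<in> carrier F" and g: "g \<in> carrier F"
  have "{p. f p \<oplus>\<^bsub>K\<^esub> g p \<noteq> \<zero>\<^bsub>K\<^esub>} \<subseteq> {p. f p \<noteq> \<zero>\<^bsub>K\<^esub>} \<union> {p. g p \<noteq> \<zero>\<^bsub>K\<^esub>}" by auto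
  then have "finite {p. f p \<oplus>\<^bsub>K\<^esub> g p \<noteq> \<zero>\<^bsub>K\<^esub>}"
    using F_finite[OF f] F_finite[OF g] finite_subset by (meson finite_UnI)
  moreover have "bp p" if "f p \<oplus>\<^bsub>K\<^esub> g p \<noteq> \<zero>\<^bsub>K\<^esub>" for p
    using F_bp[OF f, of p] F_bp[OF g, of p] that by fastforce
  ultimately show ?thesis
    unfolding F_carrier F_simps using F_closed[OF f] F_closed[OF g] by auto
qed

lemma F_smult_closed: "c \<in> carrier K \<Longrightarrow> f \<in> carrier F \<Longrightarrow> c \<odot>\<^bsub>F\<^esub> f \<in> carrier F"
proof -
  assume c: "c \<in> carrier K" and f: "f \<in> carrier F"
  have "{p. c \<otimes>\<^bsub>K\<^esub> f p \<noteq> \<zero>\<^bsub>K\<^esub>} \<subseteq> {p. f p \<noteq> \<zero>\<^bsub>K\<^esub>}" using c by auto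
  then have "finite {p. c \<otimes>\<^bsub>K\<^esub> f p \<noteq> \<zero>\<^bsub>K\<^esub>}" using F_finite[OF f] finite_subset by blast
  moreover have "bp p" if "c \<otimes>\<^bsub>K\<^esub> f p \<noteq> \<zero>\<^bsub>K\<^esub>" for p
    using F_bp[OF f, of p] c that by fastforce
  ultimately show ?thesis unfolding F_carrier F_simps using F_closed[OF f] c by auto
qed

lemma F_module: "module K F"
proof (rule moduleI[OF K.is_cring])
  have neg: "\<exists>g\<in>carrier F. g \<oplus>\<^bsub>F\<^esub> f = \<zero>\<^bsub>F\<^esub>" if f: "f \<in> carrier F" for f
  proof
    show "(\<ominus>\<^bsub>K\<^esub> \<one>\<^bsub>K\<^esub>) \<odot>\<^bsub>F\<^esub> f \<in> carrier F" using f by (intro F_smult_closed) auto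
    show "(\<ominus>\<^bsub>K\<^esub> \<one>\<^bsub>K\<^esub>) \<odot>\<^bsub>F\<^esub> f \<oplus>\<^bsub>F\<^esub> f = \<zero>\<^bsub>F\<^esub>"
      using F_closed[OF f] by (simp add: F_simps K.l_minus K.l_neg)
  qed
  have zero: "\<zero>\<^bsub>F\<^esub> \<in> carrier F" by (simp add: F_carrier F_simps)
  show "abelian_group F"
    by (rule abelian_groupI)
      (use neg zero in \<open>auto simp: F_add_closed\<close>, auto simp: F_simps F_closed K.a_ac)
qed (simp_all add: F_smult_closed, simp_all add: F_simps F_closed K.l_distr K.r_distr K.m_assoc)

sublocale F: module K F by (rule F_module)

lemma bas_closed: "bp p \<Longrightarrow> bas p \<in> carrier F"
  by (auto simp: F_carrier bp_basis_def)

text \<open>Peels one path off the support: with \<open>g = f(p := 0)\<close> the function is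
  \<open>f p\<close> times the basis vector of \<open>p\<close>, plus \<open>g\<close>, whose
  support is smaller by one. Identities linear in \<open>f\<close> thereby reduce to single
  paths.\<close>

lemma F_induct [consumes 1, case_names zero add]:
  assumes f: "f \<in> carrier F" and z: "P \<zero>\<^bsub>F\<^esub>"
    and s: "\<And>c p f. c \<in> carrier K \<Longrightarrow> bp p \<Longrightarrow> f \<in> carrier F \<Longrightarrow> P f \<Longrightarrow> P (c \<odot>\<^bsub>F\<^esub> bas p \<oplus>\<^bsub>F\<^esub> f)"
  shows "P f"
  using f
proof (induct "card {p. f p \<noteq> \<zero>\<^bsub>K\<^esub>}" arbitrary: f)
  case 0
  then have "f = \<zero>\<^bsub>F\<^esub>" using F_finite[OF 0(2)] by (auto simp: F_simps)
  then show ?case using z by simp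
next
  case (Suc n)
  then obtain p where p: "f p \<noteq> \<zero>\<^bsub>K\<^esub>" by (metis (mono_tags) card.empty empty_Collect_eq old.nat.distinct(1))
  define g where "g = f(p := \<zero>\<^bsub>K\<^esub>)"
  have supp: "{q. g q \<noteq> \<zero>\<^bsub>K\<^esub>} = {q. f q \<noteq> \<zero>\<^bsub>K\<^esub>} - {p}" by (auto simp: g_def)
  have g: "g \<in> carrier F"
    using Suc.prems supp unfolding F_carrier by (auto simp: g_def)
  have "card {q. g q \<noteq> \<zero>\<^bsub>K\<^esub>} = n" using supp Suc.hyps(2) p F_finite[OF Suc.prems] by simp
  then have "P g" using Suc.hyps(1) g by simp
  then have "P (f p \<odot>\<^bsub>F\<^esub> bas p \<oplus>\<^bsub>F\<^esub> g)"
    using s g F_closed[OF Suc.prems] F_bp[OF Suc.prems p] by simp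
  moreover have "f p \<odot>\<^bsub>F\<^esub> bas p \<oplus>\<^bsub>F\<^esub> g = f"
    using F_closed[OF Suc.prems] by (auto simp: F_simps bp_basis_def g_def)
  ultimately show ?case by simp
qed

text \<open>The defining sum runs over an index set that depends on \<open>f\<close>,
  \<open>g\<close> and \<open>p\<close> at once. Extending it by zeros to a fixed rectangle
  \<open>X \<times> Y\<close> allows sums for different functions to be compared term by term, which
  yields distributivity and compatibility with scalars.\<close>

lemma F_mult_eq:
  assumes f: "f \<in> carrier F" and g: "g \<in> carrier F"
    and X: "finite X" "{p. f p \<noteq> \<zero>\<^bsub>K\<^esub>} \<subseteq> X" and Y: "finite Y" "{p. g p \<noteq> \<zero>\<^bsub>K\<^esub>} \<subseteq> Y"
  shows "(f \<otimes>\<^bsub>F\<^esub> g) p = (\<Oplus>\<^bsub>K\<^esub>z\<in>X \<times> Y.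
    if bp_end (fst z) = bp_start \<Delta> (snd z) \<and> bp_mult B (fst z) (snd z) = p then f (fst z) \<otimes>\<^bsub>K\<^esub> g (snd z) else \<zero>\<^bsub>K\<^esub>)"
  unfolding free_bpath_algebra_def monoid.simps
  by (rule K.add.finprod_mono_neutral_cong_left)
    (use X Y F_closed[OF f] F_closed[OF g] in \<open>auto split: if_splits\<close>)

lemma F_mult_closed:
  assumes f: "f \<in> carrier F" and g: "g \<in> carrier F"
  shows "f \<otimes>\<^bsub>F\<^esub> g \<in> carrier F"
proof -
  let ?X = "{p. f p \<noteq> \<zero>\<^bsub>K\<^esub>}" and ?Y = "{p. g p \<noteq> \<zero>\<^bsub>K\<^esub>}"
  note eq = F_mult_eq[OF f g F_finite[OF f] order.refl F_finite[OF g] order.refl]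
  have supp: "\<exists>q\<in>?X. \<exists>r\<in>?Y. bp_end q = bp_start \<Delta> r \<and> bp_mult B q r = p" if p: "(f \<otimes>\<^bsub>F\<^esub> g) p \<noteq> \<zero>\<^bsub>K\<^esub>" for p
  proof (rule ccontr)
    assume "\<not> ?thesis"
    then have "(f \<otimes>\<^bsub>F\<^esub> g) p = \<zero>\<^bsub>K\<^esub>"
      unfolding eq by (intro K.add.finprod_one_eqI) fastforce
    then show False using p by simp
  qed
  then have "{p. (f \<otimes>\<^bsub>F\<^esub> g) p \<noteq> \<zero>\<^bsub>K\<^esub>} \<subseteq> (\<lambda>(q, r). bp_mult B q r) ` (?X \<times> ?Y)" by fastforce
  then have "finite {p. (f \<otimes>\<^bsub>F\<^esub> g) p \<noteq> \<zero>\<^bsub>K\<^esub>}"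
    using F_finite[OF f] F_finite[OF g] by (meson finite_SigmaI finite_imageI finite_subset)
  moreover have "bp p" if "(f \<otimes>\<^bsub>F\<^esub> g) p \<noteq> \<zero>\<^bsub>K\<^esub>" for p
    using supp[OF that] bp_mult_bp F_bp[OF f] F_bp[OF g] by auto
  moreover have "(f \<otimes>\<^bsub>F\<^esub> g) p \<in> carrier K" for p
    unfolding eq using F_closed[OF f] F_closed[OF g] by (intro K.finsum_closed) auto
  ultimately show ?thesis unfolding F_carrier by blast
qed

lemma F_l_distr:
  assumes f: "f \<in> carrier F" and g: "g \<in> carrier F" and h: "h \<in> carrier F"
  shows "(f \<oplus>\<^bsub>F\<^esub> g) \<otimes>\<^bsub>F\<^esub> h = f \<otimes>\<^bsub>F\<^esub> h \<oplus>\<^bsub>F\<^esub> g \<otimes>\<^bsub>F\<^esub> h"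
proof
  fix p
  \<comment> \<open>One rectangle for all three products: it covers the supports of
    \<open>f\<close>, of \<open>g\<close> and of their sum.\<close>
  let ?X = "{p. f p \<noteq> \<zero>\<^bsub>K\<^esub>} \<union> {p. g p \<noteq> \<zero>\<^bsub>K\<^esub>}" and ?Y = "{p. h p \<noteq> \<zero>\<^bsub>K\<^esub>}"
  have X: "finite ?X" using F_finite f g by blast
  have s: "{p. (f \<oplus>\<^bsub>F\<^esub> g) p \<noteq> \<zero>\<^bsub>K\<^esub>} \<subseteq> ?X" by (auto simp: F_simps)
  show "((f \<oplus>\<^bsub>F\<^esub> g) \<otimes>\<^bsub>F\<^esub> h) p = (f \<otimes>\<^bsub>F\<^esub> h \<oplus>\<^bsub>F\<^esub> g \<otimes>\<^bsub>F\<^esub> h) p"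
    unfolding F_simps(2)[of "f \<otimes>\<^bsub>F\<^esub> h"] F_mult_eq[OF F_add_closed[OF f g] h X s F_finite[OF h] order.refl]
      F_mult_eq[OF f h X Un_upper1 F_finite[OF h] order.refl] F_mult_eq[OF g h X Un_upper2 F_finite[OF h] order.refl]
    using F_closed[OF f] F_closed[OF g] F_closed[OF h]
    by (intro trans[OF K.finsum_cong' K.finsum_addf]) (auto simp: F_simps K.l_distr)
qed

lemma F_r_distr:
  assumes f: "f \<in> carrier F" and g: "g \<in> carrier F" and h: "h \<in> carrier F"
  shows "h \<otimes>\<^bsub>F\<^esub> (f \<oplus>\<^bsub>F\<^esub> g) = h \<otimes>\<^bsub>F\<^esub> f \<oplus>\<^bsub>F\<^esub> h \<otimes>\<^bsub>F\<^esub> g"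
proof
  fix p
  let ?X = "{p. f p \<noteq> \<zero>\<^bsub>K\<^esub>} \<union> {p. g p \<noteq> \<zero>\<^bsub>K\<^esub>}" and ?Y = "{p. h p \<noteq> \<zero>\<^bsub>K\<^esub>}"
  have X: "finite ?X" using F_finite f g by blast
  have s: "{p. (f \<oplus>\<^bsub>F\<^esub> g) p \<noteq> \<zero>\<^bsub>K\<^esub>} \<subseteq> ?X" by (auto simp: F_simps)
  show "(h \<otimes>\<^bsub>F\<^esub> (f \<oplus>\<^bsub>F\<^esub> g)) p = (h \<otimes>\<^bsub>F\<^esub> f \<oplus>\<^bsub>F\<^esub> h \<otimes>\<^bsub>F\<^esub> g) p"
    unfolding F_simps(2)[of "h \<otimes>\<^bsub>F\<^esub> f"] F_mult_eq[OF h F_add_closed[OF f g] F_finite[OF h] order.refl X s]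
      F_mult_eq[OF h f F_finite[OF h] order.refl X Un_upper1] F_mult_eq[OF h g F_finite[OF h] order.refl X Un_upper2]
    using F_closed[OF f] F_closed[OF g] F_closed[OF h]
    by (intro trans[OF K.finsum_cong' K.finsum_addf]) (auto simp: F_simps K.r_distr)
qed

lemma F_smult_mult:
  assumes c: "c \<in> carrier K" and f: "f \<in> carrier F" and g: "g \<in> carrier F"
  shows "(c \<odot>\<^bsub>F\<^esub> f) \<otimes>\<^bsub>F\<^esub> g = c \<odot>\<^bsub>F\<^esub> (f \<otimes>\<^bsub>F\<^esub> g)" "f \<otimes>\<^bsub>F\<^esub> (c \<odot>\<^bsub>F\<^esub> g) = c \<odot>\<^bsub>F\<^esub> (f \<otimes>\<^bsub>F\<^esub> g)"
proof -
  have s: "{p. (c \<odot>\<^bsub>F\<^esub> h) p \<noteq> \<zero>\<^bsub>K\<^esub>} \<subseteq> {p. h p \<noteq> \<zero>\<^bsub>K\<^esub>}" for h using c by (auto simp: F_simps)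
  show "(c \<odot>\<^bsub>F\<^esub> f) \<otimes>\<^bsub>F\<^esub> g = c \<odot>\<^bsub>F\<^esub> (f \<otimes>\<^bsub>F\<^esub> g)"
  proof
    fix p
    show "((c \<odot>\<^bsub>F\<^esub> f) \<otimes>\<^bsub>F\<^esub> g) p = (c \<odot>\<^bsub>F\<^esub> (f \<otimes>\<^bsub>F\<^esub> g)) p"
      unfolding F_simps(3)[of c "f \<otimes>\<^bsub>F\<^esub> g"] F_mult_eq[OF F_smult_closed[OF c f] g F_finite[OF f] s F_finite[OF g] order.refl]
        F_mult_eq[OF f g F_finite[OF f] order.refl F_finite[OF g] order.refl]
      using F_closed[OF f] F_closed[OF g] c F_finite[OF f] F_finite[OF g]
      by (subst K.finsum_rdistr) (auto intro!: K.finsum_cong' simp: F_simps K.m_assoc)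
  qed
  show "f \<otimes>\<^bsub>F\<^esub> (c \<odot>\<^bsub>F\<^esub> g) = c \<odot>\<^bsub>F\<^esub> (f \<otimes>\<^bsub>F\<^esub> g)"
  proof
    fix p
    show "(f \<otimes>\<^bsub>F\<^esub> (c \<odot>\<^bsub>F\<^esub> g)) p = (c \<odot>\<^bsub>F\<^esub> (f \<otimes>\<^bsub>F\<^esub> g)) p"
      unfolding F_simps(3)[of c "f \<otimes>\<^bsub>F\<^esub> g"] F_mult_eq[OF f F_smult_closed[OF c g] F_finite[OF f] order.refl F_finite[OF g] s]
        F_mult_eq[OF f g F_finite[OF f] order.refl F_finite[OF g] order.refl]
      using F_closed[OF f] F_closed[OF g] c F_finite[OF f] F_finite[OF g]
      by (subst K.finsum_rdistr) (auto intro!: K.finsum_cong' simp: F_simps K.m_lcomm)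
  qed
qed

lemma bas_supp: "{q. bas p q \<noteq> \<zero>\<^bsub>K\<^esub>} = {p}"
  by (auto simp: bp_basis_def)

lemma F_mult_bas:
  assumes p: "bp p" and q: "bp q"
  shows "bas p \<otimes>\<^bsub>F\<^esub> bas q = (if bp_end p = bp_start \<Delta> q then bas (bp_mult B p q) else \<zero>\<^bsub>F\<^esub>)"
proof
  fix r
  show "(bas p \<otimes>\<^bsub>F\<^esub> bas q) r = (if bp_end p = bp_start \<Delta> q then bas (bp_mult B p q) else \<zero>\<^bsub>F\<^esub>) r"
    by (subst F_mult_eq[of _ _ "{p}" "{q}"]) (auto simp: p q bas_closed bas_supp, auto simp: bp_basis_def F_simps)
qed

lemma F_mult_zero: "f \<in> carrier F \<Longrightarrow> \<zero>\<^bsub>F\<^esub> \<otimes>\<^bsub>F\<^esub> f = \<zero>\<^bsub>F\<^esub>" "f \<in> carrier F \<Longrightarrow> f \<otimes>\<^bsub>F\<^esub> \<zero>\<^bsub>F\<^esub> = \<zero>\<^bsub>F\<^esub>"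
proof -
  assume f: "f \<in> carrier F"
  show "\<zero>\<^bsub>F\<^esub> \<otimes>\<^bsub>F\<^esub> f = \<zero>\<^bsub>F\<^esub>"
    using F_smult_mult(1)[OF K.zero_closed F.M.zero_closed f] F_mult_closed[OF F.M.zero_closed f] by simp
  show "f \<otimes>\<^bsub>F\<^esub> \<zero>\<^bsub>F\<^esub> = \<zero>\<^bsub>F\<^esub>"
    using F_smult_mult(2)[OF K.zero_closed f F.M.zero_closed] F_mult_closed[OF f F.M.zero_closed] by simp
qed

text \<open>Both sides are linear in each factor, so three nested inductions reduce the claim to
  basis vectors. There both sides vanish unless \<open>p\<close>, \<open>q\<close>, \<open>r\<close>
  are composable in this order.\<close>

lemma F_m_assoc:
  assumes f: "f \<in> carrier F" and g: "g \<in> carrier F" and h: "h \<in> carrier F"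
  shows "(f \<otimes>\<^bsub>F\<^esub> g) \<otimes>\<^bsub>F\<^esub> h = f \<otimes>\<^bsub>F\<^esub> (g \<otimes>\<^bsub>F\<^esub> h)"
  using f
proof (induct f rule: F_induct)
  case (add c p f)
  have "(bas p \<otimes>\<^bsub>F\<^esub> g) \<otimes>\<^bsub>F\<^esub> h = bas p \<otimes>\<^bsub>F\<^esub> (g \<otimes>\<^bsub>F\<^esub> h)" if p: "bp p"
    using g
  proof (induct g rule: F_induct)
    case (add d q g)
    have "(bas p \<otimes>\<^bsub>F\<^esub> bas q) \<otimes>\<^bsub>F\<^esub> h = bas p \<otimes>\<^bsub>F\<^esub> (bas q \<otimes>\<^bsub>F\<^esub> h)" if q: "bp q"
      using h
    proof (induct h rule: F_induct)
      case (add e r h)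
      have "(bas p \<otimes>\<^bsub>F\<^esub> bas q) \<otimes>\<^bsub>F\<^esub> bas r = bas p \<otimes>\<^bsub>F\<^esub> (bas q \<otimes>\<^bsub>F\<^esub> bas r)"
        using p q add(2)
        by (simp add: F_mult_bas F_mult_zero bas_closed bp_mult_bp bp_mult_start bp_mult_end bp_mult_assoc)
      then show ?case
        using add p q by (simp add: F_r_distr F_smult_mult F_mult_closed F_smult_closed bas_closed)
    qed (simp_all add: F_mult_zero F_mult_closed bas_closed p q)
    then show ?case
      using add p h by (simp add: F_r_distr F_l_distr F_smult_mult F_mult_closed F_smult_closed bas_closed)
  qed (simp_all add: F_mult_zero F_mult_closed bas_closed p h)
  then show ?case
    using add g h by (simp add: F_l_distr F_smult_mult F_mult_closed F_smult_closed bas_closed)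
qed (simp_all add: F_mult_zero F_mult_closed bas_closed g h)

section \<open>The identity as a sum of vertex idempotents\<close>

abbreviation triv1 where "triv1 v \<equiv> Triv v \<one>\<^bsub>B v\<^esub>"

lemma triv1_bp: "v \<in> verts \<Delta> \<Longrightarrow> bp (triv1 v)"
  using ring.ring_simprules(6)[OF B_ring] by simp

lemma F_one_eq: "\<one>\<^bsub>F\<^esub> = (\<lambda>p. if p \<in> triv1 ` verts \<Delta> then \<one>\<^bsub>K\<^esub> else \<zero>\<^bsub>K\<^esub>)"
  by (auto simp: free_bpath_algebra_def image_iff)

lemma F_one_closed: "\<one>\<^bsub>F\<^esub> \<in> carrier F"
  unfolding F_carrier F_one_eq using triv1_bp by auto

lemma F_one_finsum: "\<one>\<^bsub>F\<^esub> = (\<Oplus>\<^bsub>F\<^esub>v\<in>verts \<Delta>. bas (triv1 v))"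
proof -
  \<comment> \<open>Stated for all subsets \<open>V\<close> to allow induction. Paths of length 0
    carry their vertex, so different vertices contribute at different paths and no coefficients add
    up.\<close>
  have fin: "(\<Oplus>\<^bsub>F\<^esub>v\<in>V. bas (triv1 v)) = (\<lambda>p. if p \<in> triv1 ` V then \<one>\<^bsub>K\<^esub> else \<zero>\<^bsub>K\<^esub>)" if "finite V" "V \<subseteq> verts \<Delta>" for V
    using that
  proof (induct V)
    case (insert v V)
    then have "(\<Oplus>\<^bsub>F\<^esub>v\<in>insert v V. bas (triv1 v)) = bas (triv1 v) \<oplus>\<^bsub>F\<^esub> (\<Oplus>\<^bsub>F\<^esub>v\<in>V. bas (triv1 v))"
      by (intro F.M.finsum_insert) (auto intro!: bas_closed triv1_bp simp del: is_bpath.simps)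
    then show ?case using insert by (auto simp: F_simps bp_basis_def)
  qed (simp add: F_simps)
  show ?thesis unfolding F_one_eq using fin[OF Q.finite_verts order.refl] by simp
qed

lemma F_one_mult: 
  assumes "f \<in> carrier F"
  shows "\<one>\<^bsub>F\<^esub> \<otimes>\<^bsub>F\<^esub> f = f" "f \<otimes>\<^bsub>F\<^esub> \<one>\<^bsub>F\<^esub> = f"
proof -
  have lin: "(\<lambda>f. f \<otimes>\<^bsub>F\<^esub> g) \<in> lin_maps K F F" "(\<lambda>f. g \<otimes>\<^bsub>F\<^esub> f) \<in> lin_maps K F F" if "g \<in> carrier F" for g
    using that by (auto intro!: lin_mapsI simp: F_mult_closed F_l_distr F_r_distr F_smult_mult)
  have tc: "(\<lambda>v. bas (triv1 v)) \<in> verts \<Delta> \<rightarrow> carrier F"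
    using triv1_bp bas_closed by auto
  have l: "\<one>\<^bsub>F\<^esub> \<otimes>\<^bsub>F\<^esub> bas p = bas p" if p: "bp p" for p
  proof -
    have "\<one>\<^bsub>F\<^esub> \<otimes>\<^bsub>F\<^esub> bas p = (\<Oplus>\<^bsub>F\<^esub>v\<in>verts \<Delta>. bas (triv1 v) \<otimes>\<^bsub>F\<^esub> bas p)"
      unfolding F_one_finsum by (rule lin_maps_finsum[OF F_module F_module lin(1)[OF bas_closed[OF p]] tc])
    \<comment> \<open>Only the start vertex of \<open>p\<close> survives: the other vertex
      idempotents do not compose with \<open>p\<close>.\<close>
    also have "\<dots> = bas (triv1 (bp_start \<Delta> p)) \<otimes>\<^bsub>F\<^esub> bas p"
      using p triv1_bp bp_start_vert[OF p]
      by (intro F.M.finsum_single) (auto simp: F_mult_bas bas_closed bp_mult_bp simp del: is_bpath.simps)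
    also have "\<dots> = bas p"
      using p triv1_bp[OF bp_start_vert[OF p]] by (simp add: F_mult_bas bp_mult_unit_left)
    finally show ?thesis .
  qed
  have r: "bas p \<otimes>\<^bsub>F\<^esub> \<one>\<^bsub>F\<^esub> = bas p" if p: "bp p" for p
  proof -
    have "bas p \<otimes>\<^bsub>F\<^esub> \<one>\<^bsub>F\<^esub> = (\<Oplus>\<^bsub>F\<^esub>v\<in>verts \<Delta>. bas p \<otimes>\<^bsub>F\<^esub> bas (triv1 v))"
      unfolding F_one_finsum by (rule lin_maps_finsum[OF F_module F_module lin(2)[OF bas_closed[OF p]] tc])
    also have "\<dots> = bas p \<otimes>\<^bsub>F\<^esub> bas (triv1 (bp_end p))"
      using p triv1_bp bp_end_vert[OF p]
      by (intro F.M.finsum_single) (auto simp: F_mult_bas bas_closed bp_mult_bp simp del: is_bpath.simps)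
    also have "\<dots> = bas p"
      using p triv1_bp[OF bp_end_vert[OF p]] by (simp add: F_mult_bas bp_mult_unit_right)
    finally show ?thesis .
  qed
  show "\<one>\<^bsub>F\<^esub> \<otimes>\<^bsub>F\<^esub> f = f" using assms
    by (induct f rule: F_induct)
      (simp_all add: F_mult_zero F_one_closed F_r_distr F_smult_mult F_smult_closed bas_closed l)
  show "f \<otimes>\<^bsub>F\<^esub> \<one>\<^bsub>F\<^esub> = f" using assms
    by (induct f rule: F_induct)
      (simp_all add: F_mult_zero F_one_closed F_l_distr F_smult_mult F_smult_closed bas_closed r)
qed

lemma F_k_algebra: "k_algebra K F"
proof (rule k_algebraI[OF K_field _ F_module])
  have "Group.monoid F"
    by (rule monoidI) (simp_all add: F_mult_closed F_one_closed F_m_assoc F_one_mult)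
  then show "ring F"
    by (intro ringI F.M.abelian_group_axioms) (simp_all add: F_l_distr F_r_distr)
qed (simp_all add: F_smult_mult)

end

section \<open>Multilinear maps on paths\<close>

text \<open>With \<open>lin_span_least\<close> this acts as induction over spans: that a linear map
  sends a span into a given submodule needs to be checked on generators only.\<close>

lemma submodule_vimage:
  assumes "module K M" "module K N" "h \<in> lin_maps K M N" "submodule P K N"
  shows "submodule {x \<in> carrier M. h x \<in> P} K M"
proof -
  interpret M: module K M by fact
  interpret N: module K N by fact
  note P = submodule_memD[OF assms(2,4)]
  show ?thesis
    by (rule M.submoduleI)
      (auto simp: lin_maps_zero[OF assms(1-3)] lin_maps_uminus[OF assms(1-3)] lin_maps_add[OF assms(3)]
        lin_maps_smult[OF assms(3)] P)
qed

lemma (in abelian_group) eq_if_minus_eq_zero: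
  assumes "a \<in> carrier G" "b \<in> carrier G" "a \<ominus> b = \<zero>"
  shows "a = b"
proof -
  have "a = (a \<ominus> b) \<oplus> b" using assms(1,2) by (simp add: minus_eq a_assoc l_neg)
  then show ?thesis using assms by simp
qed

text \<open>The homomorphism theorem for an arbitrary surjection \<open>h\<close>, which spares
  identifying \<open>N\<close> with a quotient of \<open>M\<close>.\<close>

lemma lin_map_factor:
  assumes M: "module K M" and N: "module K N" and V: "module K V"
    and h: "h \<in> lin_maps K M N" "h ` carrier M = carrier N" and L: "L \<in> lin_maps K M V"
    and ker: "\<And>x. x \<in> carrier M \<Longrightarrow> h x = \<zero>\<^bsub>N\<^esub> \<Longrightarrow> L x = \<zero>\<^bsub>V\<^esub>"
  shows "\<exists>\<phi>\<in>lin_maps K N V. \<forall>x\<in>carrier M. \<phi> (h x) = L x"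
proof -
  interpret M: module K M by fact
  interpret N: module K N by fact
  interpret V: module K V by fact
  \<comment> \<open>Any preimage will do: two of them differ by an element of the kernel of
    \<open>h\<close>, which \<open>L\<close> kills.\<close>
  define \<phi> where "\<phi> y = L (SOME x. x \<in> carrier M \<and> h x = y)" for y
  have \<phi>: "\<phi> (h x) = L x" if x: "x \<in> carrier M" for x
  proof -
    define x' where "x' = (SOME x'. x' \<in> carrier M \<and> h x' = h x)"
    have x': "x' \<in> carrier M" "h x' = h x"
      using someI[of "\<lambda>x'. x' \<in> carrier M \<and> h x' = h x" x] x by (auto simp: x'_def)
    have "h (x' \<ominus>\<^bsub>M\<^esub> x) = h x' \<ominus>\<^bsub>N\<^esub> h x"
      by (rule lin_maps_minus[OF M N h(1) x'(1) x])
    then have "h (x' \<ominus>\<^bsub>M\<^esub> x) = \<zero>\<^bsub>N\<^esub>"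
      using lin_maps_closed[OF h(1) x] by (simp add: x'(2) N.M.minus_eq N.M.r_neg)
    then have "L (x' \<ominus>\<^bsub>M\<^esub> x) = \<zero>\<^bsub>V\<^esub>"
      by (rule ker[OF M.M.minus_closed[OF x'(1) x]])
    then have "L x' \<ominus>\<^bsub>V\<^esub> L x = \<zero>\<^bsub>V\<^esub>"
      unfolding lin_maps_minus[OF M V L x'(1) x] .
    then have "L x' = L x"
      by (rule V.M.eq_if_minus_eq_zero[OF lin_maps_closed[OF L x'(1)] lin_maps_closed[OF L x]])
    then show ?thesis unfolding \<phi>_def x'_def .
  qed
  have "\<phi> \<in> lin_maps K N V"
  proof (rule lin_mapsI)
    fix x assume "x \<in> carrier N"
    then obtain x' where x': "x' \<in> carrier M" "x = h x'" unfolding h(2)[symmetric] by (rule imageE)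
    show "\<phi> x \<in> carrier V" unfolding x'(2) \<phi>[OF x'(1)] by (rule lin_maps_closed[OF L x'(1)])
    fix c assume "c \<in> carrier K"
    then show "\<phi> (c \<odot>\<^bsub>N\<^esub> x) = c \<odot>\<^bsub>V\<^esub> \<phi> x"
      using \<phi>[of "c \<odot>\<^bsub>M\<^esub> x'"] \<phi>[OF x'(1)] x'(1) unfolding x'(2)
      by (simp add: lin_maps_smult[OF h(1)] lin_maps_smult[OF L])
  next
    fix x y assume "x \<in> carrier N" "y \<in> carrier N"
    then obtain x' y' where x': "x' \<in> carrier M" "x = h x'" "y' \<in> carrier M" "y = h y'"
      unfolding h(2)[symmetric] by blast
    then show "\<phi> (x \<oplus>\<^bsub>N\<^esub> y) = \<phi> x \<oplus>\<^bsub>V\<^esub> \<phi> y"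
      using \<phi>[of "x' \<oplus>\<^bsub>M\<^esub> y'"] \<phi>[OF x'(1)] \<phi>[OF x'(3)]
      by (simp add: lin_maps_add[OF h(1)] lin_maps_add[OF L])
  qed
  with \<phi> show ?thesis by (intro bexI[of _ \<phi>] ballI)
qed

text \<open>Changing an entry leaves the arrows alone. So every relation imposed by multilinearity
  involves paths of one length with common end points, which makes it compatible with products and
  with length.\<close>

lemma entry_sum_same:
  "entry_sum \<Delta> B p p' p'' \<Longrightarrow> bp_start \<Delta> p' = bp_start \<Delta> p \<and> bp_start \<Delta> p'' = bp_start \<Delta> p \<and>
    bp_end p' = bp_end p \<and> bp_end p'' = bp_end p \<and> bp_length p' = bp_length p \<and> bp_length p'' = bp_length p"
  by (induct rule: entry_sum.induct) auto

lemma entry_smult_same: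
  "entry_smult \<Delta> B c p p' \<Longrightarrow>
    bp_start \<Delta> p' = bp_start \<Delta> p \<and> bp_end p' = bp_end p \<and> bp_length p' = bp_length p"
  by (induct rule: entry_smult.induct) auto

context path_data
begin

section \<open>The multilinearity relations form an ideal\<close>

lemma entry_sum_bp: "entry_sum \<Delta> B p p' p'' \<Longrightarrow> bp p \<Longrightarrow> bp p' \<Longrightarrow> bp p''"
proof (induct rule: entry_sum.induct)
  case (1 v a b)
  then interpret ring "B v" using B_ring by simp
  show ?case using 1 by simp
next
  case (2 a \<beta> p b)
  then interpret ring "B (tail \<Delta> \<beta>)" using B_ring by simp
  show ?case using 2 by simp
next
  case (3 p p' p'' a \<beta>)
  then show ?case using entry_sum_same[OF 3(1)] by simp
qed

lemma entry_smult_bp: "entry_smult \<Delta> B c p p' \<Longrightarrow> c \<in> carrier K \<Longrightarrow> bp p \<Longrightarrow> bp p'"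
proof (induct rule: entry_smult.induct)
  case (1 v a)
  then interpret module K "B v" using B_module by simp
  show ?case using 1 by simp
next
  case (2 a \<beta> p)
  then interpret module K "B (tail \<Delta> \<beta>)" using B_module by simp
  show ?case using 2 by simp
next
  case (3 p p' a \<beta>)
  then show ?case using entry_smult_same[OF 3(1)] by simp
qed

text \<open>Multiplying by \<open>q\<close> on the left alters only the first entry of
  \<open>p\<close>. If the paths differ in that entry, the claim is distributivity in
  \<open>B v\<close>; otherwise all three receive the same new first entry.\<close>

lemma entry_sum_mult_left:
  assumes "entry_sum \<Delta> B p p' p''" "bp p" "bp p'" "bp q" "bp_end q = bp_start \<Delta> p"
  shows "entry_sum \<Delta> B (bp_mult B q p) (bp_mult B q p') (bp_mult B q p'')"
  using assms(4,5)
proof (induct q)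
  case (Triv v a)
  then interpret ring "B v" using B_ring by simp
  have a: "a \<in> carrier (B v)" using Triv by simp
  show ?case using assms(1)
  proof cases
    case (1 w b b')
    then show ?thesis using Triv assms a
      entry_sum.intros(1)[of \<Delta> B v "a \<otimes>\<^bsub>B v\<^esub> b" "a \<otimes>\<^bsub>B v\<^esub> b'"] r_distr[of b b' a] by simp
  next
    case (2 b \<beta> r b')
    then show ?thesis using Triv assms a
      entry_sum.intros(2)[of \<Delta> B "a \<otimes>\<^bsub>B v\<^esub> b" \<beta> r "a \<otimes>\<^bsub>B v\<^esub> b'"] r_distr[of b b' a] by simp
  next
    case 3
    then show ?thesis by (auto intro: entry_sum.intros)
  qed
qed (auto intro: entry_sum.intros)

lemma entry_sum_mult_right:
  assumes "entry_sum \<Delta> B p p' p''" "bp p" "bp p'" "bp q" "bp_end p = bp_start \<Delta> q"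
  shows "entry_sum \<Delta> B (bp_mult B p q) (bp_mult B p' q) (bp_mult B p'' q)"
  using assms
proof (induct rule: entry_sum.induct)
  case (1 v a b)
  then interpret ring "B v" using B_ring by simp
  show ?case
  proof (cases q)
    case (Triv w c)
    then show ?thesis using 1 entry_sum.intros(1)[of \<Delta> B v "a \<otimes>\<^bsub>B v\<^esub> c" "b \<otimes>\<^bsub>B v\<^esub> c"] l_distr[of a b c] by simp
  next
    case (Step c \<beta> r)
    then show ?thesis using 1 entry_sum.intros(2)[of \<Delta> B "a \<otimes>\<^bsub>B v\<^esub> c" \<beta> r "b \<otimes>\<^bsub>B v\<^esub> c"] l_distr[of a b c] by simp
  qed
qed (auto intro: entry_sum.intros)

lemma entry_smult_mult_left:
  assumes "entry_smult \<Delta> B c p p'" "c \<in> carrier K" "bp p" "bp q" "bp_end q = bp_start \<Delta> p"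
  shows "entry_smult \<Delta> B c (bp_mult B q p) (bp_mult B q p')"
  using assms(4,5)
proof (induct q)
  case (Triv v a)
  then have alg: "k_algebra K (B v)" using B_alg by simp
  have a: "a \<in> carrier (B v)" using Triv by simp
  show ?case using assms(1)
  proof cases
    case (1 w b)
    then show ?thesis using Triv assms a
      entry_smult.intros(1)[of \<Delta> B c v "a \<otimes>\<^bsub>B v\<^esub> b"] k_algebra_smult(2)[OF alg assms(2) a, of b] by simp
  next
    case (2 b \<beta> r)
    then show ?thesis using Triv assms a
      entry_smult.intros(2)[of \<Delta> B c "a \<otimes>\<^bsub>B v\<^esub> b" \<beta> r] k_algebra_smult(2)[OF alg assms(2) a, of b] by simp
  next
    case 3
    then show ?thesis by (auto intro: entry_smult.intros)
  qed
qed (auto intro: entry_smult.intros)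

lemma entry_smult_mult_right:
  assumes "entry_smult \<Delta> B c p p'" "c \<in> carrier K" "bp p" "bp q" "bp_end p = bp_start \<Delta> q"
  shows "entry_smult \<Delta> B c (bp_mult B p q) (bp_mult B p' q)"
  using assms
proof (induct rule: entry_smult.induct)
  case (1 v a)
  then have alg: "k_algebra K (B v)" using B_alg by simp
  have a: "a \<in> carrier (B v)" using 1 by simp
  show ?case
  proof (cases q)
    case (Triv w b)
    then show ?thesis using 1 a
      entry_smult.intros(1)[of \<Delta> B c v "a \<otimes>\<^bsub>B v\<^esub> b"] k_algebra_smult(1)[OF alg assms(2) a, of b] by simp
  next
    case (Step b \<beta> r)
    then show ?thesis using 1 a
      entry_smult.intros(2)[of \<Delta> B c "a \<otimes>\<^bsub>B v\<^esub> b" \<beta> r] k_algebra_smult(1)[OF alg assms(2) a, of b] by simp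
  qed
qed (auto intro: entry_smult.intros)

abbreviation mlin where "mlin \<equiv> multilinearity K \<Delta> B"

definition mlin_gens where
  "mlin_gens = {bas p'' \<ominus>\<^bsub>F\<^esub> (bas p \<oplus>\<^bsub>F\<^esub> bas p') | p p' p''. bp p \<and> bp p' \<and> entry_sum \<Delta> B p p' p''} \<union>
       {bas p' \<ominus>\<^bsub>F\<^esub> c \<odot>\<^bsub>F\<^esub> bas p | c p p'. c \<in> carrier K \<and> bp p \<and> entry_smult \<Delta> B c p p'}"

lemma mlin_gens_sum:
    "bp p \<Longrightarrow> bp p' \<Longrightarrow> entry_sum \<Delta> B p p' p'' \<Longrightarrow> bas p'' \<ominus>\<^bsub>F\<^esub> (bas p \<oplus>\<^bsub>F\<^esub> bas p') \<in> mlin_gens"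
  and mlin_gens_smult:
    "c \<in> carrier K \<Longrightarrow> bp p \<Longrightarrow> entry_smult \<Delta> B c p p' \<Longrightarrow> bas p' \<ominus>\<^bsub>F\<^esub> c \<odot>\<^bsub>F\<^esub> bas p \<in> mlin_gens"
  unfolding mlin_gens_def by blast+

lemma mlin_eq: "mlin = lin_span K F mlin_gens"
  by (simp add: multilinearity_def mlin_gens_def Let_def)

lemma mlin_gens_closed: "mlin_gens \<subseteq> carrier F"
  using entry_sum_bp entry_smult_bp by (auto simp: mlin_gens_def intro!: F.M.minus_closed bas_closed)

lemma mlin_submodule: "submodule mlin K F"
  unfolding mlin_eq by (rule lin_span_submodule[OF F_module mlin_gens_closed])

sublocale FA: ring F using F_k_algebra k_algebraD by blast

lemma F_mult_lin: "g \<in> carrier F \<Longrightarrow> (\<lambda>f. f \<otimes>\<^bsub>F\<^esub> g) \<in> lin_maps K F F" "g \<in> carrier F \<Longrightarrow> (\<lambda>f. g \<otimes>\<^bsub>F\<^esub> f) \<in> lin_maps K F F"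
  by (auto intro!: lin_mapsI simp: F_l_distr F_r_distr F_smult_mult)

lemma bas_span: "lin_span K F {bas p | p. bp p} = carrier F"
proof
  have "{bas p | p. bp p} \<subseteq> carrier F" using bas_closed by auto
  then have sub: "submodule (lin_span K F {bas p | p. bp p}) K F" by (rule lin_span_submodule[OF F_module])
  show "lin_span K F {bas p | p. bp p} \<subseteq> carrier F" using submodule_memD(2)[OF F_module sub] by auto
  show "carrier F \<subseteq> lin_span K F {bas p | p. bp p}"
  proof
    fix f assume "f \<in> carrier F"
    then show "f \<in> lin_span K F {bas p | p. bp p}"
    proof (induct rule: F_induct)
      case (add c p f)
      have "bas p \<in> lin_span K F {bas p | p. bp p}" using add(2) by (auto simp: lin_span_def)
      then show ?case using submodule_memD[OF F_module sub] add by simp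
    qed (rule submodule_memD[OF F_module sub])
  qed
qed

text \<open>By bilinearity only products of generators with single paths need checking: combinations
  of generators are handled by \<open>submodule_vimage\<close>, a general second factor by
  \<open>F_induct\<close>.\<close>

lemma lin_span_ideal:
  assumes X: "X \<subseteq> carrier F"
    and l: "\<And>q x. bp q \<Longrightarrow> x \<in> X \<Longrightarrow> bas q \<otimes>\<^bsub>F\<^esub> x \<in> lin_span K F X"
    and r: "\<And>q x. bp q \<Longrightarrow> x \<in> X \<Longrightarrow> x \<otimes>\<^bsub>F\<^esub> bas q \<in> lin_span K F X"
  shows "ideal (lin_span K F X) F"
proof -
  have sub: "submodule (lin_span K F X) K F" by (rule lin_span_submodule[OF F_module X])
  note mem = submodule_memD[OF F_module sub]
  have L: "bas q \<otimes>\<^bsub>F\<^esub> x \<in> lin_span K F X" "x \<otimes>\<^bsub>F\<^esub> bas q \<in> lin_span K F X" if "bp q" "x \<in> lin_span K F X" for q x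
  proof -
    have "lin_span K F X \<subseteq> {x \<in> carrier F. bas q \<otimes>\<^bsub>F\<^esub> x \<in> lin_span K F X}"
      by (rule lin_span_least[OF submodule_vimage[OF F_module F_module F_mult_lin(2) sub]])
        (use that X l bas_closed in auto)
    then show "bas q \<otimes>\<^bsub>F\<^esub> x \<in> lin_span K F X" using that by auto
    have "lin_span K F X \<subseteq> {x \<in> carrier F. x \<otimes>\<^bsub>F\<^esub> bas q \<in> lin_span K F X}"
      by (rule lin_span_least[OF submodule_vimage[OF F_module F_module F_mult_lin(1) sub]])
        (use that X r bas_closed in auto)
    then show "x \<otimes>\<^bsub>F\<^esub> bas q \<in> lin_span K F X" using that by auto
  qed
  have "x \<otimes>\<^bsub>F\<^esub> f \<in> lin_span K F X \<and> f \<otimes>\<^bsub>F\<^esub> x \<in> lin_span K F X" if x: "x \<in> lin_span K F X" and f: "f \<in> carrier F" for x f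
    using f
  proof (induct rule: F_induct)
    case (add c p f)
    then show ?case using x mem(2)[OF x] L mem
      by (simp add: FA.l_distr FA.r_distr F_smult_mult bas_closed)
  qed (use mem x in simp)
  then show ?thesis
    using submodule.axioms(1)[OF sub] by (intro idealI FA.ring_axioms) auto
qed

lemma mlin_ideal: "ideal mlin F"
  unfolding mlin_eq
proof (rule lin_span_ideal[OF mlin_gens_closed])
  have zero: "\<zero>\<^bsub>F\<^esub> \<in> lin_span K F mlin_gens"
    using submodule_memD(1)[OF F_module mlin_submodule] by (simp add: mlin_eq)
  have sup: "x \<in> mlin_gens \<Longrightarrow> x \<in> lin_span K F mlin_gens" for x
    by (rule subsetD[OF lin_span_superset])
  fix q x assume q: "bp q" and x: "x \<in> mlin_gens"
  consider (sum) p p' p'' where "x = bas p'' \<ominus>\<^bsub>F\<^esub> (bas p \<oplus>\<^bsub>F\<^esub> bas p')" "bp p" "bp p'" "entry_sum \<Delta> B p p' p''"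
    | (smult) c p p' where "x = bas p' \<ominus>\<^bsub>F\<^esub> c \<odot>\<^bsub>F\<^esub> bas p" "c \<in> carrier K" "bp p" "entry_smult \<Delta> B c p p'"
    using x unfolding mlin_gens_def
    by blast
  \<comment> \<open>The paths in one generator share start and end. So either all of them compose
    with \<open>q\<close>, and the product is a generator formed from the composed paths, or none
    does, and the product is zero.\<close>
  then have "bas q \<otimes>\<^bsub>F\<^esub> x \<in> insert \<zero>\<^bsub>F\<^esub> mlin_gens \<and> x \<otimes>\<^bsub>F\<^esub> bas q \<in> insert \<zero>\<^bsub>F\<^esub> mlin_gens"
  proof cases
    case sum
    note same = entry_sum_same[OF sum(4)]
    have bp'': "bp p''" using entry_sum_bp sum by blast
    have "bas q \<otimes>\<^bsub>F\<^esub> x = bas q \<otimes>\<^bsub>F\<^esub> bas p'' \<ominus>\<^bsub>F\<^esub> (bas q \<otimes>\<^bsub>F\<^esub> bas p \<oplus>\<^bsub>F\<^esub> bas q \<otimes>\<^bsub>F\<^esub> bas p')"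
      "x \<otimes>\<^bsub>F\<^esub> bas q = bas p'' \<otimes>\<^bsub>F\<^esub> bas q \<ominus>\<^bsub>F\<^esub> (bas p \<otimes>\<^bsub>F\<^esub> bas q \<oplus>\<^bsub>F\<^esub> bas p' \<otimes>\<^bsub>F\<^esub> bas q)"
      using sum q bp'' bas_closed
      by (simp_all add: F.M.minus_eq FA.l_distr FA.r_distr FA.l_minus FA.r_minus)
    moreover have "bp_end q = bp_start \<Delta> p \<Longrightarrow>
        bas (bp_mult B q p'') \<ominus>\<^bsub>F\<^esub> (bas (bp_mult B q p) \<oplus>\<^bsub>F\<^esub> bas (bp_mult B q p')) \<in> mlin_gens"
      using sum q same by (intro mlin_gens_sum entry_sum_mult_left bp_mult_bp) simp_all
    moreover have "bp_end p = bp_start \<Delta> q \<Longrightarrow>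
        bas (bp_mult B p'' q) \<ominus>\<^bsub>F\<^esub> (bas (bp_mult B p q) \<oplus>\<^bsub>F\<^esub> bas (bp_mult B p' q)) \<in> mlin_gens"
      using sum q same by (intro mlin_gens_sum entry_sum_mult_right bp_mult_bp) simp_all
    moreover have "\<zero>\<^bsub>F\<^esub> \<ominus>\<^bsub>F\<^esub> (\<zero>\<^bsub>F\<^esub> \<oplus>\<^bsub>F\<^esub> \<zero>\<^bsub>F\<^esub>) = \<zero>\<^bsub>F\<^esub>" by (simp add: F.M.minus_eq)
    ultimately show ?thesis
      unfolding F_mult_bas[OF q bp''] F_mult_bas[OF q sum(2)] F_mult_bas[OF q sum(3)]
        F_mult_bas[OF bp'' q] F_mult_bas[OF sum(2) q] F_mult_bas[OF sum(3) q]
      by - (cases "bp_end q = bp_start \<Delta> p"; cases "bp_end p = bp_start \<Delta> q"; simp only: same if_True if_False insert_iff simp_thms)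
  next
    case smult
    note same = entry_smult_same[OF smult(4)]
    have bp': "bp p'" using entry_smult_bp smult by blast
    have "bas q \<otimes>\<^bsub>F\<^esub> x = bas q \<otimes>\<^bsub>F\<^esub> bas p' \<ominus>\<^bsub>F\<^esub> c \<odot>\<^bsub>F\<^esub> (bas q \<otimes>\<^bsub>F\<^esub> bas p)"
      "x \<otimes>\<^bsub>F\<^esub> bas q = bas p' \<otimes>\<^bsub>F\<^esub> bas q \<ominus>\<^bsub>F\<^esub> c \<odot>\<^bsub>F\<^esub> (bas p \<otimes>\<^bsub>F\<^esub> bas q)"
      using smult q bp' bas_closed
      by (simp_all add: F.M.minus_eq FA.l_distr FA.r_distr FA.l_minus FA.r_minus F_smult_mult)
    moreover have "bp_end q = bp_start \<Delta> p \<Longrightarrow>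
        bas (bp_mult B q p') \<ominus>\<^bsub>F\<^esub> c \<odot>\<^bsub>F\<^esub> bas (bp_mult B q p) \<in> mlin_gens"
      using smult q same by (intro mlin_gens_smult entry_smult_mult_left bp_mult_bp) simp_all
    moreover have "bp_end p = bp_start \<Delta> q \<Longrightarrow>
        bas (bp_mult B p' q) \<ominus>\<^bsub>F\<^esub> c \<odot>\<^bsub>F\<^esub> bas (bp_mult B p q) \<in> mlin_gens"
      using smult q same by (intro mlin_gens_smult entry_smult_mult_right bp_mult_bp) simp_all
    moreover have "\<zero>\<^bsub>F\<^esub> \<ominus>\<^bsub>F\<^esub> c \<odot>\<^bsub>F\<^esub> \<zero>\<^bsub>F\<^esub> = \<zero>\<^bsub>F\<^esub>" using smult(2) by (simp add: F.M.minus_eq)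
    ultimately show ?thesis
      unfolding F_mult_bas[OF q bp'] F_mult_bas[OF q smult(3)] F_mult_bas[OF bp' q] F_mult_bas[OF smult(3) q]
      by - (cases "bp_end q = bp_start \<Delta> p"; cases "bp_end p = bp_start \<Delta> q"; simp only: same if_True if_False insert_iff simp_thms)
  qed
  then show "bas q \<otimes>\<^bsub>F\<^esub> x \<in> lin_span K F mlin_gens" "x \<otimes>\<^bsub>F\<^esub> bas q \<in> lin_span K F mlin_gens"
    using zero sup by auto
qed

text \<open>This filtration by length stands in for the powers of the arrow ideal: containments are
  verified on paths, whereas powers of an ideal are only known through generating products.\<close>

definition F_ge where "F_ge n = lin_span K F {bas p | p. bp p \<and> n \<le> bp_length p}"

lemma F_ge_gens_closed: "{bas p | p. bp p \<and> n \<le> bp_length p} \<subseteq> carrier F"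
  using bas_closed by auto

lemma F_ge_bas: "bp p \<Longrightarrow> n \<le> bp_length p \<Longrightarrow> bas p \<in> F_ge n"
  unfolding F_ge_def by (intro subsetD[OF lin_span_superset]) blast

lemma F_ge_submodule: "submodule (F_ge n) K F"
  unfolding F_ge_def by (rule lin_span_submodule[OF F_module F_ge_gens_closed])

lemma F_ge_ideal: "ideal (F_ge n) F"
  unfolding F_ge_def
proof (rule lin_span_ideal[OF F_ge_gens_closed])
  note zero = submodule_memD(1)[OF F_module F_ge_submodule]
  fix q x assume q: "bp q" and "x \<in> {bas p | p. bp p \<and> n \<le> bp_length p}"
  then obtain p where p: "x = bas p" "bp p" "n \<le> bp_length p" by auto
  show "bas q \<otimes>\<^bsub>F\<^esub> x \<in> lin_span K F {bas p | p. bp p \<and> n \<le> bp_length p}"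
    "x \<otimes>\<^bsub>F\<^esub> bas q \<in> lin_span K F {bas p | p. bp p \<and> n \<le> bp_length p}"
    using p q zero[of n] by (auto simp: F_mult_bas bp_mult_length bp_mult_bp F_ge_def[symmetric] intro!: F_ge_bas)
qed

lemma F_ge_mult: "x \<in> F_ge m \<Longrightarrow> y \<in> F_ge n \<Longrightarrow> x \<otimes>\<^bsub>F\<^esub> y \<in> F_ge (m + n)"
proof -
  assume x: "x \<in> F_ge m" and y: "y \<in> F_ge n"
  note mem = submodule_memD[OF F_module F_ge_submodule]
  have *: "bas p \<otimes>\<^bsub>F\<^esub> y \<in> F_ge (m + n)" if p: "bp p" "m \<le> bp_length p" for p
  proof -
    have "F_ge n \<subseteq> {y \<in> carrier F. bas p \<otimes>\<^bsub>F\<^esub> y \<in> F_ge (m + n)}"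
      unfolding F_ge_def[of n]
      by (rule lin_span_least[OF submodule_vimage[OF F_module F_module F_mult_lin(2) F_ge_submodule]])
        (use p bas_closed in \<open>auto simp: F_mult_bas bp_mult_length bp_mult_bp mem intro!: F_ge_bas\<close>)
    then show ?thesis using y by auto
  qed
  have "F_ge m \<subseteq> {x \<in> carrier F. x \<otimes>\<^bsub>F\<^esub> y \<in> F_ge (m + n)}"
    unfolding F_ge_def[of m]
    by (rule lin_span_least[OF submodule_vimage[OF F_module F_module F_mult_lin(1) F_ge_submodule]])
      (use mem(2)[OF y] * bas_closed in auto)
  then show ?thesis using x by auto
qed

text \<open>The conditions say that the linear extension of \<open>g\<close> kills the generators of
  \<open>mlin\<close>, so that \<open>g\<close> descends to the generalized path algebra. Values off
  the genuine paths are arbitrary.\<close>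

definition multilinear_on_paths where
  "multilinear_on_paths V g \<longleftrightarrow> (\<forall>p. bp p \<longrightarrow> g p \<in> carrier V) \<and>
    (\<forall>p p' p''. bp p \<longrightarrow> bp p' \<longrightarrow> entry_sum \<Delta> B p p' p'' \<longrightarrow> g p'' = g p \<oplus>\<^bsub>V\<^esub> g p') \<and>
    (\<forall>c p p'. c \<in> carrier K \<longrightarrow> bp p \<longrightarrow> entry_smult \<Delta> B c p p' \<longrightarrow> g p' = c \<odot>\<^bsub>V\<^esub> g p)"

definition lin_ext where "lin_ext V g f = (\<Oplus>\<^bsub>V\<^esub>p\<in>{p. f p \<noteq> \<zero>\<^bsub>K\<^esub>}. f p \<odot>\<^bsub>V\<^esub> g p)"

section \<open>Linear extension of functions on paths\<close>

context
  fixes V :: "('k, 'x, 'y) module_scheme" and g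
  assumes V: "module K V" and g: "\<And>p. bp p \<Longrightarrow> g p \<in> carrier V"
begin

interpretation V: module K V by (rule V)

lemma lin_ext_superset:
  assumes "f \<in> carrier F" "finite X" "{p. f p \<noteq> \<zero>\<^bsub>K\<^esub>} \<subseteq> X" "\<And>p. p \<in> X \<Longrightarrow> bp p"
  shows "lin_ext V g f = (\<Oplus>\<^bsub>V\<^esub>p\<in>X. f p \<odot>\<^bsub>V\<^esub> g p)"
  unfolding lin_ext_def
  by (rule V.M.add.finprod_mono_neutral_cong_left) (use assms g F_closed[OF assms(1)] in auto)

lemma lin_ext_lin: "lin_ext V g \<in> lin_maps K F V"
proof (rule lin_mapsI)
  fix f assume f: "f \<in> carrier F"
  then show "lin_ext V g f \<in> carrier V"
    unfolding lin_ext_def using g F_closed F_bp by (intro V.M.finsum_closed) auto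
  fix c assume c: "c \<in> carrier K"
  have eq: "lin_ext V g (c \<odot>\<^bsub>F\<^esub> f) = (\<Oplus>\<^bsub>V\<^esub>p\<in>{p. f p \<noteq> \<zero>\<^bsub>K\<^esub>}. (c \<odot>\<^bsub>F\<^esub> f) p \<odot>\<^bsub>V\<^esub> g p)"
    by (rule lin_ext_superset[OF F_smult_closed[OF c f]]) (use f c F_finite F_bp in \<open>auto simp: F_simps\<close>)
  show "lin_ext V g (c \<odot>\<^bsub>F\<^esub> f) = c \<odot>\<^bsub>V\<^esub> lin_ext V g f"
    unfolding eq unfolding lin_ext_def
    using f c g F_finite F_closed[OF f] F_bp[OF f]
    by (subst V.finsum_smult_ldistr) (auto intro!: V.M.finsum_cong' simp: F_simps V.smult_assoc1)
next
  fix f h assume f: "f \<in> carrier F" and h: "h \<in> carrier F"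
  let ?X = "{p. f p \<noteq> \<zero>\<^bsub>K\<^esub>} \<union> {p. h p \<noteq> \<zero>\<^bsub>K\<^esub>}"
  have X: "finite ?X" "\<And>p. p \<in> ?X \<Longrightarrow> bp p" using F_finite F_bp f h by blast+
  have eq: "lin_ext V g (f \<oplus>\<^bsub>F\<^esub> h) = (\<Oplus>\<^bsub>V\<^esub>p\<in>?X. (f \<oplus>\<^bsub>F\<^esub> h) p \<odot>\<^bsub>V\<^esub> g p)"
    "lin_ext V g f = (\<Oplus>\<^bsub>V\<^esub>p\<in>?X. f p \<odot>\<^bsub>V\<^esub> g p)" "lin_ext V g h = (\<Oplus>\<^bsub>V\<^esub>p\<in>?X. h p \<odot>\<^bsub>V\<^esub> g p)"
    by (rule lin_ext_superset; use X f h in \<open>auto simp: F_simps(2) F_add_closed[unfolded F_simps(2)]\<close>)+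
  show "lin_ext V g (f \<oplus>\<^bsub>F\<^esub> h) = lin_ext V g f \<oplus>\<^bsub>V\<^esub> lin_ext V g h"
    unfolding eq using X g F_closed[OF f] F_closed[OF h]
    by (intro trans[OF V.M.finsum_cong' V.M.finsum_addf]) (auto simp: F_simps V.smult_l_distr)
qed

lemma lin_ext_bas: "bp p \<Longrightarrow> lin_ext V g (bas p) = g p"
  unfolding lin_ext_def bas_supp using g by (simp add: bp_basis_def)

lemma lin_ext_kills_F_ge:
  assumes "\<And>p. bp p \<Longrightarrow> n \<le> bp_length p \<Longrightarrow> g p = \<zero>\<^bsub>V\<^esub>" "f \<in> F_ge n"
  shows "lin_ext V g f = \<zero>\<^bsub>V\<^esub>"
proof -
  have "F_ge n \<subseteq> {f \<in> carrier F. lin_ext V g f = \<zero>\<^bsub>V\<^esub>}"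
    unfolding F_ge_def
    by (rule lin_span_least[OF lin_maps_kernel_submodule[OF F_module V lin_ext_lin]])
      (use assms bas_closed lin_ext_bas in auto)
  then show ?thesis using assms by auto
qed

lemma lin_ext_kills_mlin:
  assumes m: "multilinear_on_paths V g" and f: "f \<in> mlin"
  shows "lin_ext V g f = \<zero>\<^bsub>V\<^esub>"
proof -
  note lm = lin_maps_minus[OF F_module V lin_ext_lin] lin_maps_add[OF lin_ext_lin] lin_maps_smult[OF lin_ext_lin]
  have "mlin_gens \<subseteq> {f \<in> carrier F. lin_ext V g f = \<zero>\<^bsub>V\<^esub>}"
  proof
    fix x assume x: "x \<in> mlin_gens"
    have "lin_ext V g x = \<zero>\<^bsub>V\<^esub>"
      using x m g unfolding mlin_gens_def multilinear_on_paths_def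
      by (auto simp: lm bas_closed lin_ext_bas entry_sum_bp entry_smult_bp V.M.minus_eq V.M.r_neg)
    then show "x \<in> {f \<in> carrier F. lin_ext V g f = \<zero>\<^bsub>V\<^esub>}" using x mlin_gens_closed by auto
  qed
  then have "mlin \<subseteq> {f \<in> carrier F. lin_ext V g f = \<zero>\<^bsub>V\<^esub>}"
    unfolding mlin_eq by (rule lin_span_least[OF lin_maps_kernel_submodule[OF F_module V lin_ext_lin]])
  then show ?thesis using f by auto
qed

end

end

section \<open>Powers of ideals and algebra isomorphisms\<close>

lemma ideal_power_0: "ideal_power R I 0 = carrier R"
  by (simp add: ideal_power_def ideals_set_def nat_pow_def)

lemma ideal_power_Suc: "ideal_power R I (Suc n) = ideal_prod R (ideal_power R I n) I"
  by (simp add: ideal_power_def ideals_set_def nat_pow_def)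

lemma (in ring) ideal_power_ideal: "ideal I R \<Longrightarrow> ideal (ideal_power R I n) R"
  by (induct n) (simp_all add: ideal_power_0 ideal_power_Suc oneideal ideal_prod_is_ideal)

lemma (in ring) ideal_power_antimono: "ideal I R \<Longrightarrow> ideal_power R I (m + n) \<subseteq> ideal_power R I m"
proof (induct n)
  case (Suc n)
  have "ideal_power R I (m + Suc n) \<subseteq> ideal_power R I (m + n)"
    using ideal_prod_inter[OF ideal_power_ideal[OF Suc(2)] Suc(2)] by (simp add: ideal_power_Suc)
  then show ?case using Suc by blast
qed simp

lemma ideal_prod_mono: "I \<subseteq> I' \<Longrightarrow> J \<subseteq> J' \<Longrightarrow> ideal_prod R I J \<subseteq> ideal_prod R I' J'"
proof
  fix x assume "I \<subseteq> I'" "J \<subseteq> J'" "x \<in> ideal_prod R I J"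
  show "x \<in> ideal_prod R I' J'"
    using \<open>x \<in> ideal_prod R I J\<close>
  proof induct
    case (prod i j)
    then show ?case using \<open>I \<subseteq> I'\<close> \<open>J \<subseteq> J'\<close> by (intro ideal_prod.prod) auto
  next
    case (sum s1 s2)
    then show ?case by (intro ideal_prod.sum)
  qed
qed

text \<open>The recursion starts at the whole ring, so the square unfolds to \<open>(R I) I\<close>;
  the factor \<open>R\<close> disappears because \<open>R\<close> has an identity.\<close>

lemma (in ring) ideal_power_2:
  assumes "ideal I R" shows "ideal_power R I 2 = ideal_prod R I I"
proof -
  have "I \<subseteq> ideal_prod R (carrier R) I"
  proof
    fix x assume x: "x \<in> I"
    have "\<one> \<otimes> x \<in> ideal_prod R (carrier R) I" by (rule ideal_prod.prod[OF one_closed x])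
    then show "x \<in> ideal_prod R (carrier R) I" using ideal.Icarr[OF assms x] by simp
  qed
  moreover have "ideal_prod R (carrier R) I \<subseteq> I" using ideal_prod_inter[OF oneideal assms] by blast
  ultimately show ?thesis by (simp add: numeral_2_eq_2 ideal_power_0 ideal_power_Suc)
qed

section \<open>Images of ideals and inverses of isomorphisms\<close>

lemma image_ideal:
  assumes "ring R" "ring S" "h \<in> ring_hom R S" "h ` carrier R = carrier S" "ideal I R"
  shows "ideal (h ` I) S"
proof -
  interpret h: ring_hom_ring R S h by (rule ring_hom_ringI2[OF assms(1-3)])
  interpret I: ideal I R by (rule assms(5))
  show ?thesis
  proof (rule idealI[OF assms(2) h.img_is_add_subgroup[OF I.a_subgroup]])
    fix a x assume "a \<in> h ` I" "x \<in> carrier S"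
    then obtain i r where i: "i \<in> I" "a = h i" "r \<in> carrier R" "x = h r"
      unfolding assms(4)[symmetric] by (elim imageE)
    then show "x \<otimes>\<^bsub>S\<^esub> a \<in> h ` I" "a \<otimes>\<^bsub>S\<^esub> x \<in> h ` I"
      using I.I_l_closed[OF i(1,3)] I.I_r_closed[OF i(1,3)] I.Icarr[OF i(1)] ring_hom_mult[OF assms(3)]
      by (metis imageI)+
  qed
qed

lemma ideal_submodule: "k_algebra K A \<Longrightarrow> ideal I A \<Longrightarrow> submodule I K A"
proof -
  assume A: "k_algebra K A" and I: "ideal I A"
  interpret I: ideal I A by fact
  show ?thesis
    using ideal_smult_closed[OF A I] I.a_subgroup by (simp add: submodule_def submodule_axioms_def)
qed

lemma algebra_iso_lin_map: "h \<in> algebra_iso K A C \<Longrightarrow> h \<in> lin_maps K A C"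
  unfolding algebra_iso_def ring_iso_def ring_hom_def lin_maps_def Pi_def by simp

lemma algebra_isoI:
  assumes "h \<in> lin_maps K A C" "h \<in> ring_hom A C" "inj_on h (carrier A)" "h ` carrier A = carrier C"
  shows "h \<in> algebra_iso K A C"
  using assms by (simp add: algebra_iso_def ring_iso_def bij_betw_def lin_maps_smult)

lemma algebra_iso_inv:
  assumes "k_algebra K A" "k_algebra K C" "h \<in> algebra_iso K A C"
  shows "inv_into (carrier A) h \<in> algebra_iso K C A"
proof -
  interpret A: ring A using k_algebraD[OF assms(1)] by simp
  interpret A: module K A using k_algebraD[OF assms(1)] by simp
  have inj: "inj_on h (carrier A)" and im: "h ` carrier A = carrier C" and hom: "h \<in> ring_hom A C"
    and lin: "h \<in> lin_maps K A C"
    using assms(3) algebra_iso_lin_map by (auto simp: algebra_iso_def ring_iso_def bij_betw_def)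
  let ?g = "inv_into (carrier A) h"
  have gc: "?g y \<in> carrier A" and hg: "h (?g y) = y" if "y \<in> carrier C" for y
    using inv_into_into[of y h "carrier A"] f_inv_into_f[of y h "carrier A"] that im by auto
  have gh: "?g y = x" if "x \<in> carrier A" "h x = y" for x y
    using inv_into_f_f[OF inj] that by blast
  show ?thesis
  proof (rule algebra_isoI)
    show "?g \<in> lin_maps K C A"
      by (rule lin_mapsI)
        (auto simp: gc hg lin_maps_add[OF lin] lin_maps_smult[OF lin] intro!: gh)
    show "?g \<in> ring_hom C A"
      by (rule ring_hom_memI)
        (auto simp: gc hg ring_hom_mult[OF hom] ring_hom_add[OF hom] ring_hom_one[OF hom] intro!: gh)
    show "inj_on ?g (carrier C)" using inj_on_inv_into[of "carrier C" h "carrier A"] im by simp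
    show "?g ` carrier C = carrier A" using inv_into_image_cancel[OF inj, of "carrier A"] im by simp
  qed
qed

section \<open>Presenting an algebra by paths\<close>

context path_data
begin

abbreviation G where "G \<equiv> gen_path_algebra K \<Delta> B"
abbreviation cl where "cl \<equiv> (+>\<^bsub>F\<^esub>) mlin"
abbreviation J where "J \<equiv> arrow_ideal K \<Delta> B"

lemma G_eq: "G = quot_algebra F mlin"
  by (simp add: gen_path_algebra_def)

lemma G_k_algebra: "k_algebra K G"
  unfolding G_eq by (rule quot_algebra_k_algebra[OF F_k_algebra mlin_ideal])

sublocale G: ring G using G_k_algebra k_algebraD by blast

lemma cl_lin: "cl \<in> lin_maps K F G"
  unfolding G_eq by (rule quot_algebra_lin_map[OF F_k_algebra mlin_ideal])

lemma cl_image: "cl ` carrier F = carrier G"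
  by (simp add: G_eq quot_algebra_simps)

lemma cl_hom: "cl \<in> ring_hom F G"
proof (rule ring_hom_memI)
  show "cl (x \<otimes>\<^bsub>F\<^esub> y) = cl x \<otimes>\<^bsub>G\<^esub> cl y" if "x \<in> carrier F" "y \<in> carrier F" for x y
    using quot_algebra_ops[OF F_k_algebra mlin_ideal that] by (simp add: G_eq)
  show "cl \<one>\<^bsub>F\<^esub> = \<one>\<^bsub>G\<^esub>" by (simp add: G_eq quot_algebra_simps)
qed (use lin_maps_closed[OF cl_lin] lin_maps_add[OF cl_lin] in auto)

lemma cl_eq_iff: "x \<in> carrier F \<Longrightarrow> y \<in> carrier F \<Longrightarrow> cl x = cl y \<longleftrightarrow> x \<ominus>\<^bsub>F\<^esub> y \<in> mlin"
  by (rule ideal.coset_eq_iff[OF mlin_ideal])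

lemma bp_class_eq: "bp_class K \<Delta> B p = cl (bas p)"
  by (simp add: bp_class_def)

lemma J_gens_closed: "{bp_class K \<Delta> B p | p. bp p \<and> bp_length p = 1} \<subseteq> carrier G"
  using lin_maps_closed[OF cl_lin] bas_closed by (auto simp: bp_class_eq)

lemma J_ideal: "ideal J G"
  unfolding arrow_ideal_def by (rule G.genideal_ideal[OF J_gens_closed])

lemma arrow_in_J: "bp p \<Longrightarrow> bp_length p = 1 \<Longrightarrow> cl (bas p) \<in> J"
  unfolding arrow_ideal_def by (rule subsetD[OF G.genideal_self[OF J_gens_closed]]) (auto simp: bp_class_eq)

lemma cl_bas_mult:
  "bp p \<Longrightarrow> bp q \<Longrightarrow> bp_end p = bp_start \<Delta> q \<Longrightarrow> cl (bas (bp_mult B p q)) = cl (bas p) \<otimes>\<^bsub>G\<^esub> cl (bas q)"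
  using ring_hom_mult[OF cl_hom bas_closed bas_closed, of p q] by (simp add: F_mult_bas)

text \<open>Powers of an ideal grow on the right, whereas paths are built from the left. The prefix
  \<open>q\<close> mediates: one arrow at a time moves from the front of \<open>p\<close> to the end
  of \<open>q\<close> and raises the exponent by one.\<close>

lemma cl_bas_ideal_power_aux:
  "bp p \<Longrightarrow> bp q \<Longrightarrow> bp_end q = bp_start \<Delta> p \<Longrightarrow> cl (bas q) \<in> ideal_power G J m \<Longrightarrow>
    cl (bas (bp_mult B q p)) \<in> ideal_power G J (m + bp_length p)"
proof (induct p arbitrary: q m)
  case (Triv v a)
  then have "cl (bas (Triv v a)) \<in> carrier G" using lin_maps_closed[OF cl_lin bas_closed] by simp
  then show ?case
    using Triv ideal.I_r_closed[OF G.ideal_power_ideal[OF J_ideal]] by (simp add: cl_bas_mult)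
next
  case (Step a \<beta> p)
  \<comment> \<open>The first arrow, closed by an identity entry, since the remaining path brings
    its own first entry along.\<close>
  let ?p = "Step a \<beta> (triv1 (bp_start \<Delta> p))"
  have p: "bp p" and p': "bp ?p" using Step triv1_bp[OF bp_start_vert] by auto
  have e: "bp_end q = bp_start \<Delta> ?p" "bp_end ?p = bp_start \<Delta> p" using Step by auto
  have "cl (bas (bp_mult B q ?p)) \<in> ideal_power G J (Suc m)"
    unfolding cl_bas_mult[OF Step(3) p' e(1)] ideal_power_Suc
    by (rule ideal_prod.prod[OF Step(5) arrow_in_J[OF p']]) simp
  then have "cl (bas (bp_mult B (bp_mult B q ?p) p)) \<in> ideal_power G J (Suc m + bp_length p)"
    using e by (intro Step(1) p bp_mult_bp[OF Step(3) p' e(1)]) (simp_all add: bp_mult_end)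
  moreover have "bp_mult B (bp_mult B q ?p) p = bp_mult B q (Step a \<beta> p)"
    using bp_mult_assoc[OF Step(3) p' p e] bp_mult_unit_left[OF p] by simp
  ultimately show ?case by simp
qed

lemma cl_bas_ideal_power: "bp p \<Longrightarrow> n \<le> bp_length p \<Longrightarrow> cl (bas p) \<in> ideal_power G J n"
proof -
  assume p: "bp p" and n: "n \<le> bp_length p"
  have t: "bp (triv1 (bp_start \<Delta> p))" using triv1_bp[OF bp_start_vert[OF p]] .
  have "cl (bas (triv1 (bp_start \<Delta> p))) \<in> ideal_power G J 0"
    unfolding ideal_power_0 by (rule lin_maps_closed[OF cl_lin bas_closed[OF t]])
  from cl_bas_ideal_power_aux[OF p t _ this]
  have "cl (bas p) \<in> ideal_power G J (bp_length p)" using bp_mult_unit_left[OF p] by simp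
  then show ?thesis using G.ideal_power_antimono[OF J_ideal, of n "bp_length p - n"] n by auto
qed

lemma cl_F_ge_ideal_power: "cl ` F_ge n \<subseteq> ideal_power G J n"
proof -
  have "F_ge n \<subseteq> {x \<in> carrier F. cl x \<in> ideal_power G J n}"
    unfolding F_ge_def
    by (rule lin_span_least[OF submodule_vimage[OF F_module _ cl_lin ideal_submodule[OF G_k_algebra]]])
      (use G.ideal_power_ideal[OF J_ideal] k_algebraD[OF G_k_algebra] bas_closed cl_bas_ideal_power in auto)
  then show ?thesis by auto
qed

text \<open>The generators of the arrow ideal have length 1, and the images of the filtration are
  ideals, so \<open>J\<close> lies in the image of \<open>F_ge 1\<close>. The exponent 2 is the one
  that bounds the relations from above.\<close>

lemma ideal_power_2_cl_F_ge: "ideal_power G J 2 \<subseteq> cl ` F_ge 2"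
proof -
  have F: "x \<in> F_ge n \<Longrightarrow> x \<in> carrier F" for x n using submodule_memD(2)[OF F_module F_ge_submodule] .
  have id: "ideal (cl ` F_ge n) G" for n
    by (rule image_ideal[OF FA.ring_axioms G.ring_axioms cl_hom cl_image F_ge_ideal])
  have "J \<subseteq> cl ` F_ge 1"
    unfolding arrow_ideal_def
    by (rule G.genideal_minimal[OF id]) (auto simp: bp_class_eq intro!: imageI F_ge_bas)
  then have "ideal_prod G J J \<subseteq> ideal_prod G (cl ` F_ge 1) (cl ` F_ge 1)" by (intro ideal_prod_mono)
  also have "\<dots> \<subseteq> cl ` F_ge 2"
  proof
    fix x assume "x \<in> ideal_prod G (cl ` F_ge 1) (cl ` F_ge 1)"
    then show "x \<in> cl ` F_ge 2"
    proof induct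
      case (prod i j)
      then obtain y z where yz: "i = cl y" "j = cl z" "y \<in> F_ge 1" "z \<in> F_ge 1" by auto
      then have "i \<otimes>\<^bsub>G\<^esub> j = cl (y \<otimes>\<^bsub>F\<^esub> z)" using ring_hom_mult[OF cl_hom] F by simp
      moreover have "y \<otimes>\<^bsub>F\<^esub> z \<in> F_ge 2" using F_ge_mult[OF yz(3,4)] by (simp add: numeral_2_eq_2)
      ultimately show ?case by blast
    next
      case (sum s1 s2)
      then show ?case using additive_subgroup.a_closed[OF ideal.axioms(1)[OF id]] by blast
    qed
  qed
  finally show ?thesis by (simp add: G.ideal_power_2[OF J_ideal])
qed

lemma gpa_relations_closed: "gpa_relations K \<Delta> B \<subseteq> carrier G"
proof -
  have m: "module K G" using k_algebraD[OF G_k_algebra] by simp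
  interpret Gm: module K G by (rule m)
  have "lin_span K G {bp_class K \<Delta> B p | p. bp p \<and> bp_start \<Delta> p = u \<and> bp_end p = w} \<subseteq> carrier G" for u w
    by (rule lin_span_least[OF Gm.carrier_is_submodule])
      (use lin_maps_closed[OF cl_lin] bas_closed in \<open>auto simp: bp_class_eq\<close>)
  then show ?thesis unfolding gpa_relations_def by blast
qed

text \<open>Collects what the later argument uses of the relations, for a single map on the free
  space: the two quotient maps followed by the isomorphism with \<open>A\<close>. The lower bound on
  the relations makes it vanish on long paths; the upper bound confines its kernel to
  \<open>F_ge 2\<close> plus \<open>mlin\<close>.\<close>

lemma presentation:
  assumes A: "k_algebra K A" and \<rho>: "\<rho> \<subseteq> gpa_relations K \<Delta> B"
    and iso: "algebra_isomorphic K A (gen_path_algebra_rel K \<Delta> B \<rho>)"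
    and t: "ideal_power G J t \<subseteq> genideal G \<rho>" and two: "genideal G \<rho> \<subseteq> ideal_power G J 2"
  obtains \<pi> where "\<pi> \<in> lin_maps K F A" "\<pi> \<in> ring_hom F A" "\<pi> ` carrier F = carrier A"
    "\<And>x. x \<in> mlin \<Longrightarrow> \<pi> x = \<zero>\<^bsub>A\<^esub>" "\<And>x. x \<in> F_ge t \<Longrightarrow> \<pi> x = \<zero>\<^bsub>A\<^esub>"
    "\<And>f. f \<in> carrier F \<Longrightarrow> \<pi> f = \<zero>\<^bsub>A\<^esub> \<Longrightarrow> \<exists>x\<in>F_ge 2. f \<ominus>\<^bsub>F\<^esub> x \<in> mlin"
proof -
  let ?I = "genideal G \<rho>" and ?C = "gen_path_algebra_rel K \<Delta> B \<rho>"
  let ?q = "(+>\<^bsub>G\<^esub>) ?I"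
  have I: "ideal ?I G" using G.genideal_ideal \<rho> gpa_relations_closed by blast
  have C_eq: "?C = quot_algebra G ?I" by (simp add: gen_path_algebra_rel_def)
  have C: "k_algebra K ?C" unfolding C_eq by (rule quot_algebra_k_algebra[OF G_k_algebra I])
  obtain h where h: "h \<in> algebra_iso K A ?C" using iso by (auto simp: algebra_isomorphic_def)
  define g where "g = inv_into (carrier A) h"
  have g: "g \<in> algebra_iso K ?C A" unfolding g_def by (rule algebra_iso_inv[OF A C h])
  have g_inj: "inj_on g (carrier ?C)" and g_im: "g ` carrier ?C = carrier A" and g_hom: "g \<in> ring_hom ?C A"
    and g_lin: "g \<in> lin_maps K ?C A"
    using g algebra_iso_lin_map by (auto simp: algebra_iso_def ring_iso_def bij_betw_def)
  have q_lin: "?q \<in> lin_maps K G ?C" unfolding C_eq by (rule quot_algebra_lin_map[OF G_k_algebra I])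
  have q_im: "?q ` carrier G = carrier ?C" by (simp add: C_eq quot_algebra_simps)
  have q_hom: "?q \<in> ring_hom G ?C"
  proof (rule ring_hom_memI)
    show "?q (x \<otimes>\<^bsub>G\<^esub> y) = ?q x \<otimes>\<^bsub>?C\<^esub> ?q y" if "x \<in> carrier G" "y \<in> carrier G" for x y
      using quot_algebra_ops[OF G_k_algebra I that] by (simp add: C_eq)
    show "?q \<one>\<^bsub>G\<^esub> = \<one>\<^bsub>?C\<^esub>" by (simp add: C_eq quot_algebra_simps)
  qed (use lin_maps_closed[OF q_lin] lin_maps_add[OF q_lin] in auto)
  note Am = k_algebraD(4)[OF A] note Cm = k_algebraD(4)[OF C] note Gm = k_algebraD(4)[OF G_k_algebra]
  interpret Cm: module K ?C by (rule Cm)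
  define \<pi> where "\<pi> = g \<circ> (?q \<circ> cl)"
  have lin: "\<pi> \<in> lin_maps K F A"
    unfolding \<pi>_def by (rule lin_maps_comp[OF lin_maps_comp[OF cl_lin q_lin] g_lin])
  have qz: "?q y = \<zero>\<^bsub>?C\<^esub> \<longleftrightarrow> y \<in> ?I" if "y \<in> carrier G" for y
    using ideal.coset_eq_iff[OF I that G.zero_closed] ideal.axioms(1)[OF I] that
    by (simp add: C_eq quot_algebra_simps G.a_coset_add_zero additive_subgroup.a_subset G.minus_eq)
  \<comment> \<open>The last map of the composite is injective, so the kernel is the preimage of the
    ideal of relations.\<close>
  have ker: "\<pi> f = \<zero>\<^bsub>A\<^esub> \<longleftrightarrow> cl f \<in> ?I" if f: "f \<in> carrier F" for f
  proof -
    have c: "cl f \<in> carrier G" by (rule lin_maps_closed[OF cl_lin f])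
    have "\<pi> f = g \<zero>\<^bsub>?C\<^esub> \<longleftrightarrow> ?q (cl f) = \<zero>\<^bsub>?C\<^esub>"
      unfolding \<pi>_def o_def
      by (rule inj_on_eq_iff[OF g_inj lin_maps_closed[OF q_lin c] Cm.zero_closed])
    then show ?thesis using qz[OF c] lin_maps_zero[OF Cm Am g_lin] by simp
  qed
  show thesis
  proof (rule that[OF lin])
    show "\<pi> \<in> ring_hom F A"
      unfolding \<pi>_def by (rule ring_hom_trans[OF ring_hom_trans[OF cl_hom q_hom] g_hom])
    show "\<pi> ` carrier F = carrier A"
      unfolding \<pi>_def image_comp[symmetric] cl_image q_im g_im ..
    show "\<pi> x = \<zero>\<^bsub>A\<^esub>" if x: "x \<in> mlin" for x
    proof -
      have "cl x = \<zero>\<^bsub>G\<^esub>"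
        using abelian_subgroup.a_rcos_const[OF ideal.axioms(1)[OF mlin_ideal, THEN abelian_subgroupI3] x] F.M.abelian_group_axioms
        by (simp add: G_eq quot_algebra_simps)
      then show ?thesis using ker[OF submodule_memD(2)[OF F_module mlin_submodule x]]
          additive_subgroup.zero_closed[OF ideal.axioms(1)[OF I]] by simp
    qed
    show "\<pi> x = \<zero>\<^bsub>A\<^esub>" if x: "x \<in> F_ge t" for x
      using ker[OF submodule_memD(2)[OF F_module F_ge_submodule x]] cl_F_ge_ideal_power t x by blast
    show "\<exists>x\<in>F_ge 2. f \<ominus>\<^bsub>F\<^esub> x \<in> mlin" if f: "f \<in> carrier F" "\<pi> f = \<zero>\<^bsub>A\<^esub>" for f
    proof -
      have "cl f \<in> cl ` F_ge 2" using ker[OF f(1)] f(2) two ideal_power_2_cl_F_ge by blast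
      then show ?thesis using cl_eq_iff[OF f(1)] submodule_memD(2)[OF F_module F_ge_submodule] by blast
    qed
  qed
qed

end

section \<open>The radical and nilpotent ideals\<close>

context ring
begin

text \<open>Negatives come from multiplication by \<open>-1\<close>, so closure under them does not
  appear among the conditions.\<close>

lemma left_idealI:
  assumes "I \<subseteq> carrier R" "\<zero> \<in> I" "\<And>x y. x \<in> I \<Longrightarrow> y \<in> I \<Longrightarrow> x \<oplus> y \<in> I"
    "\<And>r x. r \<in> carrier R \<Longrightarrow> x \<in> I \<Longrightarrow> r \<otimes> x \<in> I"
  shows "left_ideal I R"
proof -
  have "\<ominus> x \<in> I" if "x \<in> I" for x
    using assms(4)[of "\<ominus> \<one>" x] that assms(1) by (auto simp: l_minus)
  then have "subgroup I (add_monoid R)"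
    using assms by (intro subgroup.intro) (auto simp: a_inv_def)
  then show ?thesis using assms by (simp add: left_ideal_def additive_subgroup_def)
qed

lemma left_idealD:
  assumes "left_ideal I R"
  shows "x \<in> I \<Longrightarrow> x \<in> carrier R" "\<zero> \<in> I" "x \<in> I \<Longrightarrow> y \<in> I \<Longrightarrow> x \<oplus> y \<in> I"
    "r \<in> carrier R \<Longrightarrow> x \<in> I \<Longrightarrow> r \<otimes> x \<in> I" "x \<in> I \<Longrightarrow> y \<in> I \<Longrightarrow> x \<ominus> y \<in> I"
proof -
  interpret additive_subgroup I R using assms by (simp add: left_ideal_def)
  show "x \<in> I \<Longrightarrow> x \<in> carrier R" "\<zero> \<in> I" "x \<in> I \<Longrightarrow> y \<in> I \<Longrightarrow> x \<oplus> y \<in> I"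
    "r \<in> carrier R \<Longrightarrow> x \<in> I \<Longrightarrow> r \<otimes> x \<in> I" "x \<in> I \<Longrightarrow> y \<in> I \<Longrightarrow> x \<ominus> y \<in> I"
    using assms by (simp_all add: left_ideal_def minus_eq)
qed

lemma left_ideal_one: "left_ideal I R \<Longrightarrow> \<one> \<in> I \<Longrightarrow> I = carrier R"
  using left_idealD[of I] by (metis r_one subsetI subset_antisym)

text \<open>Zorn's lemma for the left ideals that avoid the identity. Avoiding the identity is the
  same as being proper, and it passes to unions of chains.\<close>

lemma exists_maximal_left_ideal:
  assumes "\<one> \<noteq> \<zero>"
  shows "\<exists>M. maximal_left_ideal M R"
proof -
  let ?S = "{I. left_ideal I R \<and> \<one> \<notin> I}"
  have "left_ideal {\<zero>} R" by (rule left_idealI) auto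
  then have ne: "?S \<noteq> {}" using assms by auto
  have ch: "\<Union>C \<in> ?S" if C: "C \<noteq> {}" "subset.chain ?S C" for C
  proof -
    have l: "\<And>I. I \<in> C \<Longrightarrow> left_ideal I R \<and> \<one> \<notin> I" and c: "\<And>I J. I \<in> C \<Longrightarrow> J \<in> C \<Longrightarrow> I \<subseteq> J \<or> J \<subseteq> I"
      using C(2) by (auto simp: subset_chain_def)
    have "left_ideal (\<Union>C) R"
    proof (rule left_idealI)
      show "\<Union>C \<subseteq> carrier R" using l left_idealD(1) by blast
      show "\<zero> \<in> \<Union>C" using l left_idealD(2) C(1) by blast
      fix x y assume "x \<in> \<Union>C" "y \<in> \<Union>C"
      then obtain I J where "I \<in> C" "J \<in> C" "x \<in> I" "y \<in> J" by blast
      then show "x \<oplus> y \<in> \<Union>C" using c[of I J] l left_idealD(3) by (metis UnionI subsetD)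
    next
      fix r x assume "r \<in> carrier R" "x \<in> \<Union>C"
      then show "r \<otimes> x \<in> \<Union>C" using l left_idealD(4) by blast
    qed
    then show ?thesis using l by blast
  qed
  obtain M where M: "M \<in> ?S" "\<And>X. X \<in> ?S \<Longrightarrow> M \<subseteq> X \<Longrightarrow> X = M"
    using subset_Zorn_nonempty[OF ne ch] by blast
  have "M \<noteq> carrier R" using M(1) by auto
  moreover have "J = M \<or> J = carrier R" if "left_ideal J R" "M \<subseteq> J" for J
    using M(2)[of J] that left_ideal_one[of J] by blast
  ultimately have "maximal_left_ideal M R" using M(1) by (simp add: maximal_left_ideal_def)
  then show ?thesis ..
qed

text \<open>The witness is \<open>1 + j + ... + j^(n-1)\<close>; for nilpotent \<open>j\<close> it
  is a left inverse of \<open>1 - j\<close>.\<close>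

lemma geometric_series:
  assumes j: "j \<in> carrier R"
  shows "\<exists>s\<in>carrier R. s \<otimes> (\<one> \<ominus> j) = \<one> \<ominus> j [^] (n::nat)"
proof (induct n)
  case 0
  show ?case using j by (intro bexI[of _ \<zero>]) (auto simp: minus_eq r_neg)
next
  case (Suc n)
  then obtain s where s: "s \<in> carrier R" "s \<otimes> (\<one> \<ominus> j) = \<one> \<ominus> j [^] n" by blast
  have "j [^] n \<otimes> (\<one> \<ominus> j) = j [^] n \<ominus> j [^] n \<otimes> j"
    using j by (simp add: r_distr minus_eq r_minus)
  then have "(s \<oplus> j [^] n) \<otimes> (\<one> \<ominus> j) = s \<otimes> (\<one> \<ominus> j) \<oplus> (j [^] n \<ominus> j [^] n \<otimes> j)"
    using s(1) j by (simp add: l_distr)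
  also have "\<dots> = \<one> \<ominus> j [^] Suc n"
    unfolding s(2) using j by (simp add: minus_eq a_assoc r_neg1)
  finally show ?case using s(1) j by blast
qed

text \<open>If \<open>I\<close> were not contained in a maximal left ideal \<open>M\<close>, then
  \<open>M + I\<close> would be everything and \<open>1 = m + j\<close>. As \<open>j\<close> is
  nilpotent, \<open>m = 1 - j\<close> has a left inverse, which puts the identity into
  \<open>M\<close>.\<close>

lemma nil_ideal_subset_radical:
  assumes I: "ideal I R" and nil: "\<And>j. j \<in> I \<Longrightarrow> \<exists>n::nat. j [^] n = \<zero>"
  shows "I \<subseteq> radical R"
proof -
  interpret I: ideal I R by fact
  have "I \<subseteq> M" if M: "maximal_left_ideal M R" for M
  proof (rule ccontr)
    assume nsub: "\<not> I \<subseteq> M"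
    have lM: "left_ideal M R" using M by (simp add: maximal_left_ideal_def)
    note Md = left_idealD[OF lM]
    let ?L = "{m \<oplus> j | m j. m \<in> M \<and> j \<in> I}"
    have "left_ideal ?L R"
    proof (rule left_idealI)
      show "?L \<subseteq> carrier R" using Md(1) I.Icarr by auto
      have "\<zero> \<oplus> \<zero> \<in> ?L" using Md(2) I.zero_closed by blast
      then show "\<zero> \<in> ?L" by simp
    next
      fix x y assume "x \<in> ?L" "y \<in> ?L"
      then obtain m j m' j' where x: "x = m \<oplus> j" "m \<in> M" "j \<in> I" and y: "y = m' \<oplus> j'" "m' \<in> M" "j' \<in> I" by blast
      have "x \<oplus> y = (m \<oplus> m') \<oplus> (j \<oplus> j')"
        using x y Md(1) I.Icarr by (simp add: a_ac)
      then show "x \<oplus> y \<in> ?L" using Md(3)[OF x(2) y(2)] I.a_closed[OF x(3) y(3)] by blast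
    next
      fix r x assume r: "r \<in> carrier R" and "x \<in> ?L"
      then obtain m j where x: "x = m \<oplus> j" "m \<in> M" "j \<in> I" by blast
      have "r \<otimes> x = r \<otimes> m \<oplus> r \<otimes> j" using x r Md(1) I.Icarr by (simp add: r_distr)
      then show "r \<otimes> x \<in> ?L" using Md(4)[OF r x(2)] I.I_l_closed[OF x(3) r] by blast
    qed
    moreover have "M \<subseteq> ?L"
    proof
      fix m assume "m \<in> M"
      then have "m \<oplus> \<zero> \<in> ?L" using I.zero_closed by blast
      then show "m \<in> ?L" using Md(1)[OF \<open>m \<in> M\<close>] by simp
    qed
    moreover have "?L \<noteq> M"
    proof -
      obtain j where j: "j \<in> I" "j \<notin> M" using nsub by blast
      then have "\<zero> \<oplus> j \<in> ?L" using Md(2) by blast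
      then show ?thesis using j I.Icarr[OF j(1)] by auto
    qed
    ultimately have "?L = carrier R" using M unfolding maximal_left_ideal_def by blast
    then have "\<one> \<in> ?L" by simp
    then obtain m j where mj: "\<one> = m \<oplus> j" "m \<in> M" "j \<in> I" by blast
    have jc: "j \<in> carrier R" and mc: "m \<in> carrier R" using I.Icarr mj Md(1) by auto
    have m: "\<one> \<ominus> j = m" using mj(1) jc mc by (simp add: minus_eq a_assoc r_neg)
    obtain n :: nat where n: "j [^] n = \<zero>" using nil[OF mj(3)] by blast
    obtain s where s: "s \<in> carrier R" "s \<otimes> m = \<one> \<ominus> \<zero>"
      using geometric_series[OF jc, of n] unfolding m n by blast
    then have "\<one> \<in> M" using Md(4)[OF s(1) mj(2)] by (simp add: minus_eq)
    then show False using left_ideal_one[OF lM] M by (simp add: maximal_left_ideal_def)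
  qed
  then show ?thesis unfolding radical_def using I.a_subset by blast
qed

end

text \<open>
  For a maximal left ideal \<open>M\<close> of \<open>S\<close> and \<open>c \<notin> M\<close>, the preimage of
  \<open>{b. b c \<in> M}\<close> is a maximal left ideal again; since \<open>{b. b S \<subseteq> M}\<close> is a proper
  two-sided ideal of the simple ring \<open>S\<close>, the intersection over all \<open>c\<close> is the kernel.
\<close>
lemma radical_surj_simple:
  assumes A: "ring A" and S: "ring S" and h: "h \<in> ring_hom A S" "h ` carrier A = carrier S"
    and simple: "carrier S \<noteq> {\<zero>\<^bsub>S\<^esub>}" "\<And>I. ideal I S \<Longrightarrow> I = {\<zero>\<^bsub>S\<^esub>} \<or> I = carrier S"
    and a: "a \<in> radical A"
  shows "h a = \<zero>\<^bsub>S\<^esub>"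
proof (rule ccontr)
  assume nz: "h a \<noteq> \<zero>\<^bsub>S\<^esub>"
  interpret A: ring A by fact
  interpret S: ring S by fact
  have ac: "a \<in> carrier A" using a by (simp add: radical_def)
  note hc = ring_hom_closed[OF h(1)]
  have lift: "\<exists>x\<in>carrier A. h x = y" if "y \<in> carrier S" for y using that h(2) by (metis imageE)
  obtain M where M: "maximal_left_ideal M S"
    using S.exists_maximal_left_ideal simple(1) S.carrier_one_not_zero by blast
  have lM: "left_ideal M S" and ne: "M \<noteq> carrier S" using M by (simp_all add: maximal_left_ideal_def)
  note Md = S.left_idealD[OF lM]
  define P where "P = {b \<in> carrier S. \<forall>c\<in>carrier S. b \<otimes>\<^bsub>S\<^esub> c \<in> M}"
  have lP: "left_ideal P S"
    by (rule S.left_idealI) (auto simp: P_def Md S.l_distr S.m_assoc)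
  have "ideal P S"
  proof (rule idealI[OF S])
    show "subgroup P (add_monoid S)" using lP by (simp add: left_ideal_def additive_subgroup_def)
    show "x \<otimes>\<^bsub>S\<^esub> b \<in> P" if "b \<in> P" "x \<in> carrier S" for b x
      using S.left_idealD(4)[OF lP that(2,1)] .
    show "b \<otimes>\<^bsub>S\<^esub> x \<in> P" if "b \<in> P" "x \<in> carrier S" for b x
      using that by (simp add: P_def S.m_assoc)
  qed
  moreover have "P \<noteq> carrier S"
  proof
    assume "P = carrier S"
    then have "\<one>\<^bsub>S\<^esub> \<in> P" by simp
    then have "\<one>\<^bsub>S\<^esub> \<otimes>\<^bsub>S\<^esub> \<one>\<^bsub>S\<^esub> \<in> M" unfolding P_def by blast
    then show False using S.left_ideal_one[OF lM] ne by simp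
  qed
  ultimately have "P = {\<zero>\<^bsub>S\<^esub>}" using simple(2) by blast
  \<comment> \<open>The nonzero element \<open>h a\<close> is outside the zero ideal
    \<open>P\<close>, so some \<open>c\<close> moves it out of \<open>M\<close>.\<close>
  then obtain c where c: "c \<in> carrier S" "h a \<otimes>\<^bsub>S\<^esub> c \<notin> M"
    using nz hc[OF ac] by (auto simp: P_def)
  define N where "N = {x \<in> carrier A. h x \<otimes>\<^bsub>S\<^esub> c \<in> M}"
  have lN: "left_ideal N A"
    using c(1) ring_hom_zero[OF h(1) A S]
    by (intro A.left_idealI)
      (auto simp: N_def Md hc ring_hom_add[OF h(1)] ring_hom_mult[OF h(1)] S.l_distr S.m_assoc)
  have "maximal_left_ideal N A"
    unfolding maximal_left_ideal_def
  proof (intro conjI allI impI lN)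
    show "N \<noteq> carrier A" using c ac by (auto simp: N_def)
    fix J assume J: "left_ideal J A \<and> N \<subseteq> J"
    then have lJ: "left_ideal J A" by simp
    note Jd = A.left_idealD[OF lJ]
    have "J = carrier A" if "J \<noteq> N"
    proof -
      from that
      obtain y where y: "y \<in> J" "y \<notin> N" using J by blast
      have yc: "y \<in> carrier A" using Jd(1) y(1) .
      have yM: "h y \<otimes>\<^bsub>S\<^esub> c \<notin> M" using y(2) yc by (simp add: N_def)
      \<comment> \<open>This left ideal contains \<open>M\<close> and also \<open>h y c\<close>,
        which is outside \<open>M\<close>; by maximality of \<open>M\<close> it is all of
        \<open>S\<close>.\<close>
      let ?L = "{u \<otimes>\<^bsub>S\<^esub> (h y \<otimes>\<^bsub>S\<^esub> c) \<oplus>\<^bsub>S\<^esub> m | u m. u \<in> carrier S \<and> m \<in> M}"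
      have hyc: "h y \<otimes>\<^bsub>S\<^esub> c \<in> carrier S" using hc[OF yc] c(1) by simp
      have "left_ideal ?L S"
      proof (rule S.left_idealI)
        show "?L \<subseteq> carrier S" using hyc Md(1) by auto
        have "\<zero>\<^bsub>S\<^esub> \<otimes>\<^bsub>S\<^esub> (h y \<otimes>\<^bsub>S\<^esub> c) \<oplus>\<^bsub>S\<^esub> \<zero>\<^bsub>S\<^esub> \<in> ?L" using Md(2) by blast
        then show "\<zero>\<^bsub>S\<^esub> \<in> ?L" using hyc by simp
      next
        fix r s assume "r \<in> ?L" "s \<in> ?L"
        then obtain u m u' m' where r: "r = u \<otimes>\<^bsub>S\<^esub> (h y \<otimes>\<^bsub>S\<^esub> c) \<oplus>\<^bsub>S\<^esub> m" "u \<in> carrier S" "m \<in> M"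
          and s: "s = u' \<otimes>\<^bsub>S\<^esub> (h y \<otimes>\<^bsub>S\<^esub> c) \<oplus>\<^bsub>S\<^esub> m'" "u' \<in> carrier S" "m' \<in> M" by blast
        have "r \<oplus>\<^bsub>S\<^esub> s = (u \<oplus>\<^bsub>S\<^esub> u') \<otimes>\<^bsub>S\<^esub> (h y \<otimes>\<^bsub>S\<^esub> c) \<oplus>\<^bsub>S\<^esub> (m \<oplus>\<^bsub>S\<^esub> m')"
          using r s Md(1) hyc by (simp add: S.l_distr S.a_ac)
        then show "r \<oplus>\<^bsub>S\<^esub> s \<in> ?L" using Md(3)[OF r(3) s(3)] r(2) s(2) by blast
      next
        fix r s assume r: "r \<in> carrier S" and "s \<in> ?L"
        then obtain u m where s: "s = u \<otimes>\<^bsub>S\<^esub> (h y \<otimes>\<^bsub>S\<^esub> c) \<oplus>\<^bsub>S\<^esub> m" "u \<in> carrier S" "m \<in> M" by blast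
        have "r \<otimes>\<^bsub>S\<^esub> s = (r \<otimes>\<^bsub>S\<^esub> u) \<otimes>\<^bsub>S\<^esub> (h y \<otimes>\<^bsub>S\<^esub> c) \<oplus>\<^bsub>S\<^esub> (r \<otimes>\<^bsub>S\<^esub> m)"
          using r s Md(1) hyc by (simp add: S.r_distr S.m_assoc)
        then show "r \<otimes>\<^bsub>S\<^esub> s \<in> ?L" using Md(4)[OF r s(3)] r s(2) by blast
      qed
      moreover have "M \<subseteq> ?L"
      proof
        fix m assume m: "m \<in> M"
        then have "\<zero>\<^bsub>S\<^esub> \<otimes>\<^bsub>S\<^esub> (h y \<otimes>\<^bsub>S\<^esub> c) \<oplus>\<^bsub>S\<^esub> m \<in> ?L" by blast
        then show "m \<in> ?L" using hyc Md(1)[OF m] by simp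
      qed
      moreover have "h y \<otimes>\<^bsub>S\<^esub> c \<in> ?L"
      proof -
        have "\<one>\<^bsub>S\<^esub> \<otimes>\<^bsub>S\<^esub> (h y \<otimes>\<^bsub>S\<^esub> c) \<oplus>\<^bsub>S\<^esub> \<zero>\<^bsub>S\<^esub> \<in> ?L" using Md(2) by blast
        then show ?thesis using hyc by simp
      qed
      ultimately have L: "?L = carrier S" using M yM unfolding maximal_left_ideal_def by blast
      show "J = carrier A"
      proof
        show "J \<subseteq> carrier A" using Jd(1) by blast
        show "carrier A \<subseteq> J"
        proof
          fix z assume z: "z \<in> carrier A"
          then have "h z \<otimes>\<^bsub>S\<^esub> c \<in> ?L" unfolding L using hc c(1) by simp
          then obtain u m where um: "h z \<otimes>\<^bsub>S\<^esub> c = u \<otimes>\<^bsub>S\<^esub> (h y \<otimes>\<^bsub>S\<^esub> c) \<oplus>\<^bsub>S\<^esub> m" "u \<in> carrier S" "m \<in> M" by blast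
          obtain u' where u': "u' \<in> carrier A" "h u' = u" using lift[OF um(2)] by blast
          \<comment> \<open>Subtracting \<open>u' y\<close>, where \<open>u'\<close> lifts
            \<open>u\<close>, leaves an element that multiplies \<open>c\<close> into
            \<open>M\<close>. So \<open>z\<close> is an element of \<open>N\<close> plus a multiple
            of \<open>y\<close>, both inside \<open>J\<close>.\<close>
          have hm: "h (z \<ominus>\<^bsub>A\<^esub> u' \<otimes>\<^bsub>A\<^esub> y) = h z \<ominus>\<^bsub>S\<^esub> u \<otimes>\<^bsub>S\<^esub> h y"
          proof -
            interpret hh: ring_hom_ring A S h by (rule ring_hom_ringI2[OF A S h(1)])
            show ?thesis using z u' yc by (simp add: A.minus_eq S.minus_eq)
          qed
          have "(h z \<ominus>\<^bsub>S\<^esub> u \<otimes>\<^bsub>S\<^esub> h y) \<otimes>\<^bsub>S\<^esub> c = h z \<otimes>\<^bsub>S\<^esub> c \<ominus>\<^bsub>S\<^esub> u \<otimes>\<^bsub>S\<^esub> (h y \<otimes>\<^bsub>S\<^esub> c)"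
            using z um(2) yc c(1) hc by (simp add: S.minus_eq S.l_distr S.l_minus S.m_assoc)
          also have "\<dots> = m"
            unfolding um(1) using um(2) hyc Md(1)[OF um(3)]
            by (simp add: S.minus_eq S.a_ac S.r_neg S.r_neg1 S.r_neg2)
          finally have "z \<ominus>\<^bsub>A\<^esub> u' \<otimes>\<^bsub>A\<^esub> y \<in> N"
            using um(3) z u'(1) yc by (simp add: N_def hm)
          then have "(z \<ominus>\<^bsub>A\<^esub> u' \<otimes>\<^bsub>A\<^esub> y) \<oplus>\<^bsub>A\<^esub> u' \<otimes>\<^bsub>A\<^esub> y \<in> J"
            using J Jd(3) Jd(4)[OF u'(1) y(1)] by blast
          moreover have "(z \<ominus>\<^bsub>A\<^esub> u' \<otimes>\<^bsub>A\<^esub> y) \<oplus>\<^bsub>A\<^esub> u' \<otimes>\<^bsub>A\<^esub> y = z"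
            using z u'(1) yc by (simp add: A.minus_eq A.a_assoc A.l_neg)
          ultimately show "z \<in> J" by simp
        qed
      qed
    qed
    then show "J = N \<or> J = carrier A" by blast
  qed
  then have "a \<in> N" using a by (auto simp: radical_def)
  then show False using c(2) by (simp add: N_def)
qed

section \<open>Algebras presented by paths\<close>

text \<open>The conditions on \<open>\<pi>\<close> are those that \<open>presentation\<close>
  extracts from the relations; simplicity of the vertex algebras joins them here.\<close>

locale presented_algebra = path_data K \<Delta> B
  for K :: "'k ring" and \<Delta> :: "('v, 'e) pre_digraph" and B :: "'v \<Rightarrow> ('k, 'b) module" +
  fixes A :: "('k, 'a) module" and \<pi> :: "(('v, 'e, 'b) bpath \<Rightarrow> 'k) \<Rightarrow> 'a" and t :: nat
  assumes A_alg: "k_algebra K A"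
    and B_simple: "v \<in> verts \<Delta> \<Longrightarrow> simple_algebra K (B v)"
    and \<pi>_lin: "\<pi> \<in> lin_maps K (free_bpath_algebra K \<Delta> B) A"
    and \<pi>_hom: "\<pi> \<in> ring_hom (free_bpath_algebra K \<Delta> B) A"
    and \<pi>_image: "\<pi> ` carrier (free_bpath_algebra K \<Delta> B) = carrier A"
    and \<pi>_mlin: "x \<in> multilinearity K \<Delta> B \<Longrightarrow> \<pi> x = \<zero>\<^bsub>A\<^esub>"
    and \<pi>_nil: "x \<in> path_data.F_ge K \<Delta> B t \<Longrightarrow> \<pi> x = \<zero>\<^bsub>A\<^esub>"
    and \<pi>_ker: "f \<in> carrier (free_bpath_algebra K \<Delta> B) \<Longrightarrow> \<pi> f = \<zero>\<^bsub>A\<^esub> \<Longrightarrow>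
      \<exists>x\<in>path_data.F_ge K \<Delta> B 2. f \<ominus>\<^bsub>free_bpath_algebra K \<Delta> B\<^esub> x \<in> multilinearity K \<Delta> B"
begin

sublocale A: ring A using A_alg k_algebraD by blast
sublocale Am: module K A using A_alg k_algebraD by blast

lemma A_module: "module K A" using A_alg k_algebraD by blast

section \<open>Path elements of A and the induced filtration\<close>

definition x where "x p = \<pi> (bas p)"

lemma x_closed: "bp p \<Longrightarrow> x p \<in> carrier A"
  unfolding x_def by (rule lin_maps_closed[OF \<pi>_lin bas_closed])

lemma \<pi>_zero: "\<pi> \<zero>\<^bsub>F\<^esub> = \<zero>\<^bsub>A\<^esub>"
  by (rule lin_maps_zero[OF F_module A_module \<pi>_lin])

lemma x_mult:
  assumes "bp p" "bp q"
  shows "x p \<otimes>\<^bsub>A\<^esub> x q = (if bp_end p = bp_start \<Delta> q then x (bp_mult B p q) else \<zero>\<^bsub>A\<^esub>)"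
  unfolding x_def using ring_hom_mult[OF \<pi>_hom bas_closed[OF assms(1)] bas_closed[OF assms(2)]]
  by (simp add: F_mult_bas[OF assms] \<pi>_zero split: if_splits)

lemma x_multilinear: "multilinear_on_paths A x"
  unfolding multilinear_on_paths_def
proof (intro conjI allI impI)
  show "bp p \<Longrightarrow> x p \<in> carrier A" for p by (rule x_closed)
  fix p p' p'' assume a: "bp p" "bp p'" "entry_sum \<Delta> B p p' p''"
  have g: "bas p'' \<ominus>\<^bsub>F\<^esub> (bas p \<oplus>\<^bsub>F\<^esub> bas p') \<in> mlin"
    unfolding mlin_eq by (rule subsetD[OF lin_span_superset mlin_gens_sum[OF a]])
  have p'': "bp p''" using entry_sum_bp a by blast
  have c: "bas p \<oplus>\<^bsub>F\<^esub> bas p' \<in> carrier F" using a bas_closed by simp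
  have "\<pi> (bas p'') \<ominus>\<^bsub>A\<^esub> \<pi> (bas p \<oplus>\<^bsub>F\<^esub> bas p') = \<zero>\<^bsub>A\<^esub>"
    using \<pi>_mlin[OF g] lin_maps_minus[OF F_module A_module \<pi>_lin bas_closed[OF p''] c] by simp
  then have "\<pi> (bas p'') = \<pi> (bas p \<oplus>\<^bsub>F\<^esub> bas p')"
    by (rule A.eq_if_minus_eq_zero[OF lin_maps_closed[OF \<pi>_lin bas_closed[OF p'']] lin_maps_closed[OF \<pi>_lin c]])
  then show "x p'' = x p \<oplus>\<^bsub>A\<^esub> x p'"
    unfolding x_def lin_maps_add[OF \<pi>_lin bas_closed[OF a(1)] bas_closed[OF a(2)]] .
next
  fix c p p' assume a: "c \<in> carrier K" "bp p" "entry_smult \<Delta> B c p p'"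
  have g: "bas p' \<ominus>\<^bsub>F\<^esub> c \<odot>\<^bsub>F\<^esub> bas p \<in> mlin"
    unfolding mlin_eq by (rule subsetD[OF lin_span_superset mlin_gens_smult[OF a]])
  have p': "bp p'" using entry_smult_bp a by blast
  have c: "c \<odot>\<^bsub>F\<^esub> bas p \<in> carrier F" using a bas_closed by simp
  have "\<pi> (bas p') \<ominus>\<^bsub>A\<^esub> \<pi> (c \<odot>\<^bsub>F\<^esub> bas p) = \<zero>\<^bsub>A\<^esub>"
    using \<pi>_mlin[OF g] lin_maps_minus[OF F_module A_module \<pi>_lin bas_closed[OF p'] c] by simp
  then have "\<pi> (bas p') = \<pi> (c \<odot>\<^bsub>F\<^esub> bas p)"
    by (rule A.eq_if_minus_eq_zero[OF lin_maps_closed[OF \<pi>_lin bas_closed[OF p']] lin_maps_closed[OF \<pi>_lin c]])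
  then show "x p' = c \<odot>\<^bsub>A\<^esub> x p"
    unfolding x_def lin_maps_smult[OF \<pi>_lin a(1) bas_closed[OF a(2)]] .
qed

lemma x_entry_sum: "bp p \<Longrightarrow> bp p' \<Longrightarrow> entry_sum \<Delta> B p p' p'' \<Longrightarrow> x p'' = x p \<oplus>\<^bsub>A\<^esub> x p'"
  and x_entry_smult: "c \<in> carrier K \<Longrightarrow> bp p \<Longrightarrow> entry_smult \<Delta> B c p p' \<Longrightarrow> x p' = c \<odot>\<^bsub>A\<^esub> x p"
  using x_multilinear unfolding multilinear_on_paths_def by blast+

text \<open>These ideals satisfy \<open>R 0 = A\<close>, \<open>R t = 0\<close>, and the product of
  \<open>R m\<close> and \<open>R n\<close> lies in \<open>R (m + n)\<close>; elements of
  \<open>R 1\<close> are therefore nilpotent.\<close>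

definition R where "R n = \<pi> ` F_ge n"

lemma R_ideal: "ideal (R n) A"
  unfolding R_def by (rule image_ideal[OF FA.ring_axioms A.ring_axioms \<pi>_hom \<pi>_image F_ge_ideal])

lemma R_closed: "a \<in> R n \<Longrightarrow> a \<in> carrier A"
  using ideal.Icarr[OF R_ideal] .

lemma x_R: "bp p \<Longrightarrow> n \<le> bp_length p \<Longrightarrow> x p \<in> R n"
  unfolding x_def R_def by (rule imageI[OF F_ge_bas])

lemma R_0: "R 0 = carrier A"
  unfolding R_def F_ge_def \<pi>_image[symmetric] by (simp add: bas_span)

lemma R_t: "R t = {\<zero>\<^bsub>A\<^esub>}"
proof -
  have "R t \<subseteq> {\<zero>\<^bsub>A\<^esub>}" unfolding R_def using \<pi>_nil by auto
  then show ?thesis using additive_subgroup.zero_closed[OF ideal.axioms(1)[OF R_ideal]] by blast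
qed

lemma R_mult: "a \<in> R m \<Longrightarrow> b \<in> R n \<Longrightarrow> a \<otimes>\<^bsub>A\<^esub> b \<in> R (m + n)"
proof -
  assume "a \<in> R m" "b \<in> R n"
  then obtain f g where fg: "f \<in> F_ge m" "a = \<pi> f" "g \<in> F_ge n" "b = \<pi> g" unfolding R_def by blast
  have "a \<otimes>\<^bsub>A\<^esub> b = \<pi> (f \<otimes>\<^bsub>F\<^esub> g)"
    using fg submodule_memD(2)[OF F_module F_ge_submodule] ring_hom_mult[OF \<pi>_hom] by simp
  then show ?thesis unfolding R_def using F_ge_mult[OF fg(1,3)] by blast
qed

text \<open>
  Scalars can be absorbed into the first entry of a path, so sums of paths already
  exhaust the span.
\<close>

lemma x_smult_ex: 
  assumes c: "c \<in> carrier K" and p: "bp p"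
  shows "\<exists>q. bp q \<and> bp_length q = bp_length p \<and> c \<odot>\<^bsub>A\<^esub> x p = x q"
proof -
  have "\<exists>q. entry_smult \<Delta> B c p q" by (cases p) (auto intro: entry_smult.intros)
  then show ?thesis
    using entry_smult_bp[OF _ c p] entry_smult_same x_entry_smult[OF c p] by metis
qed

text \<open>The span is defined from outside, as an intersection of submodules. The description by
  supports is what truncation by length requires in \<open>R_induct\<close>.\<close>

lemma F_ge_supp:
  assumes "f \<in> F_ge n" shows "f p \<noteq> \<zero>\<^bsub>K\<^esub> \<Longrightarrow> n \<le> bp_length p"
proof -
  have "submodule {f \<in> carrier F. \<forall>p. f p \<noteq> \<zero>\<^bsub>K\<^esub> \<longrightarrow> n \<le> bp_length p} K F"
  proof (rule F.submoduleI)
    \<comment> \<open>Negation in \<open>F\<close> is the abstract inverse of the additive group;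
      written as multiplication by \<open>-1\<close> it becomes pointwise, and its support is
      visible.\<close>
    have minus: "\<ominus>\<^bsub>F\<^esub> a = (\<ominus>\<^bsub>K\<^esub> \<one>\<^bsub>K\<^esub>) \<odot>\<^bsub>F\<^esub> a" if "a \<in> carrier F" for a
      using that F.smult_l_minus[of "\<one>\<^bsub>K\<^esub>" a] by simp
    fix a assume "a \<in> {f \<in> carrier F. \<forall>p. f p \<noteq> \<zero>\<^bsub>K\<^esub> \<longrightarrow> n \<le> bp_length p}"
    then have a: "a \<in> carrier F" "\<forall>p. a p \<noteq> \<zero>\<^bsub>K\<^esub> \<longrightarrow> n \<le> bp_length p" by auto
    have "(\<ominus>\<^bsub>F\<^esub> a) p \<noteq> \<zero>\<^bsub>K\<^esub> \<longrightarrow> n \<le> bp_length p" for p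
      unfolding minus[OF a(1)] using a(2) by (cases "a p = \<zero>\<^bsub>K\<^esub>") (simp_all add: F_simps)
    then show "\<ominus>\<^bsub>F\<^esub> a \<in> {f \<in> carrier F. \<forall>p. f p \<noteq> \<zero>\<^bsub>K\<^esub> \<longrightarrow> n \<le> bp_length p}"
      using a(1) by simp
  next
    fix a b assume "a \<in> {f \<in> carrier F. \<forall>p. f p \<noteq> \<zero>\<^bsub>K\<^esub> \<longrightarrow> n \<le> bp_length p}" "b \<in> {f \<in> carrier F. \<forall>p. f p \<noteq> \<zero>\<^bsub>K\<^esub> \<longrightarrow> n \<le> bp_length p}"
    then have ab: "a \<in> carrier F" "b \<in> carrier F" "\<forall>p. a p \<noteq> \<zero>\<^bsub>K\<^esub> \<longrightarrow> n \<le> bp_length p" "\<forall>p. b p \<noteq> \<zero>\<^bsub>K\<^esub> \<longrightarrow> n \<le> bp_length p"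
      by auto
    have "a p \<oplus>\<^bsub>K\<^esub> b p \<noteq> \<zero>\<^bsub>K\<^esub> \<Longrightarrow> a p \<noteq> \<zero>\<^bsub>K\<^esub> \<or> b p \<noteq> \<zero>\<^bsub>K\<^esub>" for p by auto
    then show "a \<oplus>\<^bsub>F\<^esub> b \<in> {f \<in> carrier F. \<forall>p. f p \<noteq> \<zero>\<^bsub>K\<^esub> \<longrightarrow> n \<le> bp_length p}"
      using ab F_add_closed[OF ab(1,2)] unfolding F_simps(2) by blast
  next
    fix c a assume c: "c \<in> carrier K" and "a \<in> {f \<in> carrier F. \<forall>p. f p \<noteq> \<zero>\<^bsub>K\<^esub> \<longrightarrow> n \<le> bp_length p}"
    then have a: "a \<in> carrier F" "\<forall>p. a p \<noteq> \<zero>\<^bsub>K\<^esub> \<longrightarrow> n \<le> bp_length p" by auto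
    have "(c \<odot>\<^bsub>F\<^esub> a) p \<noteq> \<zero>\<^bsub>K\<^esub> \<longrightarrow> n \<le> bp_length p" for p
      using a(2) c by (cases "a p = \<zero>\<^bsub>K\<^esub>") (simp_all add: F_simps)
    then show "c \<odot>\<^bsub>F\<^esub> a \<in> {f \<in> carrier F. \<forall>p. f p \<noteq> \<zero>\<^bsub>K\<^esub> \<longrightarrow> n \<le> bp_length p}"
      using a(1) c by simp
  qed (use F.M.zero_closed in \<open>simp_all add: F_simps Collect_restrict\<close>)
  then have "F_ge n \<subseteq> {f \<in> carrier F. \<forall>p. f p \<noteq> \<zero>\<^bsub>K\<^esub> \<longrightarrow> n \<le> bp_length p}"
    unfolding F_ge_def
  proof (rule lin_span_least)
    show "{bas p | p. bp p \<and> n \<le> bp_length p} \<subseteq> {f \<in> carrier F. \<forall>p. f p \<noteq> \<zero>\<^bsub>K\<^esub> \<longrightarrow> n \<le> bp_length p}"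
    proof (intro subsetI CollectI conjI allI impI; elim CollectE exE conjE)
      fix f p assume "f = bas p" "bp p" "n \<le> bp_length p"
      then show "f \<in> carrier F" "f q \<noteq> \<zero>\<^bsub>K\<^esub> \<Longrightarrow> n \<le> bp_length q" for q
        using bas_closed by (auto simp: bp_basis_def split: if_splits)
    qed
  qed
  then show "f p \<noteq> \<zero>\<^bsub>K\<^esub> \<Longrightarrow> n \<le> bp_length p" using assms by blast
qed

text \<open>The underlying induction runs over all of \<open>F\<close>, but its predicate concerns
  the truncation \<open>r f\<close> to paths of length at least \<open>n\<close>, which fixes the
  elements of \<open>F_ge n\<close>. There is no case for scalars, because they are absorbed into
  the paths.\<close>

lemma R_induct [consumes 1, case_names zero path add]:
  assumes a: "a \<in> R n" and z: "P \<zero>\<^bsub>A\<^esub>" and s: "\<And>p. bp p \<Longrightarrow> n \<le> bp_length p \<Longrightarrow> P (x p)"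
    and add: "\<And>a b. a \<in> R n \<Longrightarrow> b \<in> R n \<Longrightarrow> P a \<Longrightarrow> P b \<Longrightarrow> P (a \<oplus>\<^bsub>A\<^esub> b)"
  shows "P a"
proof -
  define r where "r f = (\<lambda>p. if n \<le> bp_length p then f p else \<zero>\<^bsub>K\<^esub>)" for f :: "('v, 'e, 'b) bpath \<Rightarrow> 'k"
  have r_add: "r (f \<oplus>\<^bsub>F\<^esub> g) = r f \<oplus>\<^bsub>F\<^esub> r g" for f g
    by (auto simp: r_def F_simps)
  have r_smult: "c \<in> carrier K \<Longrightarrow> r (c \<odot>\<^bsub>F\<^esub> f) = c \<odot>\<^bsub>F\<^esub> r f" for c f
    by (auto simp: r_def F_simps)
  have r_bas: "r (bas p) = (if n \<le> bp_length p then bas p else \<zero>\<^bsub>F\<^esub>)" for p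
    by (auto simp: r_def bp_basis_def F_simps)
  have r_zero: "r \<zero>\<^bsub>F\<^esub> = \<zero>\<^bsub>F\<^esub>" by (auto simp: r_def F_simps)
  note mem = submodule_memD[OF F_module F_ge_submodule]
  have main: "r f \<in> F_ge n \<and> P (\<pi> (r f))" if "f \<in> carrier F" for f
    using that
  proof (induct f rule: F_induct)
    case zero
    then show ?case using mem(1) z by (simp add: r_zero \<pi>_zero)
  next
    case (add c p f)
    show ?case
    proof (cases "n \<le> bp_length p")
      case True
      have e: "r (c \<odot>\<^bsub>F\<^esub> bas p \<oplus>\<^bsub>F\<^esub> f) = c \<odot>\<^bsub>F\<^esub> bas p \<oplus>\<^bsub>F\<^esub> r f"
        using True add(1) by (simp add: r_add r_smult r_bas)
      have b: "c \<odot>\<^bsub>F\<^esub> bas p \<in> F_ge n" using mem(6)[OF add(1) F_ge_bas[OF add(2) True]] .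
      have rf: "r f \<in> F_ge n" "P (\<pi> (r f))" using add by auto
      have p1: "\<pi> (c \<odot>\<^bsub>F\<^esub> bas p) = c \<odot>\<^bsub>A\<^esub> x p"
        unfolding x_def by (rule lin_maps_smult[OF \<pi>_lin add(1) bas_closed[OF add(2)]])
      obtain q where q: "bp q" "bp_length q = bp_length p" "c \<odot>\<^bsub>A\<^esub> x p = x q"
        using x_smult_ex[OF add(1,2)] by blast
      have "P (\<pi> (c \<odot>\<^bsub>F\<^esub> bas p) \<oplus>\<^bsub>A\<^esub> \<pi> (r f))"
      proof (rule assms(4))
        show "\<pi> (c \<odot>\<^bsub>F\<^esub> bas p) \<in> R n" "\<pi> (r f) \<in> R n" unfolding R_def using b rf by blast+
        show "P (\<pi> (c \<odot>\<^bsub>F\<^esub> bas p))" unfolding p1 q(3) using s[OF q(1)] q(2) True by simp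
      qed (rule rf(2))
      moreover have "\<pi> (c \<odot>\<^bsub>F\<^esub> bas p \<oplus>\<^bsub>F\<^esub> r f) = \<pi> (c \<odot>\<^bsub>F\<^esub> bas p) \<oplus>\<^bsub>A\<^esub> \<pi> (r f)"
        by (rule lin_maps_add[OF \<pi>_lin mem(2)[OF b] mem(2)[OF rf(1)]])
      ultimately show ?thesis unfolding e using mem(3)[OF b rf(1)] by simp
    next
      case False
      have "r (c \<odot>\<^bsub>F\<^esub> bas p \<oplus>\<^bsub>F\<^esub> f) = c \<odot>\<^bsub>F\<^esub> \<zero>\<^bsub>F\<^esub> \<oplus>\<^bsub>F\<^esub> r f"
        using False add(1) by (simp add: r_add r_smult r_bas)
      also have "\<dots> = r f" using add(1) mem(2)[OF conjunct1[OF add(4)]] by simp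
      finally show ?thesis using add(4) by simp
    qed
  qed
  obtain f where f: "f \<in> F_ge n" "a = \<pi> f" using a unfolding R_def by blast
  have "r f p = f p" for p using F_ge_supp[OF f(1), of p] by (cases "f p = \<zero>\<^bsub>K\<^esub>") (simp_all add: r_def)
  then have "r f = f" by blast
  then show ?thesis using main[OF mem(2)[OF f(1)]] f(2) by simp
qed

lemma A_induct [consumes 1, case_names zero path add]:
  assumes "a \<in> carrier A" "P \<zero>\<^bsub>A\<^esub>" "\<And>p. bp p \<Longrightarrow> P (x p)"
    "\<And>a b. a \<in> carrier A \<Longrightarrow> b \<in> carrier A \<Longrightarrow> P a \<Longrightarrow> P b \<Longrightarrow> P (a \<oplus>\<^bsub>A\<^esub> b)"
  shows "P a"
  using assms(1)[folded R_0] by (induct rule: R_induct) (use assms in \<open>auto simp: R_0\<close>)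

text \<open>The kernel of \<open>\<pi>\<close> lies in \<open>F_ge 2\<close> plus
  \<open>mlin\<close>, and the linear extension of \<open>g\<close> kills both parts. Both the
  projections \<open>psi v\<close> and the coordinate functionals on paths of length 1 arise from
  this.\<close>

lemma universal:
  assumes V: "module K V" and g: "multilinear_on_paths V g"
    and z: "\<And>p. bp p \<Longrightarrow> 2 \<le> bp_length p \<Longrightarrow> g p = \<zero>\<^bsub>V\<^esub>"
  shows "\<exists>\<phi>\<in>lin_maps K A V. \<forall>p. bp p \<longrightarrow> \<phi> (x p) = g p"
proof -
  interpret V: module K V by fact
  have gc: "\<And>p. bp p \<Longrightarrow> g p \<in> carrier V" using g by (simp add: multilinear_on_paths_def)
  have L: "lin_ext V g \<in> lin_maps K F V" by (rule lin_ext_lin[OF V gc])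
  have ker: "lin_ext V g f = \<zero>\<^bsub>V\<^esub>" if f: "f \<in> carrier F" "\<pi> f = \<zero>\<^bsub>A\<^esub>" for f
  proof -
    obtain y where y: "y \<in> F_ge 2" "f \<ominus>\<^bsub>F\<^esub> y \<in> mlin" using \<pi>_ker[OF f] by blast
    have yc: "y \<in> carrier F" using submodule_memD(2)[OF F_module F_ge_submodule y(1)] .
    have "lin_ext V g (f \<ominus>\<^bsub>F\<^esub> y) = \<zero>\<^bsub>V\<^esub>" by (rule lin_ext_kills_mlin[OF V gc g y(2)])
    then have "lin_ext V g f \<ominus>\<^bsub>V\<^esub> lin_ext V g y = \<zero>\<^bsub>V\<^esub>"
      using lin_maps_minus[OF F_module V L f(1) yc] by simp
    then have "lin_ext V g f = lin_ext V g y"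
      using V.M.eq_if_minus_eq_zero[OF lin_maps_closed[OF L f(1)] lin_maps_closed[OF L yc]] by simp
    also have "\<dots> = \<zero>\<^bsub>V\<^esub>" by (rule lin_ext_kills_F_ge[OF V gc z y(1)])
    finally show ?thesis .
  qed
  have "\<exists>\<phi>\<in>lin_maps K A V. \<forall>f\<in>carrier F. \<phi> (\<pi> f) = lin_ext V g f"
    by (rule lin_map_factor[OF F_module A_module V \<pi>_lin \<pi>_image L ker])
  then obtain \<phi> where \<phi>: "\<phi> \<in> lin_maps K A V" "\<forall>f\<in>carrier F. \<phi> (\<pi> f) = lin_ext V g f"
    by (elim bexE)
  have "\<phi> (x p) = g p" if "bp p" for p
  proof -
    have "lin_ext V g (bas p) = g p" by (rule lin_ext_bas[OF V gc that])
    then show ?thesis using \<phi>(2) bas_closed[OF that] by (simp add: x_def)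
  qed
  then show ?thesis using \<phi>(1) by (intro bexI[of _ \<phi>] allI impI)
qed

text \<open>The induced map \<open>psi v\<close> is the projection of \<open>A\<close> modulo \<open>R 1\<close> onto its component \<open>B v\<close>.\<close>

definition psi_path where
  "psi_path v p = (case p of Triv w b \<Rightarrow> if w = v then b else \<zero>\<^bsub>B v\<^esub> | Step a \<beta> q \<Rightarrow> \<zero>\<^bsub>B v\<^esub>)"

lemma psi_path_simps [simp]:
  "psi_path v (Triv w b) = (if w = v then b else \<zero>\<^bsub>B v\<^esub>)" "psi_path v (Step a \<beta> q) = \<zero>\<^bsub>B v\<^esub>"
  by (simp_all add: psi_path_def)

section \<open>The projections onto the vertex algebras\<close>

lemma psi_ex:
  assumes v: "v \<in> verts \<Delta>"
  shows "\<exists>\<phi>\<in>lin_maps K A (B v). \<forall>p. bp p \<longrightarrow> \<phi> (x p) = psi_path v p"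
proof (rule universal[OF B_module[OF v]])
  interpret Bv: module K "B v" by (rule B_module[OF v])
  show "multilinear_on_paths (B v) (psi_path v)"
    unfolding multilinear_on_paths_def
  proof (intro conjI allI impI)
    show "psi_path v p \<in> carrier (B v)" if "bp p" for p using that by (cases p) auto
    show "psi_path v p'' = psi_path v p \<oplus>\<^bsub>B v\<^esub> psi_path v p'" if "bp p" "bp p'" "entry_sum \<Delta> B p p' p''" for p p' p''
      using that(3,1,2) by cases auto
    show "psi_path v p' = c \<odot>\<^bsub>B v\<^esub> psi_path v p" if "c \<in> carrier K" "bp p" "entry_smult \<Delta> B c p p'" for c p p'
      using that(3,1,2) by cases auto
  qed
  show "psi_path v p = \<zero>\<^bsub>B v\<^esub>" if "2 \<le> bp_length p" for p using that by (cases p) auto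
qed

definition psi where "psi v = (SOME \<phi>. \<phi> \<in> lin_maps K A (B v) \<and> (\<forall>p. bp p \<longrightarrow> \<phi> (x p) = psi_path v p))"

context
  fixes v assumes v: "v \<in> verts \<Delta>"
begin

lemma psi_lin: "psi v \<in> lin_maps K A (B v)" and psi_x: "bp p \<Longrightarrow> psi v (x p) = psi_path v p"
proof -
  have "\<exists>\<phi>. \<phi> \<in> lin_maps K A (B v) \<and> (\<forall>p. bp p \<longrightarrow> \<phi> (x p) = psi_path v p)"
    using psi_ex[OF v] by (elim bexE) (intro exI conjI)
  from someI_ex[OF this]
  show "psi v \<in> lin_maps K A (B v)" "bp p \<Longrightarrow> psi v (x p) = psi_path v p"
    unfolding psi_def by auto
qed

interpretation Bv: ring "B v" by (rule B_ring[OF v])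
interpretation Bvm: module K "B v" by (rule B_module[OF v])

lemma psi_zero: "psi v \<zero>\<^bsub>A\<^esub> = \<zero>\<^bsub>B v\<^esub>"
  by (rule lin_maps_zero[OF A_module B_module[OF v] psi_lin])

lemma psi_closed: "a \<in> carrier A \<Longrightarrow> psi v a \<in> carrier (B v)"
  by (rule lin_maps_closed[OF psi_lin])

lemma psi_path_mult:
  "bp p \<Longrightarrow> bp q \<Longrightarrow> bp_end p = bp_start \<Delta> q \<Longrightarrow> psi_path v (bp_mult B p q) = psi_path v p \<otimes>\<^bsub>B v\<^esub> psi_path v q"
proof -
  assume pq: "bp p" "bp q" "bp_end p = bp_start \<Delta> q"
  show ?thesis
  proof (cases p)
    case p: (Triv w b)
    then have b: "w = v \<Longrightarrow> b \<in> carrier (B v)" using pq(1) by simp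
    show ?thesis using p pq b Bv.r_null[of b] by (cases q; cases "w = v") simp_all
  next
    case p: (Step a \<beta> r)
    show ?thesis
    proof (cases q)
      case (Triv w b)
      then have "w = v \<Longrightarrow> b \<in> carrier (B v)" using pq(2) by simp
      then show ?thesis using p pq Triv Bv.l_null[of b] by (cases "w = v") simp_all
    qed (simp add: p)
  qed
qed

lemma psi_path_mult_zero:
  "bp p \<Longrightarrow> bp q \<Longrightarrow> bp_end p \<noteq> bp_start \<Delta> q \<Longrightarrow> psi_path v p \<otimes>\<^bsub>B v\<^esub> psi_path v q = \<zero>\<^bsub>B v\<^esub>"
  using Bv.l_null Bv.r_null by (cases p; cases q) auto

text \<open>\<open>universal\<close> yields only a linear map, so multiplicativity is checked on
  pairs of paths. The point is that a composite has length 0 only if both factors do.\<close>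

lemma psi_mult:
  assumes "a \<in> carrier A" "b \<in> carrier A"
  shows "psi v (a \<otimes>\<^bsub>A\<^esub> b) = psi v a \<otimes>\<^bsub>B v\<^esub> psi v b"
  using assms(1)
proof (induct a rule: A_induct)
  case (path p)
  have xp: "x p \<in> carrier A" by (rule x_closed[OF path])
  show ?case
    using assms(2)
  proof (induct b rule: A_induct)
    case zero
    then show ?case using xp psi_closed by (simp add: psi_zero)
  next
    case (path q)
    then show ?case using \<open>bp p\<close>
      by (cases "bp_end p = bp_start \<Delta> q")
        (simp_all add: x_mult psi_x psi_path_mult psi_path_mult_zero psi_zero bp_mult_bp)
  next
    case (add b c)
    then show ?case using xp psi_closed
      by (simp add: A.r_distr Bv.r_distr lin_maps_add[OF psi_lin])
  qed
next
  case zero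
  then show ?case using assms psi_closed by (simp add: psi_zero)
next
  case (add a c)
  then show ?case using assms psi_closed
    by (simp add: A.l_distr Bv.l_distr lin_maps_add[OF psi_lin])
qed

lemma psi_triv: "b \<in> carrier (B v) \<Longrightarrow> psi v (x (Triv v b)) = b"
  using psi_x[of "Triv v b"] v by simp

lemma psi_image: "psi v ` carrier A = carrier (B v)"
proof
  show "psi v ` carrier A \<subseteq> carrier (B v)" using psi_closed by auto
  show "carrier (B v) \<subseteq> psi v ` carrier A"
  proof
    fix b assume b: "b \<in> carrier (B v)"
    then have "x (Triv v b) \<in> carrier A" using x_closed v by simp
    then show "b \<in> psi v ` carrier A" using psi_triv[OF b] by force
  qed
qed

text \<open>Multiplicativity is applied to the identity times the vertex idempotent, whose image is
  already known to be the identity of \<open>B v\<close>.\<close>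

lemma psi_one: "psi v \<one>\<^bsub>A\<^esub> = \<one>\<^bsub>B v\<^esub>"
proof -
  have c: "psi v \<one>\<^bsub>A\<^esub> \<in> carrier (B v)" using psi_closed by simp
  have e: "x (triv1 v) \<in> carrier A" "psi v (x (triv1 v)) = \<one>\<^bsub>B v\<^esub>"
    using x_closed triv1_bp[OF v] psi_triv by auto
  have "psi v (\<one>\<^bsub>A\<^esub> \<otimes>\<^bsub>A\<^esub> x (triv1 v)) = psi v \<one>\<^bsub>A\<^esub> \<otimes>\<^bsub>B v\<^esub> psi v (x (triv1 v))"
    using e by (intro psi_mult) auto
  then show ?thesis using e c by simp
qed

lemma psi_hom: "psi v \<in> ring_hom A (B v)"
  by (rule ring_hom_memI) (simp_all add: psi_closed psi_mult lin_maps_add[OF psi_lin] psi_one)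

end

text \<open>Reassembles the components of \<open>a\<close> inside \<open>A\<close> from paths of
  length 0. It differs from \<open>a\<close> by an element of \<open>R 1\<close>, so the maps
  \<open>psi v\<close> together determine \<open>a\<close> modulo \<open>R 1\<close>.\<close>

definition D where "D a = (\<Oplus>\<^bsub>A\<^esub>v\<in>verts \<Delta>. x (Triv v (psi v a)))"

lemma triv_closed: "v \<in> verts \<Delta> \<Longrightarrow> b \<in> carrier (B v) \<Longrightarrow> x (Triv v b) \<in> carrier A"
  by (rule x_closed) simp

lemma triv_add:
  assumes "v \<in> verts \<Delta>" "b \<in> carrier (B v)" "c \<in> carrier (B v)"
  shows "x (Triv v (b \<oplus>\<^bsub>B v\<^esub> c)) = x (Triv v b) \<oplus>\<^bsub>A\<^esub> x (Triv v c)"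
  by (rule x_entry_sum) (use assms in \<open>auto intro: entry_sum.intros\<close>)

lemma triv_smult:
  assumes "v \<in> verts \<Delta>" "b \<in> carrier (B v)" "c \<in> carrier K"
  shows "x (Triv v (c \<odot>\<^bsub>B v\<^esub> b)) = c \<odot>\<^bsub>A\<^esub> x (Triv v b)"
  by (rule x_entry_smult) (use assms in \<open>auto intro: entry_smult.intros\<close>)

lemma triv_zero: "v \<in> verts \<Delta> \<Longrightarrow> x (Triv v \<zero>\<^bsub>B v\<^esub>) = \<zero>\<^bsub>A\<^esub>"
proof -
  assume v: "v \<in> verts \<Delta>"
  interpret Bvm: module K "B v" by (rule B_module[OF v])
  show ?thesis using triv_smult[OF v Bvm.M.zero_closed K.zero_closed] triv_closed[OF v] by simp
qed

lemma triv_mult: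
  assumes "v \<in> verts \<Delta>" "b \<in> carrier (B v)" "c \<in> carrier (B v)"
  shows "x (Triv v b) \<otimes>\<^bsub>A\<^esub> x (Triv v c) = x (Triv v (b \<otimes>\<^bsub>B v\<^esub> c))"
  using assms by (simp add: x_mult)

lemma D_add: "a \<in> carrier A \<Longrightarrow> b \<in> carrier A \<Longrightarrow> D (a \<oplus>\<^bsub>A\<^esub> b) = D a \<oplus>\<^bsub>A\<^esub> D b"
proof -
  assume a: "a \<in> carrier A" and b: "b \<in> carrier A"
  have c: "(\<lambda>v. x (Triv v (psi v a))) \<in> verts \<Delta> \<rightarrow> carrier A" "(\<lambda>v. x (Triv v (psi v b))) \<in> verts \<Delta> \<rightarrow> carrier A"
    using a b triv_closed psi_closed by auto
  show ?thesis unfolding D_def A.finsum_addf[OF c, symmetric]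
    using a b triv_closed psi_closed
    by (intro A.finsum_cong') (auto simp: lin_maps_add[OF psi_lin] triv_add)
qed

lemma D_closed: "a \<in> carrier A \<Longrightarrow> D a \<in> carrier A"
  unfolding D_def by (intro A.finsum_closed) (auto intro!: triv_closed psi_closed)

lemma D_zero: "(\<And>v. v \<in> verts \<Delta> \<Longrightarrow> psi v a = \<zero>\<^bsub>B v\<^esub>) \<Longrightarrow> D a = \<zero>\<^bsub>A\<^esub>"
  unfolding D_def by (intro A.add.finprod_one_eqI) (simp add: triv_zero)

lemma minus_D: "a \<in> carrier A \<Longrightarrow> a \<ominus>\<^bsub>A\<^esub> D a \<in> R 1"
proof (induct a rule: A_induct)
  case zero
  have "D \<zero>\<^bsub>A\<^esub> = \<zero>\<^bsub>A\<^esub>" by (rule D_zero) (rule psi_zero)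
  then show ?case using additive_subgroup.zero_closed[OF ideal.axioms(1)[OF R_ideal]] by (simp add: A.minus_eq)
next
  case (path p)
  show ?case
  proof (cases p)
    case (Triv v b)
    then have vb: "v \<in> verts \<Delta>" "b \<in> carrier (B v)" using path by auto
    have ps: "psi w (x p) = (if v = w then b else \<zero>\<^bsub>B w\<^esub>)" if "w \<in> verts \<Delta>" for w
      using psi_x[OF that path] Triv by simp
    have "D (x p) = x (Triv v (psi v (x p)))"
      unfolding D_def using vb x_closed[OF path]
      by (intro A.finsum_single) (auto intro!: triv_closed psi_closed simp: ps triv_zero)
    then have "D (x p) = x p" using ps[OF vb(1)] Triv by simp
    then show ?thesis using x_closed[OF path] additive_subgroup.zero_closed[OF ideal.axioms(1)[OF R_ideal]]
      by (simp add: A.minus_eq A.r_neg)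
  next
    case (Step a \<beta> q)
    have "D (x p) = \<zero>\<^bsub>A\<^esub>" by (rule D_zero) (use psi_x[OF _ path] Step in simp)
    then show ?thesis using x_closed[OF path] x_R[OF path, of 1] Step by (simp add: A.minus_eq)
  qed
next
  case (add a b)
  have "(a \<oplus>\<^bsub>A\<^esub> b) \<ominus>\<^bsub>A\<^esub> D (a \<oplus>\<^bsub>A\<^esub> b) = (a \<ominus>\<^bsub>A\<^esub> D a) \<oplus>\<^bsub>A\<^esub> (b \<ominus>\<^bsub>A\<^esub> D b)"
    unfolding D_add[OF add(1,2)] using add(1,2) D_closed
    by (simp add: A.minus_eq A.minus_add A.a_ac)
  then show ?case using add additive_subgroup.a_closed[OF ideal.axioms(1)[OF R_ideal]] by simp
qed

lemma psi_R: "v \<in> verts \<Delta> \<Longrightarrow> a \<in> R 1 \<Longrightarrow> psi v a = \<zero>\<^bsub>B v\<^esub>"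
proof -
  assume v: "v \<in> verts \<Delta>" and a: "a \<in> R 1"
  interpret Bvm: module K "B v" by (rule B_module[OF v])
  show ?thesis using a
  proof (induct a rule: R_induct)
    case zero
    then show ?case by (rule psi_zero[OF v])
  next
    case (path p)
    then show ?case using psi_x[OF v path(1)] by (cases p) auto
  next
    case (add a b)
    then show ?case by (simp add: lin_maps_add[OF psi_lin[OF v]] R_closed)
  qed
qed

lemma R_1_iff: "a \<in> carrier A \<Longrightarrow> a \<in> R 1 \<longleftrightarrow> (\<forall>v\<in>verts \<Delta>. psi v a = \<zero>\<^bsub>B v\<^esub>)"
proof
  assume a: "a \<in> carrier A" and "\<forall>v\<in>verts \<Delta>. psi v a = \<zero>\<^bsub>B v\<^esub>"
  then have "D a = \<zero>\<^bsub>A\<^esub>" using D_zero by blast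
  then show "a \<in> R 1" using minus_D[OF a] a by (simp add: A.minus_eq)
qed (use psi_R in blast)

text \<open>The n-th power of an element of \<open>R 1\<close> lies in \<open>R n\<close>, so
  \<open>R 1\<close> is a nil ideal and belongs to the radical. Conversely, each surjection
  \<open>psi v\<close> onto a simple ring kills the radical, and \<open>R 1\<close> is their common
  kernel.\<close>

lemma radical_eq: "radical A = R 1"
proof
  show "R 1 \<subseteq> radical A"
  proof (rule A.nil_ideal_subset_radical[OF R_ideal])
    fix j assume j: "j \<in> R 1"
    have "j [^]\<^bsub>A\<^esub> n \<in> R n" for n :: nat
    proof (induct n)
      case 0
      then show ?case by (simp add: R_0)
    next
      case (Suc n)
      then show ?case using R_mult[OF Suc j] by simp
    qed
    from this[of t] show "\<exists>n::nat. j [^]\<^bsub>A\<^esub> n = \<zero>\<^bsub>A\<^esub>" unfolding R_t by blast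
  qed
  show "radical A \<subseteq> R 1"
  proof
    fix a assume a: "a \<in> radical A"
    then have ac: "a \<in> carrier A" by (simp add: radical_def)
    have "psi v a = \<zero>\<^bsub>B v\<^esub>" if v: "v \<in> verts \<Delta>" for v
      using B_simple[OF v] unfolding simple_algebra_def
      by (intro radical_surj_simple[OF A.ring_axioms B_ring[OF v] psi_hom[OF v] psi_image[OF v] _ _ a]) auto
    then show "a \<in> R 1" using R_1_iff[OF ac] by blast
  qed
qed

lemma rad_sq_eq: "rad_sq A = R 2"
proof -
  have "ideal_prod A (R 1) (R 1) = R 2"
  proof
    show "ideal_prod A (R 1) (R 1) \<subseteq> R 2"
    proof
      fix a assume "a \<in> ideal_prod A (R 1) (R 1)"
      then show "a \<in> R 2"
      proof induct
        case (prod i j)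
        then show ?case using R_mult[OF prod] by (simp add: numeral_2_eq_2)
      next
        case (sum s1 s2)
        then show ?case using additive_subgroup.a_closed[OF ideal.axioms(1)[OF R_ideal]] by blast
      qed
    qed
    show "R 2 \<subseteq> ideal_prod A (R 1) (R 1)"
    proof
      fix a assume "a \<in> R 2"
      then show "a \<in> ideal_prod A (R 1) (R 1)"
      proof (induct a rule: R_induct)
        case zero
        show ?case
          using additive_subgroup.zero_closed[OF ideal.axioms(1)[OF A.ideal_prod_is_ideal[OF R_ideal R_ideal]]] .
      next
        case (path p)
        then obtain a \<beta> q where p: "p = Step a \<beta> q" by (cases p) auto
        \<comment> \<open>A path of length at least 2 is its first arrow times a rest of length at
          least 1.\<close>
        let ?p = "Step a \<beta> (triv1 (bp_start \<Delta> q))"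
        have q: "bp q" "1 \<le> bp_length q" using path p by auto
        have bp: "bp ?p" "bp_length ?p = 1" "bp_end ?p = bp_start \<Delta> q"
          using path p triv1_bp[OF bp_start_vert[OF q(1)]] by auto
        have "x ?p \<otimes>\<^bsub>A\<^esub> x q = x p"
          using x_mult[OF bp(1) q(1)] bp(3) bp_mult_unit_left[OF q(1)] p by simp
        then show ?case
          using ideal_prod.prod[of "x ?p" "R 1" "x q" "R 1" A] x_R[OF bp(1), of 1] x_R[OF q] bp(2) by simp
      next
        case (add a b)
        then show ?case by (intro ideal_prod.sum)
      qed
    qed
  qed
  then show ?thesis unfolding rad_sq_def radical_eq by (simp add: A.ideal_power_2[OF R_ideal])
qed

end

section \<open>The simple components of the semisimple quotient\<close>

lemma ideal_algebra_simps:
  "carrier (ideal_algebra C I) = I" "mult (ideal_algebra C I) = mult C" "add (ideal_algebra C I) = add C"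
  "zero (ideal_algebra C I) = zero C" "smult (ideal_algebra C I) = smult C"
  by (simp_all add: ideal_algebra_def)

text \<open>Makes simplicity of a component applicable to ideals of the whole ring. The delicate
  point is negation, which each record takes from its own group; the two agree because inverses are
  unique.\<close>

lemma ideal_in_ideal_algebra:
  assumes "ring (ideal_algebra C I)" "ideal J C" "J \<subseteq> I" "ideal I C"
  shows "ideal J (ideal_algebra C I)"
proof -
  interpret I: ideal I C by fact
  interpret J: ideal J C by fact
  interpret C: ring "ideal_algebra C I" by fact
  show ?thesis
  proof (rule idealI[OF assms(1)])
    show "subgroup J (add_monoid (ideal_algebra C I))"
    proof (rule C.add.subgroupI)
      fix a assume a: "a \<in> J"
      have "\<ominus>\<^bsub>C\<^esub> a \<in> J" using a by simp
      moreover have "\<ominus>\<^bsub>ideal_algebra C I\<^esub> a = \<ominus>\<^bsub>C\<^esub> a"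
        using a assms(3) \<open>\<ominus>\<^bsub>C\<^esub> a \<in> J\<close> I.l_neg[of a] J.a_Hcarr[OF a]
        by (intro C.minus_equality) (auto simp: ideal_algebra_simps)
      ultimately show "\<ominus>\<^bsub>ideal_algebra C I\<^esub> a \<in> J" by simp
    next
      show "J \<noteq> {}" using J.zero_closed by blast
    qed (use assms(3) in \<open>auto simp: ideal_algebra_simps\<close>)
  qed (auto simp: ideal_algebra_simps J.I_l_closed J.I_r_closed I.Icarr)
qed

context presented_algebra
begin

section \<open>The quotient by the radical and its components\<close>

definition Rad where "Rad = R 1"

lemma Rad_ideal: "ideal Rad A"
  unfolding Rad_def by (rule R_ideal)

lemma Rad_iff: "a \<in> carrier A \<Longrightarrow> a \<in> Rad \<longleftrightarrow> (\<forall>v\<in>verts \<Delta>. psi v a = \<zero>\<^bsub>B v\<^esub>)"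
  unfolding Rad_def by (rule R_1_iff)

abbreviation S where "S \<equiv> quot_algebra A Rad"
abbreviation q where "q \<equiv> (+>\<^bsub>A\<^esub>) Rad"

sublocale S: ring S by (rule quot_algebra_ring[OF Rad_ideal])

lemma q_lin: "q \<in> lin_maps K A S"
  by (rule quot_algebra_lin_map[OF A_alg Rad_ideal])

lemma q_closed: "a \<in> carrier A \<Longrightarrow> q a \<in> carrier S"
  by (rule lin_maps_closed[OF q_lin])

lemma q_image: "q ` carrier A = carrier S"
  by (simp add: quot_algebra_simps)

lemma q_ops:
  assumes "a \<in> carrier A" "b \<in> carrier A"
  shows "q a \<oplus>\<^bsub>S\<^esub> q b = q (a \<oplus>\<^bsub>A\<^esub> b)" "q a \<otimes>\<^bsub>S\<^esub> q b = q (a \<otimes>\<^bsub>A\<^esub> b)"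
  using quot_algebra_ops[OF A_alg Rad_ideal assms] by blast+

lemma q_zero: "q \<zero>\<^bsub>A\<^esub> = \<zero>\<^bsub>S\<^esub>"
  by (rule lin_maps_zero[OF A_module k_algebraD(4)[OF quot_algebra_k_algebra[OF A_alg Rad_ideal]] q_lin])

lemma q_hom: "q \<in> ring_hom A S"
  by (rule ring_hom_memI) (simp_all add: q_closed q_ops quot_algebra_simps(3))

lemma q_eq_iff:
  assumes "a \<in> carrier A" "b \<in> carrier A"
  shows "q a = q b \<longleftrightarrow> (\<forall>v\<in>verts \<Delta>. psi v a = psi v b)"
proof -
  have "psi v (a \<ominus>\<^bsub>A\<^esub> b) = \<zero>\<^bsub>B v\<^esub> \<longleftrightarrow> psi v a = psi v b" if v: "v \<in> verts \<Delta>" for v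
  proof -
    interpret Bv: ring "B v" by (rule B_ring[OF v])
    have "psi v (a \<ominus>\<^bsub>A\<^esub> b) = psi v a \<ominus>\<^bsub>B v\<^esub> psi v b"
      by (rule lin_maps_minus[OF A_module B_module[OF v] psi_lin[OF v] assms])
    then show ?thesis
      using Bv.eq_if_minus_eq_zero[of "psi v a" "psi v b"] psi_closed[OF v] assms
      by (auto simp: Bv.minus_eq Bv.r_neg)
  qed
  then show ?thesis
    using ideal.coset_eq_iff[OF Rad_ideal assms] Rad_iff[of "a \<ominus>\<^bsub>A\<^esub> b"] assms by simp
qed

lemma q_eq_zero_iff: "a \<in> carrier A \<Longrightarrow> q a = \<zero>\<^bsub>S\<^esub> \<longleftrightarrow> (\<forall>v\<in>verts \<Delta>. psi v a = \<zero>\<^bsub>B v\<^esub>)"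
  using q_eq_iff[of a "\<zero>\<^bsub>A\<^esub>"] by (simp add: q_zero psi_zero)

lemma psi_triv_eq:
  "v \<in> verts \<Delta> \<Longrightarrow> w \<in> verts \<Delta> \<Longrightarrow> b \<in> carrier (B v) \<Longrightarrow> psi w (x (Triv v b)) = (if v = w then b else \<zero>\<^bsub>B w\<^esub>)"
  using psi_x[of w "Triv v b"] by simp

text \<open>The preimage in \<open>A\<close> of the sum of the components at the vertices in
  \<open>V\<close>; it always contains \<open>R 1\<close>. Singletons give the \<open>T v\<close>,
  and complements of singletons serve to show that no vertex is missed.\<close>

definition supp_ideal where "supp_ideal V = {a \<in> carrier A. \<forall>w\<in>verts \<Delta> - V. psi w a = \<zero>\<^bsub>B w\<^esub>}"

lemma supp_ideal_ideal: "ideal (supp_ideal V) A"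
proof (rule idealI[OF A.ring_axioms])
  show "subgroup (supp_ideal V) (add_monoid A)"
  proof (rule A.add.subgroupI)
    show "\<ominus>\<^bsub>A\<^esub> a \<in> supp_ideal V" if "a \<in> supp_ideal V" for a
    proof -
      have "psi w (\<ominus>\<^bsub>A\<^esub> a) = \<zero>\<^bsub>B w\<^esub>" if "w \<in> verts \<Delta> - V" for w
      proof -
        have w: "w \<in> verts \<Delta>" using that by simp
        interpret Bw: ring "B w" by (rule B_ring[OF w])
        have "a \<in> carrier A" "psi w a = \<zero>\<^bsub>B w\<^esub>" using that \<open>a \<in> supp_ideal V\<close> by (auto simp: supp_ideal_def)
        then show ?thesis using lin_maps_uminus[OF A_module B_module[OF w] psi_lin[OF w], of a] by simp
      qed
      then show ?thesis using that by (simp add: supp_ideal_def)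
    qed
    show "a \<oplus>\<^bsub>A\<^esub> b \<in> supp_ideal V" if "a \<in> supp_ideal V" "b \<in> supp_ideal V" for a b
    proof -
      have "psi w (a \<oplus>\<^bsub>A\<^esub> b) = \<zero>\<^bsub>B w\<^esub>" if "w \<in> verts \<Delta> - V" for w
      proof -
        have w: "w \<in> verts \<Delta>" using that by simp
        interpret Bw: ring "B w" by (rule B_ring[OF w])
        show ?thesis using \<open>a \<in> supp_ideal V\<close> \<open>b \<in> supp_ideal V\<close> that
          by (simp add: supp_ideal_def lin_maps_add[OF psi_lin[OF w]])
      qed
      then show ?thesis using that by (simp add: supp_ideal_def)
    qed
  qed (use psi_zero in \<open>auto simp: supp_ideal_def\<close>)
  fix a b assume a: "a \<in> supp_ideal V" and b: "b \<in> carrier A"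
  have "psi w (b \<otimes>\<^bsub>A\<^esub> a) = \<zero>\<^bsub>B w\<^esub> \<and> psi w (a \<otimes>\<^bsub>A\<^esub> b) = \<zero>\<^bsub>B w\<^esub>" if "w \<in> verts \<Delta> - V" for w
  proof -
    have w: "w \<in> verts \<Delta>" using that by simp
    interpret Bw: ring "B w" by (rule B_ring[OF w])
    show ?thesis using a b that psi_closed[OF w b] by (simp add: supp_ideal_def psi_mult[OF w])
  qed
  then show "b \<otimes>\<^bsub>A\<^esub> a \<in> supp_ideal V" "a \<otimes>\<^bsub>A\<^esub> b \<in> supp_ideal V"
    using a b by (simp_all add: supp_ideal_def)
qed

definition T where "T v = q ` supp_ideal {v}"

lemma T_ideal: "ideal (T v) S"
  unfolding T_def by (rule image_ideal[OF A.ring_axioms S.ring_axioms q_hom q_image supp_ideal_ideal])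

text \<open>The inverse of the map that \<open>psi v\<close> induces on \<open>T v\<close>. It
  respects products, but sends the identity of \<open>B v\<close> to that of \<open>T v\<close>,
  which is in general not the identity of \<open>S\<close>.\<close>

definition tau where "tau v b = q (x (Triv v b))"

lemma tau_T: "v \<in> verts \<Delta> \<Longrightarrow> b \<in> carrier (B v) \<Longrightarrow> tau v b \<in> T v"
  unfolding T_def tau_def by (rule imageI) (auto simp: supp_ideal_def triv_closed psi_triv_eq)

lemma T_tau: "v \<in> verts \<Delta> \<Longrightarrow> a \<in> supp_ideal {v} \<Longrightarrow> q a = tau v (psi v a)"
  unfolding tau_def
  by (subst q_eq_iff) (auto simp: supp_ideal_def triv_closed psi_closed psi_triv_eq)

lemma T_eq: "v \<in> verts \<Delta> \<Longrightarrow> T v = tau v ` carrier (B v)"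
  using tau_T T_tau psi_closed by (fastforce simp: T_def supp_ideal_def)

lemma tau_eq_zero_iff: "v \<in> verts \<Delta> \<Longrightarrow> b \<in> carrier (B v) \<Longrightarrow> tau v b = \<zero>\<^bsub>S\<^esub> \<longleftrightarrow> b = \<zero>\<^bsub>B v\<^esub>"
  unfolding tau_def by (auto simp: q_eq_zero_iff triv_closed psi_triv_eq)

lemma tau_inj: "v \<in> verts \<Delta> \<Longrightarrow> inj_on (tau v) (carrier (B v))"
  by (rule inj_onI) (auto simp: tau_def q_eq_iff triv_closed psi_triv_eq)

lemma tau_ops:
  assumes "v \<in> verts \<Delta>" "b \<in> carrier (B v)" "c \<in> carrier (B v)"
  shows "tau v (b \<oplus>\<^bsub>B v\<^esub> c) = tau v b \<oplus>\<^bsub>S\<^esub> tau v c" "tau v (b \<otimes>\<^bsub>B v\<^esub> c) = tau v b \<otimes>\<^bsub>S\<^esub> tau v c"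
    "k \<in> carrier K \<Longrightarrow> tau v (k \<odot>\<^bsub>B v\<^esub> b) = k \<odot>\<^bsub>S\<^esub> tau v b"
  unfolding tau_def using assms by (simp_all add: triv_add triv_mult[symmetric] triv_smult q_ops triv_closed lin_maps_smult[OF q_lin])

lemma B_one_nonzero: "v \<in> verts \<Delta> \<Longrightarrow> \<one>\<^bsub>B v\<^esub> \<noteq> \<zero>\<^bsub>B v\<^esub>"
proof -
  assume v: "v \<in> verts \<Delta>"
  interpret Bv: ring "B v" by (rule B_ring[OF v])
  show ?thesis using B_simple[OF v] Bv.carrier_one_not_zero by (simp add: simple_algebra_def)
qed

text \<open>A nonzero element of \<open>I\<close> has a nonzero component at some \<open>v\<close>,
  so \<open>I\<close> meets \<open>T v\<close> nontrivially. Simplicity of \<open>I\<close> turns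
  this into \<open>I \<subseteq> T v\<close>, simplicity of \<open>B v\<close> into the reverse
  inclusion.\<close>

lemma simple_ideal_is_T:
  assumes I: "ideal I S" and simple: "simple_algebra K (ideal_algebra S I)"
  obtains v where "v \<in> verts \<Delta>" "I = T v"
proof -
  interpret I: ideal I S by (rule I)
  have ring: "ring (ideal_algebra S I)"
    using simple k_algebraD(3) by (auto simp: simple_algebra_def)
  have "I \<noteq> {\<zero>\<^bsub>S\<^esub>}" and triv: "\<And>N. ideal N (ideal_algebra S I) \<Longrightarrow> N = {\<zero>\<^bsub>S\<^esub>} \<or> N = I"
    using simple by (auto simp: simple_algebra_def ideal_algebra_simps)
  then obtain s where s: "s \<in> I" "s \<noteq> \<zero>\<^bsub>S\<^esub>" using I.zero_closed by blast
  obtain a where a: "a \<in> carrier A" "s = q a" using I.Icarr[OF s(1)] unfolding q_image[symmetric] by blast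
  obtain v where v: "v \<in> verts \<Delta>" "psi v a \<noteq> \<zero>\<^bsub>B v\<^esub>" using s(2) a q_eq_zero_iff by blast
  interpret Bv: ring "B v" by (rule B_ring[OF v(1)])
  have e: "x (triv1 v) \<in> carrier A" by (rule triv_closed[OF v(1) Bv.one_closed])
  \<comment> \<open>Multiplying by the identity of \<open>T v\<close> cuts out the component at
    \<open>v\<close>; the product lies in both ideals and is not zero.\<close>
  let ?s = "s \<otimes>\<^bsub>S\<^esub> tau v \<one>\<^bsub>B v\<^esub>"
  have sI: "?s \<in> I" using I.I_r_closed[OF s(1)] q_closed[OF e] by (simp add: tau_def)
  have sT: "?s \<in> T v" using ideal.I_l_closed[OF T_ideal tau_T[OF v(1) Bv.one_closed] I.Icarr[OF s(1)]] .
  have s0: "?s \<noteq> \<zero>\<^bsub>S\<^esub>"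
  proof -
    have "?s = q (a \<otimes>\<^bsub>A\<^esub> x (triv1 v))" using a e by (simp add: tau_def q_ops)
    moreover have "psi v (a \<otimes>\<^bsub>A\<^esub> x (triv1 v)) = psi v a"
      using psi_mult[OF v(1) a(1) e] psi_triv[OF v(1) Bv.one_closed] psi_closed[OF v(1) a(1)] by simp
    ultimately show ?thesis using v q_eq_zero_iff[of "a \<otimes>\<^bsub>A\<^esub> x (triv1 v)"] a e by auto
  qed
  have int: "ideal (I \<inter> T v) S" using S.i_intersect[OF I T_ideal] .
  have "I \<inter> T v = {\<zero>\<^bsub>S\<^esub>} \<or> I \<inter> T v = I"
    by (rule triv[OF ideal_in_ideal_algebra[OF ring int Int_lower1 I]])
  then have sub: "I \<subseteq> T v" using sI sT s0 by blast
  have "T v \<subseteq> I"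
  proof -
    define P where "P = {b \<in> carrier (B v). tau v b \<in> I}"
    have tau0: "tau v \<zero>\<^bsub>B v\<^esub> = \<zero>\<^bsub>S\<^esub>" using tau_eq_zero_iff[OF v(1) Bv.zero_closed] by simp
    have tauc: "tau v b \<in> carrier S" if "b \<in> carrier (B v)" for b
      using tau_T[OF v(1) that] ideal.Icarr[OF T_ideal] by blast
    have "ideal P (B v)"
    proof (rule idealI[OF Bv.ring_axioms])
      show "subgroup P (add_monoid (B v))"
      proof (rule Bv.add.subgroupI)
        show "P \<noteq> {}" using tau0 I.zero_closed Bv.zero_closed unfolding P_def by fastforce
        fix b assume b: "b \<in> P"
        then have bc: "b \<in> carrier (B v)" "tau v b \<in> I" by (auto simp: P_def)
        have nc: "\<ominus>\<^bsub>B v\<^esub> \<one>\<^bsub>B v\<^esub> \<in> carrier (B v)" by simp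
        have "\<ominus>\<^bsub>B v\<^esub> b = (\<ominus>\<^bsub>B v\<^esub> \<one>\<^bsub>B v\<^esub>) \<otimes>\<^bsub>B v\<^esub> b" using bc(1) by (simp add: Bv.l_minus)
        then have "tau v (\<ominus>\<^bsub>B v\<^esub> b) \<in> I"
          using I.I_l_closed[OF bc(2) tauc[OF nc]] tau_ops(2)[OF v(1) nc bc(1)] by simp
        then show "\<ominus>\<^bsub>B v\<^esub> b \<in> P" using bc(1) by (simp add: P_def)
      qed (auto simp: P_def tau_ops[OF v(1)])
    qed (auto simp: P_def tau_ops[OF v(1)] I.I_l_closed I.I_r_closed tauc)
    moreover have "P \<noteq> {\<zero>\<^bsub>B v\<^esub>}"
    proof -
      obtain b where b: "b \<in> carrier (B v)" "?s = tau v b" using sT unfolding T_eq[OF v(1)] by blast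
      then have "b \<in> P" "b \<noteq> \<zero>\<^bsub>B v\<^esub>" using sI s0 tau0 by (auto simp: P_def)
      then show ?thesis by blast
    qed
    ultimately have "P = carrier (B v)" using B_simple[OF v(1)] by (auto simp: simple_algebra_def)
    then show ?thesis unfolding T_eq[OF v(1)] by (auto simp: P_def)
  qed
  then show thesis using that[OF v(1)] sub by blast
qed

text \<open>Uniqueness of decompositions forbids two indices with the same \<open>T v\<close>.
  Existence forbids a missed vertex, since the idempotent at that vertex must be a sum of elements
  of the \<open>Abar i\<close>.\<close>

lemma components_bij:
  fixes p :: nat
  assumes sum: "is_direct_sum_of_ideals S {1..p} Abar"
    and simple: "\<And>i. i \<in> {1..p} \<Longrightarrow> simple_algebra K (ideal_algebra S (Abar i))"
  obtains \<sigma> where "bij_betw \<sigma> {1..p} (verts \<Delta>)" "\<And>i. i \<in> {1..p} \<Longrightarrow> Abar i = T (\<sigma> i)"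
proof -
  have id: "ideal (Abar i) S" if "i \<in> {1..p}" for i using sum that by (simp add: is_direct_sum_of_ideals_def)
  have "\<exists>v. v \<in> verts \<Delta> \<and> Abar i = T v" if "i \<in> {1..p}" for i
    using simple_ideal_is_T[OF id[OF that] simple[OF that]] by metis
  then obtain \<sigma> where \<sigma>: "\<And>i. i \<in> {1..p} \<Longrightarrow> \<sigma> i \<in> verts \<Delta> \<and> Abar i = T (\<sigma> i)" by metis
  have uniq: "f = g" if "f \<in> (\<Pi>\<^sub>E i\<in>{1..p}. Abar i)" "g \<in> (\<Pi>\<^sub>E i\<in>{1..p}. Abar i)" "finsum S f {1..p} = finsum S g {1..p}" for f g
  proof -
    have "finsum S f {1..p} \<in> carrier S"
      using that(1) ideal.Icarr[OF id] by (intro S.finsum_closed) (auto simp: PiE_iff)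
    then have "\<exists>!h. h \<in> (\<Pi>\<^sub>E i\<in>{1..p}. Abar i) \<and> finsum S f {1..p} = finsum S h {1..p}"
      using sum by (simp add: is_direct_sum_of_ideals_def)
    then show ?thesis using that by metis
  qed
  have "inj_on \<sigma> {1..p}"
  proof (rule inj_onI, rule ccontr)
    fix i j assume ij: "i \<in> {1..p}" "j \<in> {1..p}" "\<sigma> i = \<sigma> j" "i \<noteq> j"
    then have eq: "Abar i = Abar j" using \<sigma> by metis
    have "Abar i \<noteq> {\<zero>\<^bsub>S\<^esub>}" using simple[OF ij(1)] by (simp add: simple_algebra_def ideal_algebra_simps)
    moreover have z: "\<zero>\<^bsub>S\<^esub> \<in> Abar k" if "k \<in> {1..p}" for k
      using additive_subgroup.zero_closed[OF ideal.axioms(1)[OF id[OF that]]] .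
    ultimately obtain s where s: "s \<in> Abar i" "s \<noteq> \<zero>\<^bsub>S\<^esub>" using ij(1) by blast
    have sc: "s \<in> carrier S" using ideal.Icarr[OF id[OF ij(1)] s(1)] .
    \<comment> \<open>The same \<open>s\<close> placed at index \<open>k\<close>: for coinciding
      ideals, \<open>f i\<close> and \<open>f j\<close> would be two decompositions of
      \<open>s\<close>.\<close>
    define f where "f k = (\<lambda>l\<in>{1..p}. if l = k then s else \<zero>\<^bsub>S\<^esub>)" for k
    have fs: "finsum S (f k) {1..p} = s" if "k \<in> {1..p}" for k
    proof -
      have "finsum S (f k) {1..p} = f k k"
        by (rule S.finsum_single) (use that sc in \<open>auto simp: f_def\<close>)
      then show ?thesis using that by (simp add: f_def)
    qed
    have "f i \<in> (\<Pi>\<^sub>E l\<in>{1..p}. Abar l)" "f j \<in> (\<Pi>\<^sub>E l\<in>{1..p}. Abar l)"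
      using s(1) z eq by (auto simp: f_def)
    then have "f i = f j" using uniq fs ij(1,2) by metis
    then have "f i i = f j i" by simp
    then show False using ij s(2) by (simp add: f_def)
  qed
  moreover have "\<sigma> ` {1..p} = verts \<Delta>"
  proof
    show "\<sigma> ` {1..p} \<subseteq> verts \<Delta>" using \<sigma> by auto
    show "verts \<Delta> \<subseteq> \<sigma> ` {1..p}"
    proof (rule subsetI, rule ccontr)
      fix v assume v: "v \<in> verts \<Delta>" "v \<notin> \<sigma> ` {1..p}"
      interpret Bv: ring "B v" by (rule B_ring[OF v(1)])
      \<comment> \<open>Collects the components at all vertices other than \<open>v\<close>. Every
        \<open>Abar i\<close> lies in this ideal, but the idempotent at \<open>v\<close> does
        not.\<close>
      let ?U = "q ` supp_ideal (verts \<Delta> - {v})"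
      have U: "ideal ?U S"
        by (rule image_ideal[OF A.ring_axioms S.ring_axioms q_hom q_image supp_ideal_ideal])
      interpret U: ideal ?U S by (rule U)
      have "T w \<subseteq> ?U" if "w \<in> verts \<Delta>" "w \<noteq> v" for w
        unfolding T_def supp_ideal_def using that by (intro image_mono) auto
      then have sub: "Abar i \<subseteq> ?U" if "i \<in> {1..p}" for i using \<sigma>[OF that] v(2) that by (metis imageI)
      have one: "q (x (triv1 v)) \<in> carrier S" by (rule q_closed[OF triv_closed[OF v(1) Bv.one_closed]])
      then obtain f where f: "f \<in> (\<Pi>\<^sub>E i\<in>{1..p}. Abar i)" "q (x (triv1 v)) = finsum S f {1..p}"
        using sum unfolding is_direct_sum_of_ideals_def by metis
      have "finsum S f N \<in> ?U" if "finite N" "N \<subseteq> {1..p}" for N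
        using that
      proof (induct N)
        case (insert j N)
        have fU: "f i \<in> ?U" if "i \<in> insert j N" for i
          using f(1) sub that insert(4) by (blast dest: PiE_mem)
        have "finsum S f (insert j N) = f j \<oplus>\<^bsub>S\<^esub> finsum S f N"
          using insert(1,2) fU U.Icarr by (intro S.finsum_insert) auto
        then show ?case using U.a_closed[OF fU[of j]] insert by simp
      qed (use U.zero_closed in simp)
      then have "q (x (triv1 v)) \<in> ?U" using f(2) by simp
      then obtain a where a: "a \<in> supp_ideal (verts \<Delta> - {v})" "q (x (triv1 v)) = q a" by blast
      have ac: "a \<in> carrier A" "psi v a = \<zero>\<^bsub>B v\<^esub>" using a(1) v(1) by (auto simp: supp_ideal_def)
      have "psi v (x (triv1 v)) = psi v a"
        using q_eq_iff[OF triv_closed[OF v(1) Bv.one_closed] ac(1)] a(2) v(1) by blast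
      then show False using ac(2) psi_triv[OF v(1) Bv.one_closed] B_one_nonzero[OF v(1)] by simp
    qed
  qed
  ultimately show thesis using that[of \<sigma>] \<sigma> by (simp add: bij_betw_def)
qed

text \<open>The identity of an ideal is a definite description, so uniqueness has to be shown: two
  identities \<open>e'\<close> and \<open>e\<close> satisfy \<open>e' = e' e = e\<close>.\<close>

lemma T_one:
  assumes v: "v \<in> verts \<Delta>" shows "one (ideal_algebra S (T v)) = tau v \<one>\<^bsub>B v\<^esub>"
proof -
  interpret Bv: ring "B v" by (rule B_ring[OF v])
  let ?e = "tau v \<one>\<^bsub>B v\<^esub>"
  have e: "?e \<in> T v \<and> (\<forall>s\<in>T v. ?e \<otimes>\<^bsub>S\<^esub> s = s \<and> s \<otimes>\<^bsub>S\<^esub> ?e = s)"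
    using tau_T[OF v Bv.one_closed] by (auto simp: T_eq[OF v] tau_ops(2)[OF v, symmetric])
  have "(THE e. e \<in> T v \<and> (\<forall>s\<in>T v. e \<otimes>\<^bsub>S\<^esub> s = s \<and> s \<otimes>\<^bsub>S\<^esub> e = s)) = ?e"
  proof (rule the_equality)
    fix e' assume e': "e' \<in> T v \<and> (\<forall>s\<in>T v. e' \<otimes>\<^bsub>S\<^esub> s = s \<and> s \<otimes>\<^bsub>S\<^esub> e' = s)"
    then have "e' \<otimes>\<^bsub>S\<^esub> ?e = e'" "e' \<otimes>\<^bsub>S\<^esub> ?e = ?e" using e by auto
    then show "e' = ?e" by simp
  qed (rule e)
  then show ?thesis by (simp add: ideal_algebra_def)
qed

lemma T_isomorphic:
  assumes v: "v \<in> verts \<Delta>" and T: "k_algebra K (ideal_algebra S (T v))"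
  shows "algebra_isomorphic K (ideal_algebra S (T v)) (B v)"
proof -
  have "tau v \<in> algebra_iso K (B v) (ideal_algebra S (T v))"
  proof (rule algebra_isoI)
    show "tau v \<in> lin_maps K (B v) (ideal_algebra S (T v))"
      by (rule lin_mapsI) (simp_all add: ideal_algebra_simps tau_T[OF v] tau_ops[OF v])
    show "tau v \<in> ring_hom (B v) (ideal_algebra S (T v))"
      by (rule ring_hom_memI) (simp_all add: ideal_algebra_simps tau_T[OF v] tau_ops[OF v] T_one[OF v])
    show "inj_on (tau v) (carrier (B v))" by (rule tau_inj[OF v])
    show "tau v ` carrier (B v) = carrier (ideal_algebra S (T v))"
      by (simp add: ideal_algebra_simps T_eq[OF v])
  qed
  then show ?thesis using algebra_iso_inv[OF B_alg[OF v] T] by (auto simp: algebra_isomorphic_def)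
qed

end

section \<open>Linear algebra over a field\<close>

text \<open>Gaussian elimination, by induction on the number of equations. An equation whose
  coefficients are all zero is dropped; any other serves to eliminate one unknown
  \<open>i0\<close>.\<close>

lemma (in field) homogeneous_system:
  assumes "finite E" "finite I" "card E < card I" "\<And>e i. e \<in> E \<Longrightarrow> i \<in> I \<Longrightarrow> c e i \<in> carrier R"
  shows "\<exists>w. (\<forall>i\<in>I. w i \<in> carrier R) \<and> (\<exists>i\<in>I. w i \<noteq> \<zero>) \<and> (\<forall>e\<in>E. (\<Oplus>i\<in>I. c e i \<otimes> w i) = \<zero>)"
  using assms
proof (induct E arbitrary: I c rule: finite_induct)
  case empty
  then have "I \<noteq> {}" by auto
  then show ?case by (intro exI[of _ "\<lambda>_. \<one>"]) auto
next
  case (insert e0 E)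
  show ?case
  proof (cases "\<forall>i\<in>I. c e0 i = \<zero>")
    case True
    have "\<exists>w. (\<forall>i\<in>I. w i \<in> carrier R) \<and> (\<exists>i\<in>I. w i \<noteq> \<zero>) \<and> (\<forall>e\<in>E. (\<Oplus>i\<in>I. c e i \<otimes> w i) = \<zero>)"
      using insert by (intro insert(3)) auto
    then obtain w where w: "\<forall>i\<in>I. w i \<in> carrier R" "\<exists>i\<in>I. w i \<noteq> \<zero>" "\<forall>e\<in>E. (\<Oplus>i\<in>I. c e i \<otimes> w i) = \<zero>"
      by blast
    have "(\<Oplus>i\<in>I. c e0 i \<otimes> w i) = \<zero>" using True w(1) by (intro add.finprod_one_eqI) simp
    then show ?thesis using w by blast
  next
    case False
    then obtain i0 where i0: "i0 \<in> I" "c e0 i0 \<noteq> \<zero>" by blast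
    define I' where "I' = I - {i0}"
    have I': "finite I'" "i0 \<notin> I'" "I = insert i0 I'" using insert(4) i0 by (auto simp: I'_def)
    have card: "card E < card I'" using insert(1,2,4,5) I' by simp
    have cc: "c e i \<in> carrier R" if "e \<in> insert e0 E" "i \<in> I" for e i using insert(6) that by blast
    have u: "c e0 i0 \<in> Units R" using i0 cc field_Units by auto
    define d where "d e = c e i0 \<otimes> inv (c e0 i0)" for e
    have dc: "d e \<in> carrier R" if "e \<in> insert e0 E" for e using that cc i0(1) u by (simp add: d_def)
    \<comment> \<open>Subtracting \<open>d e\<close> times equation \<open>e0\<close> clears the
      coefficient at \<open>i0\<close>, which leaves a system with one equation and one unknown
      fewer.\<close>
    define c' where "c' e i = c e i \<ominus> d e \<otimes> c e0 i" for e i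
    have "\<exists>w. (\<forall>i\<in>I'. w i \<in> carrier R) \<and> (\<exists>i\<in>I'. w i \<noteq> \<zero>) \<and> (\<forall>e\<in>E. (\<Oplus>i\<in>I'. c' e i \<otimes> w i) = \<zero>)"
      using I' card cc dc by (intro insert(3)) (auto simp: c'_def)
    then obtain w where w: "\<forall>i\<in>I'. w i \<in> carrier R" "\<exists>i\<in>I'. w i \<noteq> \<zero>" "\<forall>e\<in>E. (\<Oplus>i\<in>I'. c' e i \<otimes> w i) = \<zero>"
      by blast
    define s where "s e = (\<Oplus>i\<in>I'. c e i \<otimes> w i)" for e
    have sc: "s e \<in> carrier R" if "e \<in> insert e0 E" for e
      unfolding s_def using w(1) cc[OF that] I'(3) by (intro finsum_closed) auto
    \<comment> \<open>The value at \<open>i0\<close> is dictated by equation \<open>e0\<close>; the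
      other equations then follow from the reduced system.\<close>
    define w' where "w' = w(i0 := \<ominus> (inv (c e0 i0) \<otimes> s e0))"
    have w'c: "w' i \<in> carrier R" if "i \<in> I" for i
      using that w(1) I' u sc[of e0] by (auto simp: w'_def)
    have sum: "(\<Oplus>i\<in>I. c e i \<otimes> w' i) = c e i0 \<otimes> \<ominus> (inv (c e0 i0) \<otimes> s e0) \<oplus> s e" if e: "e \<in> insert e0 E" for e
    proof -
      have "(\<Oplus>i\<in>I. c e i \<otimes> w' i) = c e i0 \<otimes> w' i0 \<oplus> (\<Oplus>i\<in>I'. c e i \<otimes> w' i)"
        unfolding I'(3) using I' w'c cc[OF e] by (intro finsum_insert) auto
      also have "(\<Oplus>i\<in>I'. c e i \<otimes> w' i) = s e"
        unfolding s_def using I' w'c cc[OF e] w(1) by (intro finsum_cong') (auto simp: w'_def)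
      finally show ?thesis by (simp add: w'_def)
    qed
    have "(\<Oplus>i\<in>I. c e i \<otimes> w' i) = \<zero>" if e: "e \<in> insert e0 E" for e
    proof (cases "e = e0")
      case True
      have "c e0 i0 \<otimes> (inv (c e0 i0) \<otimes> s e0) = s e0"
        using u sc[of e0] cc[OF _ i0(1), of e0] by (simp add: m_assoc[symmetric])
      then have "c e0 i0 \<otimes> \<ominus> (inv (c e0 i0) \<otimes> s e0) = \<ominus> s e0"
        using u sc[of e0] cc[OF _ i0(1), of e0] by (simp add: r_minus)
      then show ?thesis using sum[OF e] sc[of e0] True by (simp add: l_neg)
    next
      case False
      then have eE: "e \<in> E" using e by simp
      have "\<zero> = (\<Oplus>i\<in>I'. c' e i \<otimes> w i)" using w(3) eE by simp
      also have "\<dots> = (\<Oplus>i\<in>I'. c e i \<otimes> w i \<oplus> (\<ominus> d e) \<otimes> (c e0 i \<otimes> w i))"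
        using w(1) cc dc[OF e] e I'(3)
        by (intro finsum_cong') (auto simp: c'_def l_distr minus_eq l_minus m_assoc)
      also have "\<dots> = s e \<oplus> (\<Oplus>i\<in>I'. (\<ominus> d e) \<otimes> (c e0 i \<otimes> w i))"
        unfolding s_def using w(1) cc dc[OF e] e I'(3) by (intro finsum_addf) auto
      also have "(\<Oplus>i\<in>I'. (\<ominus> d e) \<otimes> (c e0 i \<otimes> w i)) = (\<ominus> d e) \<otimes> s e0"
        unfolding s_def using w(1) cc dc[OF e] I' by (intro finsum_rdistr[symmetric]) auto
      also have "(\<ominus> d e) \<otimes> s e0 = c e i0 \<otimes> \<ominus> (inv (c e0 i0) \<otimes> s e0)"
        unfolding d_def using u sc[of e0] cc[OF e i0(1)] by (simp add: l_minus r_minus m_assoc)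
      finally show ?thesis unfolding sum[OF e] using u sc e cc[OF e i0(1)] by (simp add: a_comm)
    qed
    moreover have "\<exists>i\<in>I. w' i \<noteq> \<zero>" using w(2) I' by (auto simp: w'_def)
    ultimately show ?thesis using w'c by blast
  qed
qed

text \<open>The ground field as a module over itself, to serve as the target of linear
  functionals.\<close>

definition field_module :: "('k, 'm) ring_scheme \<Rightarrow> ('k, 'k) module" where
  "field_module K = \<lparr>carrier = carrier K, mult = mult K, one = one K, zero = zero K, add = add K, smult = mult K\<rparr>"

lemma field_module_simps [simp]:
  "carrier (field_module K) = carrier K" "zero (field_module K) = zero K" "add (field_module K) = add K"
  "smult (field_module K) = mult K"
  by (simp_all add: field_module_def)

lemma field_module_module: "field K \<Longrightarrow> module K (field_module K)"
proof -
  assume "field K"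
  then interpret field K .
  have "\<exists>y\<in>carrier K. y \<oplus>\<^bsub>K\<^esub> x = \<zero>\<^bsub>K\<^esub>" if "x \<in> carrier K" for x
    using l_neg[OF that] a_inv_closed[OF that] by blast
  then have "abelian_group (field_module K)"
    by (intro abelian_groupI) (simp_all add: a_ac)
  then show ?thesis
    by (intro moduleI is_cring) (simp_all add: l_distr r_distr m_assoc)
qed

section \<open>Bases and coordinate functionals\<close>

lemma lin_span_eq_carrierI:
  assumes "module K V" "X \<subseteq> carrier V" "\<And>N. submodule N K V \<Longrightarrow> X \<subseteq> N \<Longrightarrow> carrier V \<subseteq> N"
  shows "lin_span K V X = carrier V"
proof -
  interpret module K V by fact
  show ?thesis
    using lin_span_least[OF carrier_is_submodule assms(2)] assms(3)[OF lin_span_submodule[OF assms(1,2)] lin_span_superset]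
    by blast
qed

lemma lin_span_finsum:
  assumes V: "module K V" and X: "finite X" "X \<subseteq> carrier V" and v: "v \<in> lin_span K V X"
  shows "\<exists>c. c \<in> X \<rightarrow> carrier K \<and> v = (\<Oplus>\<^bsub>V\<^esub>x\<in>X. c x \<odot>\<^bsub>V\<^esub> x)"
proof -
  interpret V: module K V by fact
  let ?N = "{v. \<exists>c. c \<in> X \<rightarrow> carrier K \<and> v = (\<Oplus>\<^bsub>V\<^esub>x\<in>X. c x \<odot>\<^bsub>V\<^esub> x)}"
  have cl: "(\<lambda>x. c x \<odot>\<^bsub>V\<^esub> x) \<in> X \<rightarrow> carrier V" if "c \<in> X \<rightarrow> carrier K" for c using that X by auto
  have "submodule ?N K V"
  proof (rule V.submoduleI)
    show "?N \<subseteq> carrier V" using cl by (auto intro!: V.M.finsum_closed)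
    show "\<zero>\<^bsub>V\<^esub> \<in> ?N" using X by (intro CollectI exI[of _ "\<lambda>_. \<zero>\<^bsub>K\<^esub>"]) (auto intro!: V.M.add.finprod_one_eqI[symmetric])
    have smult: "k \<odot>\<^bsub>V\<^esub> a \<in> ?N" if k: "k \<in> carrier K" and a: "a \<in> ?N" for k a
    proof -
      obtain c where c: "c \<in> X \<rightarrow> carrier K" "a = (\<Oplus>\<^bsub>V\<^esub>x\<in>X. c x \<odot>\<^bsub>V\<^esub> x)" using a by blast
      have "k \<odot>\<^bsub>V\<^esub> a = (\<Oplus>\<^bsub>V\<^esub>x\<in>X. k \<odot>\<^bsub>V\<^esub> (c x \<odot>\<^bsub>V\<^esub> x))"
        unfolding c(2) by (rule V.finsum_smult_ldistr[OF X(1) k cl[OF c(1)]])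
      also have "\<dots> = (\<Oplus>\<^bsub>V\<^esub>x\<in>X. (k \<otimes>\<^bsub>K\<^esub> c x) \<odot>\<^bsub>V\<^esub> x)"
        using c(1) k X by (intro V.M.finsum_cong') (auto simp: V.smult_assoc1 Pi_iff)
      finally show ?thesis using c(1) k by (intro CollectI exI[of _ "\<lambda>x. k \<otimes>\<^bsub>K\<^esub> c x"]) auto
    qed
    then show "k \<odot>\<^bsub>V\<^esub> a \<in> ?N" if "k \<in> carrier K" "a \<in> ?N" for k a using that by blast
    show "\<ominus>\<^bsub>V\<^esub> a \<in> ?N" if a: "a \<in> ?N" for a
    proof -
      have "a \<in> carrier V" using a cl by (auto intro!: V.M.finsum_closed)
      then have "\<ominus>\<^bsub>V\<^esub> a = (\<ominus>\<^bsub>K\<^esub> \<one>\<^bsub>K\<^esub>) \<odot>\<^bsub>V\<^esub> a" by (simp add: V.smult_l_minus)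
      then show ?thesis using smult[OF _ a, of "\<ominus>\<^bsub>K\<^esub> \<one>\<^bsub>K\<^esub>"] by simp
    qed
    show "a \<oplus>\<^bsub>V\<^esub> b \<in> ?N" if ab: "a \<in> ?N" "b \<in> ?N" for a b
    proof -
      obtain c where c: "c \<in> X \<rightarrow> carrier K" "a = (\<Oplus>\<^bsub>V\<^esub>x\<in>X. c x \<odot>\<^bsub>V\<^esub> x)" using ab by blast
      obtain d where d: "d \<in> X \<rightarrow> carrier K" "b = (\<Oplus>\<^bsub>V\<^esub>x\<in>X. d x \<odot>\<^bsub>V\<^esub> x)" using ab by blast
      have "(\<Oplus>\<^bsub>V\<^esub>x\<in>X. (c x \<oplus>\<^bsub>K\<^esub> d x) \<odot>\<^bsub>V\<^esub> x) = a \<oplus>\<^bsub>V\<^esub> b"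
        unfolding c(2) d(2) V.M.finsum_addf[OF cl[OF c(1)] cl[OF d(1)], symmetric]
        using c(1) d(1) X by (intro V.M.finsum_cong') (auto simp: V.smult_l_distr Pi_iff)
      then show ?thesis using c(1) d(1) by (intro CollectI exI[of _ "\<lambda>x. c x \<oplus>\<^bsub>K\<^esub> d x"]) auto
    qed
  qed
  moreover have "X \<subseteq> ?N"
  proof
    fix x assume x: "x \<in> X"
    have "(\<Oplus>\<^bsub>V\<^esub>y\<in>X. (if y = x then \<one>\<^bsub>K\<^esub> else \<zero>\<^bsub>K\<^esub>) \<odot>\<^bsub>V\<^esub> y) = (if x = x then \<one>\<^bsub>K\<^esub> else \<zero>\<^bsub>K\<^esub>) \<odot>\<^bsub>V\<^esub> x"
      by (rule V.M.finsum_single) (use x X in auto)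
    then have "x = (\<Oplus>\<^bsub>V\<^esub>y\<in>X. (if y = x then \<one>\<^bsub>K\<^esub> else \<zero>\<^bsub>K\<^esub>) \<odot>\<^bsub>V\<^esub> y)" using x X by auto
    then show "x \<in> ?N" by (intro CollectI exI[of _ "\<lambda>y. if y = x then \<one>\<^bsub>K\<^esub> else \<zero>\<^bsub>K\<^esub>"]) auto
  qed
  ultimately show ?thesis using lin_span_least[of ?N K V X] v by blast
qed

lemma submodule_finsum:
  assumes "module K V" "submodule N K V" "\<And>i. i \<in> I \<Longrightarrow> f i \<in> N"
  shows "finsum V f I \<in> N"
proof -
  interpret V: module K V by fact
  note N = submodule_memD[OF assms(1,2)]
  show ?thesis using assms(3)
  proof (induct I rule: infinite_finite_induct)
    case (insert i I)
    have "finsum V f (insert i I) = f i \<oplus>\<^bsub>V\<^esub> finsum V f I"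
      using insert N(2) by (intro V.M.finsum_insert) auto
    then show ?case using insert N(3) by simp
  qed (use N(1) in simp_all)
qed

text \<open>A spanning set of least size is independent, so coordinates are unique and hence linear.
  The later count works with the coordinate functionals themselves.\<close>

lemma dual_basis:
  assumes K: "field K" and V: "module K V" and fd: "finite_dimensional K V"
  obtains X f where "finite X" "X \<subseteq> carrier V" "lin_span K V X = carrier V"
    "\<And>x. x \<in> X \<Longrightarrow> f x \<in> lin_maps K V (field_module K)"
    "\<And>x y. x \<in> X \<Longrightarrow> y \<in> X \<Longrightarrow> f x y = (if x = y then \<one>\<^bsub>K\<^esub> else \<zero>\<^bsub>K\<^esub>)"
proof -
  interpret K: field K by fact
  interpret V: module K V by fact
  let ?P = "\<lambda>X. finite X \<and> X \<subseteq> carrier V \<and> lin_span K V X = carrier V"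
  obtain X0 where "?P X0" using fd by (auto simp: finite_dimensional_def)
  from ex_has_least_nat[of ?P X0 card, OF this]
  obtain X where P: "?P X" and min': "\<forall>Y. ?P Y \<longrightarrow> card X \<le> card Y" by (elim exE conjE) (rule that, simp_all)
  have min: "card X \<le> card Y" if "?P Y" for Y using min' that by simp
  have X: "finite X" "X \<subseteq> carrier V" and sp: "lin_span K V X = carrier V" using P by auto
  have Xc: "x \<in> carrier V" if "x \<in> X" for x using that X by blast
  have cl: "(\<lambda>x. c x \<odot>\<^bsub>V\<^esub> x) \<in> Y \<rightarrow> carrier V" if "c \<in> X \<rightarrow> carrier K" "Y \<subseteq> X" for c Y using that X by (auto simp: Pi_iff)
  have indep: "c y = \<zero>\<^bsub>K\<^esub>" if c: "c \<in> X \<rightarrow> carrier K" and z: "(\<Oplus>\<^bsub>V\<^esub>x\<in>X. c x \<odot>\<^bsub>V\<^esub> x) = \<zero>\<^bsub>V\<^esub>" and y: "y \<in> X" for c y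
  proof (rule ccontr)
    assume ne: "c y \<noteq> \<zero>\<^bsub>K\<^esub>"
    have cy: "c y \<in> carrier K" using c y by blast
    then have u: "c y \<in> Units K" using ne K.field_Units by simp
    \<comment> \<open>As \<open>c y\<close> is invertible, \<open>y\<close> is a combination of the
      other vectors; these would still span, contrary to minimality.\<close>
    let ?Y = "X - {y}"
    let ?s = "\<Oplus>\<^bsub>V\<^esub>x\<in>?Y. c x \<odot>\<^bsub>V\<^esub> x"
    have sc: "?s \<in> carrier V" using cl[OF c, of ?Y] by (intro V.M.finsum_closed) auto
    have Xy: "X = insert y ?Y" using y by blast
    have "(\<Oplus>\<^bsub>V\<^esub>x\<in>insert y ?Y. c x \<odot>\<^bsub>V\<^esub> x) = c y \<odot>\<^bsub>V\<^esub> y \<oplus>\<^bsub>V\<^esub> ?s"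
      using X y cy cl[OF c, of ?Y] Xc[OF y] by (intro V.M.finsum_insert) auto
    then have "c y \<odot>\<^bsub>V\<^esub> y \<oplus>\<^bsub>V\<^esub> ?s = \<zero>\<^bsub>V\<^esub>" using z Xy by simp
    then have "c y \<odot>\<^bsub>V\<^esub> y = \<ominus>\<^bsub>V\<^esub> ?s"
      using V.M.minus_equality[of "c y \<odot>\<^bsub>V\<^esub> y" ?s] sc cy Xc[OF y] by simp
    then have "inv\<^bsub>K\<^esub> (c y) \<odot>\<^bsub>V\<^esub> (c y \<odot>\<^bsub>V\<^esub> y) = inv\<^bsub>K\<^esub> (c y) \<odot>\<^bsub>V\<^esub> (\<ominus>\<^bsub>V\<^esub> ?s)" by simp
    moreover have "inv\<^bsub>K\<^esub> (c y) \<odot>\<^bsub>V\<^esub> (c y \<odot>\<^bsub>V\<^esub> y) = y"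
      using u cy Xc[OF y] by (simp add: V.smult_assoc1[symmetric])
    ultimately have ys: "y = inv\<^bsub>K\<^esub> (c y) \<odot>\<^bsub>V\<^esub> (\<ominus>\<^bsub>V\<^esub> ?s)" by simp
    have "lin_span K V ?Y = carrier V"
    proof (rule lin_span_eq_carrierI[OF V])
      show "?Y \<subseteq> carrier V" using X by blast
      fix N assume N: "submodule N K V" "?Y \<subseteq> N"
      note Nm = submodule_memD[OF V N(1)]
      have "?s \<in> N" by (rule submodule_finsum[OF V N(1)]) (use N(2) c Nm(6) in auto)
      then have "inv\<^bsub>K\<^esub> (c y) \<odot>\<^bsub>V\<^esub> (\<ominus>\<^bsub>V\<^esub> ?s) \<in> N" by (intro Nm(6) Nm(4) K.Units_inv_closed u)
      then have "y \<in> N" unfolding ys[symmetric] .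
      then have "X \<subseteq> N" using N(2) by blast
      then show "carrier V \<subseteq> N" using lin_span_least[OF N(1)] sp by blast
    qed
    then have "card X \<le> card ?Y" using X by (intro min) auto
    then show False using card_Diff1_less[OF X(1) y] by simp
  qed
  define cf where "cf v = (SOME c. c \<in> X \<rightarrow> carrier K \<and> v = (\<Oplus>\<^bsub>V\<^esub>x\<in>X. c x \<odot>\<^bsub>V\<^esub> x))" for v
  have cf: "cf v \<in> X \<rightarrow> carrier K" "v = (\<Oplus>\<^bsub>V\<^esub>x\<in>X. cf v x \<odot>\<^bsub>V\<^esub> x)" if "v \<in> carrier V" for v
    using someI_ex[OF lin_span_finsum[OF V X, of v]] that sp by (auto simp: cf_def)
  have uniq: "c y = d y" if c: "c \<in> X \<rightarrow> carrier K" and d: "d \<in> X \<rightarrow> carrier K" and y: "y \<in> X"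
    and e: "(\<Oplus>\<^bsub>V\<^esub>x\<in>X. c x \<odot>\<^bsub>V\<^esub> x) = (\<Oplus>\<^bsub>V\<^esub>x\<in>X. d x \<odot>\<^bsub>V\<^esub> x)" for c d y
  proof -
    have m: "(\<lambda>x. \<ominus>\<^bsub>K\<^esub> d x) \<in> X \<rightarrow> carrier K" using d by auto
    have "(\<Oplus>\<^bsub>V\<^esub>x\<in>X. (c x \<oplus>\<^bsub>K\<^esub> \<ominus>\<^bsub>K\<^esub> d x) \<odot>\<^bsub>V\<^esub> x) = (\<Oplus>\<^bsub>V\<^esub>x\<in>X. c x \<odot>\<^bsub>V\<^esub> x) \<oplus>\<^bsub>V\<^esub> (\<Oplus>\<^bsub>V\<^esub>x\<in>X. (\<ominus>\<^bsub>K\<^esub> d x) \<odot>\<^bsub>V\<^esub> x)"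
      unfolding V.M.finsum_addf[OF cl[OF c order.refl] cl[OF m order.refl], symmetric]
      using c d X by (intro V.M.finsum_cong') (auto simp: V.smult_l_distr Pi_iff)
    also have "\<dots> = (\<Oplus>\<^bsub>V\<^esub>x\<in>X. (d x \<oplus>\<^bsub>K\<^esub> \<ominus>\<^bsub>K\<^esub> d x) \<odot>\<^bsub>V\<^esub> x)"
      unfolding e V.M.finsum_addf[OF cl[OF d order.refl] cl[OF m order.refl], symmetric]
      using c d X by (intro V.M.finsum_cong') (auto simp: V.smult_l_distr Pi_iff)
    also have "\<dots> = \<zero>\<^bsub>V\<^esub>"
      using d Xc by (intro V.M.add.finprod_one_eqI) (auto simp: K.r_neg Pi_iff)
    finally have z: "(\<Oplus>\<^bsub>V\<^esub>x\<in>X. (c x \<oplus>\<^bsub>K\<^esub> \<ominus>\<^bsub>K\<^esub> d x) \<odot>\<^bsub>V\<^esub> x) = \<zero>\<^bsub>V\<^esub>" .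
    have "c y \<oplus>\<^bsub>K\<^esub> \<ominus>\<^bsub>K\<^esub> d y = \<zero>\<^bsub>K\<^esub>"
      using indep[OF _ z y] c d by auto
    then show ?thesis using K.eq_if_minus_eq_zero[of "c y" "d y"] c d y by (auto simp: K.minus_eq)
  qed
  show thesis
  proof (rule that[of X "\<lambda>x v. cf v x"])
    show "(\<lambda>v. cf v y) \<in> lin_maps K V (field_module K)" if y: "y \<in> X" for y
    proof (rule lin_mapsI)
      show "cf v y \<in> carrier (field_module K)" if "v \<in> carrier V" for v using cf(1)[OF that] y by auto
      show "cf (v \<oplus>\<^bsub>V\<^esub> w) y = cf v y \<oplus>\<^bsub>field_module K\<^esub> cf w y" if v: "v \<in> carrier V" and w: "w \<in> carrier V" for v w
      proof -
        have vw: "v \<oplus>\<^bsub>V\<^esub> w \<in> carrier V" using v w by simp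
        have "(\<Oplus>\<^bsub>V\<^esub>x\<in>X. (cf v x \<oplus>\<^bsub>K\<^esub> cf w x) \<odot>\<^bsub>V\<^esub> x) = (\<Oplus>\<^bsub>V\<^esub>x\<in>X. cf v x \<odot>\<^bsub>V\<^esub> x) \<oplus>\<^bsub>V\<^esub> (\<Oplus>\<^bsub>V\<^esub>x\<in>X. cf w x \<odot>\<^bsub>V\<^esub> x)"
          unfolding V.M.finsum_addf[OF cl[OF cf(1)[OF v] order.refl] cl[OF cf(1)[OF w] order.refl], symmetric]
          using cf(1)[OF v] cf(1)[OF w] X by (intro V.M.finsum_cong') (auto simp: V.smult_l_distr Pi_iff)
        also have "\<dots> = v \<oplus>\<^bsub>V\<^esub> w" unfolding cf(2)[OF v, symmetric] cf(2)[OF w, symmetric] ..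
        finally have "cf (v \<oplus>\<^bsub>V\<^esub> w) y = cf v y \<oplus>\<^bsub>K\<^esub> cf w y"
          using uniq[of "cf (v \<oplus>\<^bsub>V\<^esub> w)" "\<lambda>x. cf v x \<oplus>\<^bsub>K\<^esub> cf w x" y] cf(1)[OF v] cf(1)[OF w] cf[OF vw] y by auto
        then show ?thesis by simp
      qed
      show "cf (k \<odot>\<^bsub>V\<^esub> v) y = k \<odot>\<^bsub>field_module K\<^esub> cf v y" if k: "k \<in> carrier K" and v: "v \<in> carrier V" for k v
      proof -
        have vw: "k \<odot>\<^bsub>V\<^esub> v \<in> carrier V" using v k by simp
        have "(\<Oplus>\<^bsub>V\<^esub>x\<in>X. (k \<otimes>\<^bsub>K\<^esub> cf v x) \<odot>\<^bsub>V\<^esub> x) = k \<odot>\<^bsub>V\<^esub> (\<Oplus>\<^bsub>V\<^esub>x\<in>X. cf v x \<odot>\<^bsub>V\<^esub> x)"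
          unfolding V.finsum_smult_ldistr[OF X(1) k cl[OF cf(1)[OF v] order.refl]]
          using cf(1)[OF v] k X by (intro V.M.finsum_cong') (auto simp: V.smult_assoc1 Pi_iff)
        also have "\<dots> = k \<odot>\<^bsub>V\<^esub> v" unfolding cf(2)[OF v, symmetric] ..
        finally have "cf (k \<odot>\<^bsub>V\<^esub> v) y = k \<otimes>\<^bsub>K\<^esub> cf v y"
          using uniq[of "cf (k \<odot>\<^bsub>V\<^esub> v)" "\<lambda>x. k \<otimes>\<^bsub>K\<^esub> cf v x" y] cf(1)[OF v] cf[OF vw] k y by auto
        then show ?thesis by simp
      qed
    qed
    show "cf y x = (if x = y then \<one>\<^bsub>K\<^esub> else \<zero>\<^bsub>K\<^esub>)" if xy: "x \<in> X" "y \<in> X" for x y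
    proof -
      have "(\<Oplus>\<^bsub>V\<^esub>z\<in>X. (if z = y then \<one>\<^bsub>K\<^esub> else \<zero>\<^bsub>K\<^esub>) \<odot>\<^bsub>V\<^esub> z) = (if y = y then \<one>\<^bsub>K\<^esub> else \<zero>\<^bsub>K\<^esub>) \<odot>\<^bsub>V\<^esub> y"
        by (rule V.M.finsum_single) (use xy X in auto)
      then have "(\<Oplus>\<^bsub>V\<^esub>z\<in>X. (if z = y then \<one>\<^bsub>K\<^esub> else \<zero>\<^bsub>K\<^esub>) \<odot>\<^bsub>V\<^esub> z) = y" using xy X by auto
      then show ?thesis
        using uniq[of "cf y" "\<lambda>z. if z = y then \<one>\<^bsub>K\<^esub> else \<zero>\<^bsub>K\<^esub>" x] cf[OF Xc[OF xy(2)]] xy by auto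
    qed
  qed (use X sp in auto)
qed

lemma finite_dimensional_image:
  assumes "module K V" "module K W" "h \<in> lin_maps K V W" "h ` carrier V = carrier W" "finite_dimensional K V"
  shows "finite_dimensional K W"
proof -
  interpret W: module K W by fact
  obtain X where X: "finite X" "X \<subseteq> carrier V" "lin_span K V X = carrier V"
    using assms(5) by (auto simp: finite_dimensional_def)
  have "lin_span K W (h ` X) = carrier W"
  proof (rule lin_span_eq_carrierI[OF assms(2)])
    show "h ` X \<subseteq> carrier W" using X(2) assms(4) by blast
    fix N assume N: "submodule N K W" "h ` X \<subseteq> N"
    have "lin_span K V X \<subseteq> {x \<in> carrier V. h x \<in> N}"
      by (rule lin_span_least[OF submodule_vimage[OF assms(1,2,3) N(1)]]) (use X(2) N(2) in blast)
    then show "carrier W \<subseteq> N" unfolding X(3) assms(4)[symmetric] by blast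
  qed
  then show ?thesis unfolding finite_dimensional_def using X(1,2) assms(4) by (intro exI[of _ "h ` X"]) auto
qed

section \<open>The arrows of the quiver\<close>

text \<open>On paths \<open>a \<beta> b\<close> this is the form \<open>f \<otimes> g\<close> on the
  copy of \<open>B v\<close> tensor \<open>B w\<close> that belongs to \<beta>, for v and w the tail
  and head of \<beta>; all other paths get zero. For coordinate functionals \<open>f\<close> and
  \<open>g\<close> it is a coordinate function on the part of length 1.\<close>

definition arrow_form where
  "arrow_form K f g \<beta> p = (case p of Triv v a \<Rightarrow> \<zero>\<^bsub>K\<^esub> | Step a \<gamma> r \<Rightarrow>
    (case r of Triv w b \<Rightarrow> if \<gamma> = \<beta> then f a \<otimes>\<^bsub>K\<^esub> g b else \<zero>\<^bsub>K\<^esub> | Step _ _ _ \<Rightarrow> \<zero>\<^bsub>K\<^esub>))"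

lemma arrow_form_simps [simp]:
  "arrow_form K f g \<beta> (Triv v a) = \<zero>\<^bsub>K\<^esub>"
  "arrow_form K f g \<beta> (Step a \<gamma> (Triv w b)) = (if \<gamma> = \<beta> then f a \<otimes>\<^bsub>K\<^esub> g b else \<zero>\<^bsub>K\<^esub>)"
  "arrow_form K f g \<beta> (Step a \<gamma> (Step b \<delta> r)) = \<zero>\<^bsub>K\<^esub>"
  by (simp_all add: arrow_form_def)

context path_data
begin

lemma arrow_form_multilinear:
  assumes \<beta>: "\<beta> \<in> arcs \<Delta>" and f: "f \<in> lin_maps K (B (tail \<Delta> \<beta>)) (field_module K)"
    and g: "g \<in> lin_maps K (B (head \<Delta> \<beta>)) (field_module K)"
  shows "multilinear_on_paths (field_module K) (arrow_form K f g \<beta>)"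
proof -
  note fc = lin_maps_closed[OF f, simplified] and gc = lin_maps_closed[OF g, simplified]
  note fa = lin_maps_add[OF f, simplified] and ga = lin_maps_add[OF g, simplified]
  note fs = lin_maps_smult[OF f, simplified] and gs = lin_maps_smult[OF g, simplified]
  show ?thesis
    unfolding multilinear_on_paths_def
  proof (intro conjI allI impI)
    fix p assume p: "bp p"
    show "arrow_form K f g \<beta> p \<in> carrier (field_module K)"
    proof (cases p)
      case (Step a \<gamma> r)
      then show ?thesis using p fc gc by (cases r) auto
    qed simp
  next
    fix p p' p'' assume p: "bp p" "bp p'" and "entry_sum \<Delta> B p p' p''"
    from this(3) show "arrow_form K f g \<beta> p'' = arrow_form K f g \<beta> p \<oplus>\<^bsub>field_module K\<^esub> arrow_form K f g \<beta> p'"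
    proof cases
      case (2 a \<gamma> r b)
      then show ?thesis using p fc gc by (cases r) (auto simp: fa K.l_distr)
    next
      case (3 r r' r'' a \<gamma>)
      from 3(4) show ?thesis
      proof cases
        case (1 u b b')
        then show ?thesis using 3 p fc gc by (auto simp: ga K.r_distr)
      qed (simp_all add: 3)
    qed simp
  next
    fix c p p' assume c: "c \<in> carrier K" and p: "bp p" and "entry_smult \<Delta> B c p p'"
    from this(3) show "arrow_form K f g \<beta> p' = c \<odot>\<^bsub>field_module K\<^esub> arrow_form K f g \<beta> p"
    proof cases
      case (2 a \<gamma> r)
      then show ?thesis using p fc gc c by (cases r) (auto simp: fs K.m_assoc)
    next
      case (3 r r' a \<gamma>)
      from 3(3) show ?thesis
      proof cases
        case (1 u b)
        then show ?thesis using 3 p fc gc c by (auto simp: gs K.m_lcomm)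
      qed (use 3 c in simp_all)
    qed (use c in simp)
  qed
qed

end

context presented_algebra
begin

abbreviation r2 where "r2 \<equiv> (+>\<^bsub>A\<^esub>) (R 2)"
abbreviation Q2 where "Q2 \<equiv> A Quot R 2"

section \<open>The bimodule r/r^2 and its components\<close>

lemma R_2_subset_R_1: "R 2 \<subseteq> R 1"
proof
  fix a assume "a \<in> R 2"
  then show "a \<in> R 1"
  proof (induct a rule: R_induct)
    case (path p)
    then show ?case by (intro x_R) auto
  next
    case (add a b)
    show ?case by (rule additive_subgroup.a_closed[OF ideal.axioms(1)[OF R_ideal] add(3,4)])
  qed (rule additive_subgroup.zero_closed[OF ideal.axioms(1)[OF R_ideal]])
qed

lemma Q2_ring: "ring Q2"
  by (rule ideal.quotient_is_ring[OF R_ideal])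

lemma r2_hom: "r2 \<in> ring_hom A Q2"
  by (rule ideal.rcos_ring_hom[OF R_ideal])

lemma r2_zero: "a \<in> R 2 \<Longrightarrow> r2 a = \<zero>\<^bsub>Q2\<^esub>"
proof -
  assume a: "a \<in> R 2"
  interpret I: ideal "R 2" A by (rule R_ideal)
  show ?thesis using I.a_rcos_const[OF a] by (simp add: FactRing_def)
qed

lemma r2_eq_iff: "a \<in> carrier A \<Longrightarrow> b \<in> carrier A \<Longrightarrow> r2 a = r2 b \<longleftrightarrow> a \<ominus>\<^bsub>A\<^esub> b \<in> R 2"
  by (rule ideal.coset_eq_iff[OF R_ideal])

text \<open>Both actions are unions over representatives. Changing \<open>a\<close> within its coset
  of \<open>R 1\<close> alters the product with an element of \<open>R 1\<close> only by
  \<open>R 2\<close>, and so does changing \<open>m\<close> within its coset of \<open>R 2\<close>;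
  hence the union is a single coset.\<close>

lemma rad_act:
  assumes a: "a \<in> carrier A" and m: "m \<in> R 1"
  shows "rad_lact A (q a) (r2 m) = r2 (a \<otimes>\<^bsub>A\<^esub> m)" "rad_ract A (r2 m) (q a) = r2 (m \<otimes>\<^bsub>A\<^esub> a)"
proof -
  interpret I: ideal "R 2" A by (rule R_ideal)
  interpret I1: ideal Rad A by (rule Rad_ideal)
  have mc: "m \<in> carrier A" by (rule R_closed[OF m])
  have eq: "r2 (a' \<otimes>\<^bsub>A\<^esub> m') = r2 (a \<otimes>\<^bsub>A\<^esub> m) \<and> r2 (m' \<otimes>\<^bsub>A\<^esub> a') = r2 (m \<otimes>\<^bsub>A\<^esub> a)"
    if a': "a' \<in> q a" and m': "m' \<in> r2 m" for a' m'
  proof -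
    have ac: "a' \<in> carrier A" "a' \<ominus>\<^bsub>A\<^esub> a \<in> R 1"
      using I1.a_elemrcos_carrier[OF a a'] I1.a_rcos_module_minus[OF A.ring_axioms a] a' by (auto simp: Rad_def)
    have m'c: "m' \<in> carrier A" "m' \<ominus>\<^bsub>A\<^esub> m \<in> R 2"
      using I.a_elemrcos_carrier[OF mc m'] I.a_rcos_module_minus[OF A.ring_axioms mc] m' by auto
    have "(m' \<ominus>\<^bsub>A\<^esub> m) \<oplus>\<^bsub>A\<^esub> m \<in> R 1"
      using m'c(2) R_2_subset_R_1 m additive_subgroup.a_closed[OF ideal.axioms(1)[OF R_ideal]] by blast
    then have m'1: "m' \<in> R 1" using m'c mc by (simp add: A.minus_eq A.a_assoc A.l_neg)
    have "a' \<otimes>\<^bsub>A\<^esub> m' \<ominus>\<^bsub>A\<^esub> a \<otimes>\<^bsub>A\<^esub> m = (a' \<ominus>\<^bsub>A\<^esub> a) \<otimes>\<^bsub>A\<^esub> m' \<oplus>\<^bsub>A\<^esub> a \<otimes>\<^bsub>A\<^esub> (m' \<ominus>\<^bsub>A\<^esub> m)"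
      "m' \<otimes>\<^bsub>A\<^esub> a' \<ominus>\<^bsub>A\<^esub> m \<otimes>\<^bsub>A\<^esub> a = m' \<otimes>\<^bsub>A\<^esub> (a' \<ominus>\<^bsub>A\<^esub> a) \<oplus>\<^bsub>A\<^esub> (m' \<ominus>\<^bsub>A\<^esub> m) \<otimes>\<^bsub>A\<^esub> a"
      using a ac(1) mc m'c(1)
      by (simp_all add: A.minus_eq A.l_distr A.r_distr A.l_minus A.r_minus A.a_assoc A.r_neg1)
    moreover have "(a' \<ominus>\<^bsub>A\<^esub> a) \<otimes>\<^bsub>A\<^esub> m' \<in> R 2" "m' \<otimes>\<^bsub>A\<^esub> (a' \<ominus>\<^bsub>A\<^esub> a) \<in> R 2"
      using R_mult[OF ac(2) m'1] R_mult[OF m'1 ac(2)] by (simp_all add: numeral_2_eq_2)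
    ultimately have "a' \<otimes>\<^bsub>A\<^esub> m' \<ominus>\<^bsub>A\<^esub> a \<otimes>\<^bsub>A\<^esub> m \<in> R 2" "m' \<otimes>\<^bsub>A\<^esub> a' \<ominus>\<^bsub>A\<^esub> m \<otimes>\<^bsub>A\<^esub> a \<in> R 2"
      using I.a_closed I.I_l_closed[OF m'c(2) a] I.I_r_closed[OF m'c(2) a] by simp_all
    then show ?thesis using a ac(1) mc m'c(1) by (simp add: r2_eq_iff)
  qed
  have ne: "a \<in> q a" "m \<in> r2 m" using I1.a_rcos_self[OF a] I.a_rcos_self[OF mc] by auto
  have "(\<Union>a'\<in>q a. \<Union>m'\<in>r2 m. r2 (a' \<otimes>\<^bsub>A\<^esub> m')) = (\<Union>a'\<in>q a. \<Union>m'\<in>r2 m. r2 (a \<otimes>\<^bsub>A\<^esub> m))"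
    by (intro SUP_cong refl) (use eq in blast)
  also have "\<dots> = r2 (a \<otimes>\<^bsub>A\<^esub> m)" using ne by auto
  finally show "rad_lact A (q a) (r2 m) = r2 (a \<otimes>\<^bsub>A\<^esub> m)"
    by (simp add: rad_lact_def rcoset_mult_def rad_sq_eq)
  have "(\<Union>m'\<in>r2 m. \<Union>a'\<in>q a. r2 (m' \<otimes>\<^bsub>A\<^esub> a')) = (\<Union>m'\<in>r2 m. \<Union>a'\<in>q a. r2 (m \<otimes>\<^bsub>A\<^esub> a))"
    by (intro SUP_cong refl) (use eq in blast)
  also have "\<dots> = r2 (m \<otimes>\<^bsub>A\<^esub> a)" using ne by auto
  finally show "rad_ract A (r2 m) (q a) = r2 (m \<otimes>\<^bsub>A\<^esub> a)"
    by (simp add: rad_ract_def rcoset_mult_def rad_sq_eq)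
qed

lemma rad_layer_eq: "rad_layer A = r2 ` R 1"
  by (simp only: rad_layer_def rad_sq_eq radical_eq)

lemma triv_lin: "v \<in> verts \<Delta> \<Longrightarrow> (\<lambda>b. x (Triv v b)) \<in> lin_maps K (B v) A"
  by (rule lin_mapsI) (simp_all add: triv_closed triv_add triv_smult)

lemma A_mult_lin: "a \<in> carrier A \<Longrightarrow> (\<lambda>b. a \<otimes>\<^bsub>A\<^esub> b) \<in> lin_maps K A A" "a \<in> carrier A \<Longrightarrow> (\<lambda>b. b \<otimes>\<^bsub>A\<^esub> a) \<in> lin_maps K A A"
  using k_algebra_smult[OF A_alg] by (auto intro!: lin_mapsI simp: A.r_distr A.l_distr)

context
  fixes v w assumes v: "v \<in> verts \<Delta>" and w: "w \<in> verts \<Delta>"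
begin

interpretation Bv: ring "B v" by (rule B_ring[OF v])
interpretation Bw: ring "B w" by (rule B_ring[OF w])

definition arrows where "arrows = {\<beta> \<in> arcs \<Delta>. tail \<Delta> \<beta> = v \<and> head \<Delta> \<beta> = w}"

abbreviation ev where "ev \<equiv> x (triv1 v)"
abbreviation ew where "ew \<equiv> x (triv1 w)"

lemma arrows_finite: "finite arrows"
  unfolding arrows_def by simp

lemma evw_closed: "ev \<in> carrier A" "ew \<in> carrier A"
  using triv_closed[OF v Bv.one_closed] triv_closed[OF w Bw.one_closed] by auto

lemma ev_triv: "b \<in> carrier (B v) \<Longrightarrow> ev \<otimes>\<^bsub>A\<^esub> x (Triv v b) = x (Triv v b)"
  "b \<in> carrier (B v) \<Longrightarrow> x (Triv v b) \<otimes>\<^bsub>A\<^esub> ev = x (Triv v b)"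
  using v by (simp_all add: triv_mult)

lemma ew_triv: "b \<in> carrier (B w) \<Longrightarrow> ew \<otimes>\<^bsub>A\<^esub> x (Triv w b) = x (Triv w b)"
  "b \<in> carrier (B w) \<Longrightarrow> x (Triv w b) \<otimes>\<^bsub>A\<^esub> ew = x (Triv w b)"
  using w by (simp_all add: triv_mult)

text \<open>A lift to \<open>A\<close> of the component of r/r^2 at the two vertices. Calculations
  are done here, among path elements, and pass to cosets of \<open>R 2\<close> only at the
  end.\<close>

definition corner where "corner = {ev \<otimes>\<^bsub>A\<^esub> m \<otimes>\<^bsub>A\<^esub> ew | m. m \<in> R 1}"

lemma R_1_mult: "m \<in> R 1 \<Longrightarrow> a \<in> carrier A \<Longrightarrow> a \<otimes>\<^bsub>A\<^esub> m \<in> R 1" "m \<in> R 1 \<Longrightarrow> a \<in> carrier A \<Longrightarrow> m \<otimes>\<^bsub>A\<^esub> a \<in> R 1"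
  by (rule ideal.I_l_closed[OF R_ideal], assumption+, rule ideal.I_r_closed[OF R_ideal], assumption+)

lemma corner_R: "y \<in> corner \<Longrightarrow> y \<in> R 1"
  unfolding corner_def using R_1_mult evw_closed by blast

lemma corner_absorb: "y \<in> corner \<Longrightarrow> ev \<otimes>\<^bsub>A\<^esub> y \<otimes>\<^bsub>A\<^esub> ew = y"
proof -
  assume "y \<in> corner"
  then obtain m where m: "y = ev \<otimes>\<^bsub>A\<^esub> m \<otimes>\<^bsub>A\<^esub> ew" "m \<in> R 1" unfolding corner_def by blast
  have ee: "ev \<otimes>\<^bsub>A\<^esub> ev = ev" "ew \<otimes>\<^bsub>A\<^esub> ew = ew" using ev_triv[OF Bv.one_closed] ew_triv[OF Bw.one_closed] by auto
  have "ev \<otimes>\<^bsub>A\<^esub> y \<otimes>\<^bsub>A\<^esub> ew = (ev \<otimes>\<^bsub>A\<^esub> ev) \<otimes>\<^bsub>A\<^esub> m \<otimes>\<^bsub>A\<^esub> (ew \<otimes>\<^bsub>A\<^esub> ew)"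
    unfolding m(1) using evw_closed R_closed[OF m(2)] by (simp add: A.m_assoc)
  then show ?thesis by (simp only: ee m(1))
qed

lemma corner_act:
  assumes "y \<in> corner" "b \<in> carrier (B v)" "b' \<in> carrier (B w)"
  shows "x (Triv v b) \<otimes>\<^bsub>A\<^esub> y \<in> corner" "y \<otimes>\<^bsub>A\<^esub> x (Triv w b') \<in> corner"
proof -
  obtain m where m: "y = ev \<otimes>\<^bsub>A\<^esub> m \<otimes>\<^bsub>A\<^esub> ew" "m \<in> R 1" using assms(1) unfolding corner_def by blast
  note c = evw_closed R_closed[OF m(2)] triv_closed[OF v assms(2)] triv_closed[OF w assms(3)]
  have "x (Triv v b) \<otimes>\<^bsub>A\<^esub> y = (x (Triv v b) \<otimes>\<^bsub>A\<^esub> ev) \<otimes>\<^bsub>A\<^esub> m \<otimes>\<^bsub>A\<^esub> ew"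
    unfolding m(1) using c by (simp add: A.m_assoc)
  also have "\<dots> = (ev \<otimes>\<^bsub>A\<^esub> x (Triv v b)) \<otimes>\<^bsub>A\<^esub> m \<otimes>\<^bsub>A\<^esub> ew" by (simp only: ev_triv[OF assms(2)])
  also have "\<dots> = ev \<otimes>\<^bsub>A\<^esub> (x (Triv v b) \<otimes>\<^bsub>A\<^esub> m) \<otimes>\<^bsub>A\<^esub> ew" using c by (simp add: A.m_assoc)
  finally show "x (Triv v b) \<otimes>\<^bsub>A\<^esub> y \<in> corner"
    unfolding corner_def using R_1_mult(1)[OF m(2) c(4)] by blast
  have "y \<otimes>\<^bsub>A\<^esub> x (Triv w b') = ev \<otimes>\<^bsub>A\<^esub> m \<otimes>\<^bsub>A\<^esub> (ew \<otimes>\<^bsub>A\<^esub> x (Triv w b'))"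
    unfolding m(1) using c by (simp add: A.m_assoc)
  also have "\<dots> = ev \<otimes>\<^bsub>A\<^esub> m \<otimes>\<^bsub>A\<^esub> (x (Triv w b') \<otimes>\<^bsub>A\<^esub> ew)" by (simp only: ew_triv[OF assms(3)])
  also have "\<dots> = ev \<otimes>\<^bsub>A\<^esub> (m \<otimes>\<^bsub>A\<^esub> x (Triv w b')) \<otimes>\<^bsub>A\<^esub> ew" using c by (simp add: A.m_assoc)
  finally show "y \<otimes>\<^bsub>A\<^esub> x (Triv w b') \<in> corner"
    unfolding corner_def using R_1_mult(2)[OF m(2) c(5)] by blast
qed

lemma corner_submodule: "submodule corner K A"
proof -
  have l: "(\<lambda>m. ev \<otimes>\<^bsub>A\<^esub> m \<otimes>\<^bsub>A\<^esub> ew) \<in> lin_maps K A A"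
    using lin_maps_comp[OF A_mult_lin(1)[OF evw_closed(1)] A_mult_lin(2)[OF evw_closed(2)]] by (simp add: o_def)
  note R1 = submodule_memD[OF A_module ideal_submodule[OF A_alg R_ideal[of 1]]]
  show ?thesis
  proof (rule Am.submoduleI)
    show "corner \<subseteq> carrier A" using corner_R R_closed by blast
    show "\<zero>\<^bsub>A\<^esub> \<in> corner"
      unfolding corner_def using R1(1) evw_closed by (intro CollectI exI[of _ "\<zero>\<^bsub>A\<^esub>"]) simp
    fix a assume "a \<in> corner"
    then obtain m where m: "m \<in> R 1" "a = ev \<otimes>\<^bsub>A\<^esub> m \<otimes>\<^bsub>A\<^esub> ew" unfolding corner_def by blast
    show "\<ominus>\<^bsub>A\<^esub> a \<in> corner"
      unfolding corner_def m(2) lin_maps_uminus[OF A_module A_module l R1(2)[OF m(1)], symmetric]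
      using R1(4)[OF m(1)] by blast
    show "c \<odot>\<^bsub>A\<^esub> a \<in> corner" if "c \<in> carrier K" for c
      unfolding corner_def m(2) lin_maps_smult[OF l that R1(2)[OF m(1)], symmetric]
      using R1(6)[OF that m(1)] by blast
    fix b assume "b \<in> corner"
    then obtain n where n: "n \<in> R 1" "b = ev \<otimes>\<^bsub>A\<^esub> n \<otimes>\<^bsub>A\<^esub> ew" unfolding corner_def by blast
    show "a \<oplus>\<^bsub>A\<^esub> b \<in> corner"
      unfolding corner_def m(2) n(2) lin_maps_add[OF l R1(2)[OF m(1)] R1(2)[OF n(1)], symmetric]
      using R1(3)[OF m(1) n(1)] by blast
  qed
qed

lemma r2_image_subgroup: "submodule N K A \<Longrightarrow> subgroup (r2 ` N) (add_monoid Q2)"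
  by (rule ring_hom_ring.img_is_add_subgroup[OF ring_hom_ringI2[OF A.ring_axioms Q2_ring r2_hom] submodule.axioms(1)])

text \<open>The generating products already form a group: they lie in the image of the corner, and
  every corner element arises with the identities of the two components as outer factors. As the
  corner is a subspace, its image is a subgroup.\<close>

lemma component_eq: "rad_component A (T v) (T w) = r2 ` corner"
proof -
  let ?gens = "{rad_ract A (rad_lact A a m) b | a m b. a \<in> T v \<and> m \<in> rad_layer A \<and> b \<in> T w}"
  interpret Q2: ring Q2 by (rule Q2_ring)
  have act: "rad_ract A (rad_lact A (tau v b) (r2 m)) (tau w b') = r2 (x (Triv v b) \<otimes>\<^bsub>A\<^esub> m \<otimes>\<^bsub>A\<^esub> x (Triv w b'))"
    if "b \<in> carrier (B v)" "b' \<in> carrier (B w)" "m \<in> R 1" for b b' m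
    unfolding tau_def rad_act(1)[OF triv_closed[OF v that(1)] that(3)]
    by (rule rad_act(2)[OF triv_closed[OF w that(2)] R_1_mult(1)[OF that(3) triv_closed[OF v that(1)]]])
  have "?gens = r2 ` corner"
  proof
    show "?gens \<subseteq> r2 ` corner"
    proof
      fix z assume "z \<in> ?gens"
      then obtain b m b' where z: "z = rad_ract A (rad_lact A (tau v b) (r2 m)) (tau w b')"
        "b \<in> carrier (B v)" "b' \<in> carrier (B w)" "m \<in> R 1"
        unfolding T_eq[OF v] T_eq[OF w] rad_layer_eq by blast
      note c = evw_closed R_closed[OF z(4)] triv_closed[OF v z(2)] triv_closed[OF w z(3)]
      let ?m = "x (Triv v b) \<otimes>\<^bsub>A\<^esub> m \<otimes>\<^bsub>A\<^esub> x (Triv w b')"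
      have "?m \<in> R 1" using R_1_mult z(4) c by blast
      moreover have "?m = ev \<otimes>\<^bsub>A\<^esub> ?m \<otimes>\<^bsub>A\<^esub> ew"
      proof -
        have "ev \<otimes>\<^bsub>A\<^esub> ?m \<otimes>\<^bsub>A\<^esub> ew = (ev \<otimes>\<^bsub>A\<^esub> x (Triv v b)) \<otimes>\<^bsub>A\<^esub> m \<otimes>\<^bsub>A\<^esub> (x (Triv w b') \<otimes>\<^bsub>A\<^esub> ew)"
          using c by (simp add: A.m_assoc)
        then show ?thesis by (simp only: ev_triv[OF z(2)] ew_triv[OF z(3)])
      qed
      ultimately have "?m \<in> corner" unfolding corner_def by blast
      then show "z \<in> r2 ` corner" unfolding z(1) act[OF z(2-4)] by (rule imageI)
    qed
    show "r2 ` corner \<subseteq> ?gens"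
    proof
      fix z assume "z \<in> r2 ` corner"
      then obtain m where m: "z = r2 (ev \<otimes>\<^bsub>A\<^esub> m \<otimes>\<^bsub>A\<^esub> ew)" "m \<in> R 1" unfolding corner_def by blast
      have "z = rad_ract A (rad_lact A (tau v \<one>\<^bsub>B v\<^esub>) (r2 m)) (tau w \<one>\<^bsub>B w\<^esub>)"
        unfolding m(1) by (rule act[OF Bv.one_closed Bw.one_closed m(2), symmetric])
      then show "z \<in> ?gens"
        unfolding rad_layer_eq using tau_T[OF v Bv.one_closed] tau_T[OF w Bw.one_closed] m(2) by blast
    qed
  qed
  then have "rad_component A (T v) (T w) = generate (add_monoid Q2) (r2 ` corner)"
    unfolding rad_component_def rad_sq_eq by simp
  also have "\<dots> = r2 ` corner"
  proof
    show "generate (add_monoid Q2) (r2 ` corner) \<subseteq> r2 ` corner"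
      by (rule Q2.add.generate_subgroup_incl[OF order.refl r2_image_subgroup[OF corner_submodule]])
    show "r2 ` corner \<subseteq> generate (add_monoid Q2) (r2 ` corner)" by (auto intro: generate.incl)
  qed
  finally show ?thesis .
qed

abbreviation sub_bim where
  "sub_bim \<equiv> sub_bimodule (ideal_algebra S (T v)) (ideal_algebra S (T w)) Q2 (rad_lact A) (rad_ract A)"

text \<open>Produces sub-bimodules from subspaces of \<open>A\<close> stable under the paths of
  length 0 at the two vertices; \<open>rad_act\<close> computes the actions on
  representatives.\<close>

lemma sub_bim_image:
  assumes N: "submodule N K A" "N \<subseteq> R 1"
    and l: "\<And>b y. b \<in> carrier (B v) \<Longrightarrow> y \<in> N \<Longrightarrow> x (Triv v b) \<otimes>\<^bsub>A\<^esub> y \<in> N"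
    and r: "\<And>b y. b \<in> carrier (B w) \<Longrightarrow> y \<in> N \<Longrightarrow> y \<otimes>\<^bsub>A\<^esub> x (Triv w b) \<in> N"
  shows "sub_bim (r2 ` N)"
  unfolding sub_bimodule_def ideal_algebra_simps T_eq[OF v] T_eq[OF w]
proof (intro conjI ballI)
  show "additive_subgroup (r2 ` N) Q2"
    by (rule additive_subgroupI[OF r2_image_subgroup[OF N(1)]])
  fix z assume "z \<in> r2 ` N"
  then obtain y where y: "y \<in> N" "z = r2 y" by blast
  have y1: "y \<in> R 1" using y(1) N(2) by blast
  show "rad_lact A a z \<in> r2 ` N" if "a \<in> tau v ` carrier (B v)" for a
  proof -
    from that obtain b where b: "a = tau v b" "b \<in> carrier (B v)" by (rule imageE)
    show ?thesis unfolding y(2) b(1) tau_def rad_act(1)[OF triv_closed[OF v b(2)] y1] using l[OF b(2) y(1)] by (rule imageI)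
  qed
  show "rad_ract A z a \<in> r2 ` N" if "a \<in> tau w ` carrier (B w)" for a
  proof -
    from that obtain b where b: "a = tau w b" "b \<in> carrier (B w)" by (rule imageE)
    show ?thesis unfolding y(2) b(1) tau_def rad_act(2)[OF triv_closed[OF w b(2)] y1] using r[OF b(2) y(1)] by (rule imageI)
  qed
qed

lemma sub_bim_corner: "sub_bim (r2 ` corner)"
proof (rule sub_bim_image[OF corner_submodule])
  show "corner \<subseteq> R 1" by (rule subsetI) (rule corner_R)
  show "x (Triv v b) \<otimes>\<^bsub>A\<^esub> y \<in> corner" if "b \<in> carrier (B v)" "y \<in> corner" for b y
    by (rule corner_act(1)[OF that(2,1) Bw.one_closed])
  show "y \<otimes>\<^bsub>A\<^esub> x (Triv w b) \<in> corner" if "b \<in> carrier (B w)" "y \<in> corner" for b y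
    by (rule corner_act(2)[OF that(2) Bv.one_closed that(1)])
qed

section \<open>Generators and rank\<close>

lemma corner_path:
  assumes p: "bp p"
  shows "ev \<otimes>\<^bsub>A\<^esub> x p \<otimes>\<^bsub>A\<^esub> ew = (if bp_start \<Delta> p = v \<and> bp_end p = w then x p else \<zero>\<^bsub>A\<^esub>)"
proof -
  have t: "bp (triv1 v)" "bp (triv1 w)" using triv1_bp v w by auto
  have "ev \<otimes>\<^bsub>A\<^esub> x p = (if bp_start \<Delta> p = v then x p else \<zero>\<^bsub>A\<^esub>)"
    using x_mult[OF t(1) p] bp_mult_unit_left[OF p] by auto
  moreover have "x p \<otimes>\<^bsub>A\<^esub> ew = (if bp_end p = w then x p else \<zero>\<^bsub>A\<^esub>)"
    using x_mult[OF p t(2)] bp_mult_unit_right[OF p] by auto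
  ultimately show ?thesis using evw_closed by simp
qed

abbreviation arrow where "arrow \<beta> \<equiv> Step \<one>\<^bsub>B v\<^esub> \<beta> (triv1 w)"

lemma arrow_bp: "\<beta> \<in> arrows \<Longrightarrow> a \<in> carrier (B v) \<Longrightarrow> b \<in> carrier (B w) \<Longrightarrow> bp (Step a \<beta> (Triv w b))"
  using w by (simp add: arrows_def)

lemma arrow_corner:
  assumes "\<beta> \<in> arrows" "a \<in> carrier (B v)" "b \<in> carrier (B w)"
  shows "x (Step a \<beta> (Triv w b)) \<in> corner"
proof -
  have "x (Step a \<beta> (Triv w b)) = ev \<otimes>\<^bsub>A\<^esub> x (Step a \<beta> (Triv w b)) \<otimes>\<^bsub>A\<^esub> ew"
    using corner_path[OF arrow_bp[OF assms]] assms(1) by (simp add: arrows_def)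
  moreover have "x (Step a \<beta> (Triv w b)) \<in> R 1" by (rule x_R[OF arrow_bp[OF assms]]) simp
  ultimately show ?thesis unfolding corner_def by blast
qed

text \<open>Since \<open>a \<beta> b = a (1 \<beta> 1) b\<close>, the arrows with identity entries
  generate all paths of length 1 between the two vertices. Longer paths vanish modulo
  \<open>R 2\<close>, and paths with other end points are cut off by the idempotents.\<close>

lemma sub_bim_contains_corner:
  assumes N: "sub_bim N" and arr: "\<And>\<beta>. \<beta> \<in> arrows \<Longrightarrow> r2 (x (arrow \<beta>)) \<in> N"
  shows "r2 ` corner \<subseteq> N"
proof -
  interpret N: additive_subgroup N Q2 using N by (simp add: sub_bimodule_def)
  have l: "rad_lact A a z \<in> N" if "a \<in> T v" "z \<in> N" for a z
    using N that by (simp add: sub_bimodule_def ideal_algebra_simps)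
  have r': "rad_ract A z a \<in> N" if "a \<in> T w" "z \<in> N" for a z
    using N that by (simp add: sub_bimodule_def ideal_algebra_simps)
  have z: "r2 a \<in> N" if "a \<in> R 2" for a using r2_zero[OF that] N.zero_closed by simp
  have z0: "\<zero>\<^bsub>A\<^esub> \<in> R 2" using additive_subgroup.zero_closed[OF ideal.axioms(1)[OF R_ideal]] .
  have "r2 (ev \<otimes>\<^bsub>A\<^esub> m \<otimes>\<^bsub>A\<^esub> ew) \<in> N" if "m \<in> R 1" for m
    using that
  proof (induct m rule: R_induct)
    case zero
    then show ?case using z[OF z0] evw_closed by simp
  next
    case (path p)
    show ?case
    proof (cases "bp_start \<Delta> p = v \<and> bp_end p = w \<and> bp_length p = 1")
      case True
      obtain a \<beta> r where p: "p = Step a \<beta> r" using path(2) by (cases p) auto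
      obtain u b where r: "r = Triv u b" using True p by (cases r) auto
      have \<beta>: "\<beta> \<in> arrows" and a: "a \<in> carrier (B v)" and b: "b \<in> carrier (B w)" and u: "u = w"
        using True path(1) p r by (auto simp: arrows_def)
      have pe: "p = Step a \<beta> (Triv w b)" using p r u by simp
      have ab: "bp (arrow \<beta>)" by (rule arrow_bp[OF \<beta> Bv.one_closed Bw.one_closed])
      have a1: "x (arrow \<beta>) \<in> R 1" by (rule x_R[OF ab]) simp
      have ta: "bp (Triv v a)" "bp (Triv w b)" using a b v w by auto
      have "x (Triv v a) \<otimes>\<^bsub>A\<^esub> x (arrow \<beta>) = x (Step a \<beta> (triv1 w))"
        using x_mult[OF ta(1) ab] \<beta> a by (simp add: arrows_def)
      moreover have "x (Step a \<beta> (triv1 w)) \<otimes>\<^bsub>A\<^esub> x (Triv w b) = x p"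
        using x_mult[OF arrow_bp[OF \<beta> a Bw.one_closed] ta(2)] b pe by simp
      ultimately have xp: "x p = x (Triv v a) \<otimes>\<^bsub>A\<^esub> x (arrow \<beta>) \<otimes>\<^bsub>A\<^esub> x (Triv w b)" by simp
      have tca: "x (Triv v a) \<in> carrier A" and tcb: "x (Triv w b) \<in> carrier A" using x_closed ta by auto
      have "rad_ract A (rad_lact A (tau v a) (r2 (x (arrow \<beta>)))) (tau w b) \<in> N"
        by (rule r'[OF tau_T[OF w b] l[OF tau_T[OF v a] arr[OF \<beta>]]])
      then have "r2 (x p) \<in> N"
        unfolding tau_def rad_act(1)[OF tca a1] rad_act(2)[OF tcb R_1_mult(1)[OF a1 tca]] xp .
      then show ?thesis using corner_path[OF path(1)] True by simp
    next
      case False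
      then have "ev \<otimes>\<^bsub>A\<^esub> x p \<otimes>\<^bsub>A\<^esub> ew \<in> R 2"
        unfolding corner_path[OF path(1)] using z0 x_R[OF path(1), of 2] path(2) by auto
      then show ?thesis by (rule z)
    qed
  next
    case (add a b)
    have c: "a \<in> carrier A" "b \<in> carrier A" using add R_closed by auto
    have "ev \<otimes>\<^bsub>A\<^esub> (a \<oplus>\<^bsub>A\<^esub> b) \<otimes>\<^bsub>A\<^esub> ew = ev \<otimes>\<^bsub>A\<^esub> a \<otimes>\<^bsub>A\<^esub> ew \<oplus>\<^bsub>A\<^esub> ev \<otimes>\<^bsub>A\<^esub> b \<otimes>\<^bsub>A\<^esub> ew"
      using c evw_closed by (simp add: A.l_distr A.r_distr)
    then have "r2 (ev \<otimes>\<^bsub>A\<^esub> (a \<oplus>\<^bsub>A\<^esub> b) \<otimes>\<^bsub>A\<^esub> ew) = r2 (ev \<otimes>\<^bsub>A\<^esub> a \<otimes>\<^bsub>A\<^esub> ew) \<oplus>\<^bsub>Q2\<^esub> r2 (ev \<otimes>\<^bsub>A\<^esub> b \<otimes>\<^bsub>A\<^esub> ew)"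
      using c evw_closed ring_hom_add[OF r2_hom] by simp
    then show ?case using add N.a_closed by simp
  qed
  then show ?thesis unfolding corner_def by blast
qed

text \<open>
  The elements of \<open>X\<close> generate at most \<open>card X \<cdot> dim B v \<cdot> dim B w\<close> dimensions, so if there
  are fewer of them than arrows, some nonzero combination \<open>\<Phi>\<close> of the coordinate functionals
  of the paths of length 1 vanishes on the sub-bimodule generated by \<open>X\<close>.
\<close>
lemma generating_set_card:
  assumes fd: "finite_dimensional K A"
    and X: "finite X" "X \<subseteq> r2 ` corner" "\<Inter>{N. sub_bim N \<and> X \<subseteq> N} = r2 ` corner"
  shows "card arrows \<le> card X"
proof (rule ccontr)
  assume "\<not> card arrows \<le> card X"
  then have lt: "card X < card arrows" by simp
  have KM: "module K (field_module K)" by (rule field_module_module[OF K_field])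
  have fdB: "finite_dimensional K (B u)" if "u \<in> verts \<Delta>" for u
    by (rule finite_dimensional_image[OF A_module B_module[OF that] psi_lin[OF that] psi_image[OF that] fd])
  obtain U f where U: "finite U" "U \<subseteq> carrier (B v)" "lin_span K (B v) U = carrier (B v)"
    and f: "\<And>u. u \<in> U \<Longrightarrow> f u \<in> lin_maps K (B v) (field_module K)"
    and fd: "\<And>u u'. u \<in> U \<Longrightarrow> u' \<in> U \<Longrightarrow> f u u' = (if u = u' then \<one>\<^bsub>K\<^esub> else \<zero>\<^bsub>K\<^esub>)"
    using dual_basis[OF K_field B_module[OF v] fdB[OF v]] by metis
  obtain U' f' where U': "finite U'" "U' \<subseteq> carrier (B w)" "lin_span K (B w) U' = carrier (B w)"
    and f': "\<And>u. u \<in> U' \<Longrightarrow> f' u \<in> lin_maps K (B w) (field_module K)"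
    and fd': "\<And>u u'. u \<in> U' \<Longrightarrow> u' \<in> U' \<Longrightarrow> f' u u' = (if u = u' then \<one>\<^bsub>K\<^esub> else \<zero>\<^bsub>K\<^esub>)"
    using dual_basis[OF K_field B_module[OF w] fdB[OF w]] by metis
  \<comment> \<open>The vertex algebras are nonzero, so their spanning sets are nonempty, and the
    strict inequality between the numbers of generators and arrows survives multiplication by both
    dimensions.\<close>
  have ne: "Y \<noteq> {}" if u: "u \<in> verts \<Delta>" and Y: "lin_span K (B u) Y = carrier (B u)" for u Y
  proof
    assume "Y = {}"
    interpret Bu: module K "B u" by (rule B_module[OF u])
    interpret Bur: ring "B u" by (rule B_ring[OF u])
    have "submodule {\<zero>\<^bsub>B u\<^esub>} K (B u)" by (rule Bu.submoduleI) auto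
    then have "lin_span K (B u) Y \<subseteq> {\<zero>\<^bsub>B u\<^esub>}" using \<open>Y = {}\<close> by (intro lin_span_least) auto
    then show False using Y Bur.one_closed B_one_nonzero[OF u] by auto
  qed
  \<comment> \<open>Unknowns: a coefficient for each path \<open>u \<beta> u'\<close> with basis
    elements as entries. Equations: one for each generator multiplied by basis elements from both
    sides.\<close>
  let ?I = "arrows \<times> U \<times> U'" and ?E = "X \<times> U \<times> U'"
  have cardlt: "card ?E < card ?I"
    using lt U(1) U'(1) ne[OF v U(3)] ne[OF w U'(3)] by (simp add: card_cartesian_product card_gt_0_iff)
  have "\<forall>i\<in>?I. \<exists>\<phi>. \<phi> \<in> lin_maps K A (field_module K) \<and>
      (\<forall>p. bp p \<longrightarrow> \<phi> (x p) = arrow_form K (f (fst (snd i))) (f' (snd (snd i))) (fst i) p)"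
  proof
    fix i assume i: "i \<in> ?I"
    let ?g = "arrow_form K (f (fst (snd i))) (f' (snd (snd i))) (fst i)"
    have "fst i \<in> arcs \<Delta>" "tail \<Delta> (fst i) = v" "head \<Delta> (fst i) = w" using i by (auto simp: arrows_def)
    then have m: "multilinear_on_paths (field_module K) ?g"
      using i f f' by (intro arrow_form_multilinear) auto
    have "?g p = \<zero>\<^bsub>field_module K\<^esub>" if "2 \<le> bp_length p" for p
    proof (cases p)
      case (Step a \<gamma> r)
      then show ?thesis using that by (cases r) auto
    qed simp
    then have "\<exists>\<phi>\<in>lin_maps K A (field_module K). \<forall>p. bp p \<longrightarrow> \<phi> (x p) = ?g p"
      by (intro universal[OF KM m])
    then show "\<exists>\<phi>. \<phi> \<in> lin_maps K A (field_module K) \<and> (\<forall>p. bp p \<longrightarrow> \<phi> (x p) = ?g p)" by (elim bexE) (intro exI conjI)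
  qed
  from bchoice[OF this] obtain \<phi> where \<phi>': "\<forall>i\<in>?I. \<phi> i \<in> lin_maps K A (field_module K) \<and>
      (\<forall>p. bp p \<longrightarrow> \<phi> i (x p) = arrow_form K (f (fst (snd i))) (f' (snd (snd i))) (fst i) p)"
    by (elim exE)
  have \<phi>: "\<phi> i \<in> lin_maps K A (field_module K)" if "i \<in> ?I" for i
    by (rule conjunct1[OF bspec[OF \<phi>' that]])
  have \<phi>x: "\<phi> i (x p) = arrow_form K (f (fst (snd i))) (f' (snd (snd i))) (fst i) p" if "i \<in> ?I" "bp p" for i p
    by (rule mp[OF spec[OF conjunct2[OF bspec[OF \<phi>' that(1)]]] that(2)])
  have \<phi>c: "\<phi> i a \<in> carrier K" if "i \<in> ?I" "a \<in> carrier A" for i a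
    using lin_maps_closed[OF \<phi>[OF that(1)] that(2)] by simp
  have "\<forall>\<xi>\<in>X. \<exists>y. y \<in> corner \<and> r2 y = \<xi>" using X(2) by blast
  from bchoice[OF this] obtain y where y: "\<And>\<xi>. \<xi> \<in> X \<Longrightarrow> y \<xi> \<in> corner" "\<And>\<xi>. \<xi> \<in> X \<Longrightarrow> r2 (y \<xi>) = \<xi>" by blast
  have corner_c: "a \<in> carrier A" if "a \<in> corner" for a using R_closed[OF corner_R[OF that]] .
  define sw where "sw b a b' = x (Triv v b) \<otimes>\<^bsub>A\<^esub> a \<otimes>\<^bsub>A\<^esub> x (Triv w b')" for b a b'
  have swc: "sw b a b' \<in> carrier A" if "b \<in> carrier (B v)" "a \<in> carrier A" "b' \<in> carrier (B w)" for b a b'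
    using that triv_closed[OF v] triv_closed[OF w] by (simp add: sw_def)
  \<comment> \<open>The coordinate at \<open>i\<close> of a lifted generator multiplied from both
    sides by the basis elements named in \<open>e\<close>.\<close>
  define c where "c e i = \<phi> i (sw (fst (snd e)) (y (fst e)) (snd (snd e)))" for e i
  have "\<exists>\<omega>. (\<forall>i\<in>?I. \<omega> i \<in> carrier K) \<and> (\<exists>i\<in>?I. \<omega> i \<noteq> \<zero>\<^bsub>K\<^esub>) \<and> (\<forall>e\<in>?E. (\<Oplus>\<^bsub>K\<^esub>i\<in>?I. c e i \<otimes>\<^bsub>K\<^esub> \<omega> i) = \<zero>\<^bsub>K\<^esub>)"
  proof (rule K.homogeneous_system[OF _ _ cardlt])
    show "c e i \<in> carrier K" if e: "e \<in> ?E" and i: "i \<in> ?I" for e i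
      unfolding c_def by (rule \<phi>c[OF i swc]) (use e U(2) U'(2) corner_c y(1) in auto)
  qed (use X(1) U(1) U'(1) arrows_finite in auto)
  then obtain \<omega> where \<omega>': "\<forall>i\<in>?I. \<omega> i \<in> carrier K" "\<exists>i\<in>?I. \<omega> i \<noteq> \<zero>\<^bsub>K\<^esub>"
    "\<forall>e\<in>?E. (\<Oplus>\<^bsub>K\<^esub>i\<in>?I. c e i \<otimes>\<^bsub>K\<^esub> \<omega> i) = \<zero>\<^bsub>K\<^esub>"
    by (elim exE conjE)
  note \<omega> = bspec[OF \<omega>'(1)] \<omega>'(2) bspec[OF \<omega>'(3)]
  \<comment> \<open>By the choice of \<open>\<omega>\<close>, this functional kills every lifted
    generator multiplied by basis elements, although not all of its coefficients are zero.\<close>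
  define \<Phi> where "\<Phi> a = (\<Oplus>\<^bsub>K\<^esub>i\<in>?I. \<phi> i a \<otimes>\<^bsub>K\<^esub> \<omega> i)" for a
  have finI: "finite ?I" using U(1) U'(1) arrows_finite by simp
  have tc: "(\<lambda>i. \<phi> i a \<otimes>\<^bsub>K\<^esub> \<omega> i) \<in> ?I \<rightarrow> carrier K" if "a \<in> carrier A" for a using \<phi>c[OF _ that] \<omega>(1) by blast
  have \<Phi>l: "\<Phi> \<in> lin_maps K A (field_module K)"
  proof (rule lin_mapsI)
    show "\<Phi> a \<in> carrier (field_module K)" if "a \<in> carrier A" for a
      unfolding \<Phi>_def using K.finsum_closed[OF tc[OF that]] by simp
    show "\<Phi> (a \<oplus>\<^bsub>A\<^esub> b) = \<Phi> a \<oplus>\<^bsub>field_module K\<^esub> \<Phi> b" if a: "a \<in> carrier A" and b: "b \<in> carrier A" for a b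
    proof -
      have "\<Phi> (a \<oplus>\<^bsub>A\<^esub> b) = (\<Oplus>\<^bsub>K\<^esub>i\<in>?I. \<phi> i a \<otimes>\<^bsub>K\<^esub> \<omega> i \<oplus>\<^bsub>K\<^esub> \<phi> i b \<otimes>\<^bsub>K\<^esub> \<omega> i)"
        unfolding \<Phi>_def
      proof (rule K.finsum_cong'[OF refl])
        show "(\<lambda>i. \<phi> i a \<otimes>\<^bsub>K\<^esub> \<omega> i \<oplus>\<^bsub>K\<^esub> \<phi> i b \<otimes>\<^bsub>K\<^esub> \<omega> i) \<in> ?I \<rightarrow> carrier K" using tc[OF a] tc[OF b] by blast
        show "\<phi> i (a \<oplus>\<^bsub>A\<^esub> b) \<otimes>\<^bsub>K\<^esub> \<omega> i = \<phi> i a \<otimes>\<^bsub>K\<^esub> \<omega> i \<oplus>\<^bsub>K\<^esub> \<phi> i b \<otimes>\<^bsub>K\<^esub> \<omega> i" if i: "i \<in> ?I" for i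
          using lin_maps_add[OF \<phi>[OF i] a b] \<phi>c[OF i a] \<phi>c[OF i b] \<omega>(1)[OF i] by (simp add: K.l_distr)
      qed
      also have "\<dots> = \<Phi> a \<oplus>\<^bsub>K\<^esub> \<Phi> b" unfolding \<Phi>_def by (rule K.finsum_addf[OF tc[OF a] tc[OF b]])
      finally show ?thesis by simp
    qed
    show "\<Phi> (k \<odot>\<^bsub>A\<^esub> a) = k \<odot>\<^bsub>field_module K\<^esub> \<Phi> a" if k: "k \<in> carrier K" and a: "a \<in> carrier A" for k a
    proof -
      have "\<Phi> (k \<odot>\<^bsub>A\<^esub> a) = (\<Oplus>\<^bsub>K\<^esub>i\<in>?I. k \<otimes>\<^bsub>K\<^esub> (\<phi> i a \<otimes>\<^bsub>K\<^esub> \<omega> i))"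
        unfolding \<Phi>_def
      proof (rule K.finsum_cong'[OF refl])
        show "(\<lambda>i. k \<otimes>\<^bsub>K\<^esub> (\<phi> i a \<otimes>\<^bsub>K\<^esub> \<omega> i)) \<in> ?I \<rightarrow> carrier K" using tc[OF a] k by blast
        show "\<phi> i (k \<odot>\<^bsub>A\<^esub> a) \<otimes>\<^bsub>K\<^esub> \<omega> i = k \<otimes>\<^bsub>K\<^esub> (\<phi> i a \<otimes>\<^bsub>K\<^esub> \<omega> i)" if i: "i \<in> ?I" for i
          using lin_maps_smult[OF \<phi>[OF i] k a] \<phi>c[OF i a] \<omega>(1)[OF i] k by (simp add: K.m_assoc)
      qed
      also have "\<dots> = k \<otimes>\<^bsub>K\<^esub> \<Phi> a" unfolding \<Phi>_def by (rule K.finsum_rdistr[OF finI k tc[OF a], symmetric])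
      finally show ?thesis by simp
    qed
  qed
  have \<Phi>0: "\<Phi> \<zero>\<^bsub>A\<^esub> = \<zero>\<^bsub>K\<^esub>" using lin_maps_zero[OF A_module KM \<Phi>l] by simp
  have \<Phi>2: "\<Phi> a = \<zero>\<^bsub>K\<^esub>" if "a \<in> R 2" for a
    using that
  proof (induct a rule: R_induct)
    case zero
    show ?case by (rule \<Phi>0)
  next
    case (path p)
    have "\<phi> i (x p) = \<zero>\<^bsub>K\<^esub>" if i: "i \<in> ?I" for i
    proof (cases p)
      case (Step a \<gamma> r)
      then show ?thesis using path \<phi>x[OF i path(1)] by (cases r) auto
    qed (use path in simp)
    then show ?case unfolding \<Phi>_def using \<omega>(1) by (intro K.add.finprod_one_eqI) simp
  next
    case (add a b)
    then show ?case using lin_maps_add[OF \<Phi>l R_closed[OF add(1)] R_closed[OF add(2)]] by simp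
  qed
  \<comment> \<open>The kernel of \<open>\<Phi>\<close> need not be stable under the two actions;
    demanding that all two-sided multiples be killed makes it so.\<close>
  define Z where "Z = {z \<in> R 1. \<forall>b\<in>carrier (B v). \<forall>b'\<in>carrier (B w). \<Phi> (sw b z b') = \<zero>\<^bsub>K\<^esub>}"
  have sw_lin: "(\<lambda>a. \<Phi> (sw b a b')) \<in> lin_maps K A (field_module K)"
    if "b \<in> carrier (B v)" "b' \<in> carrier (B w)" for b b'
    using lin_maps_comp[OF lin_maps_comp[OF A_mult_lin(1)[OF triv_closed[OF v that(1)]] A_mult_lin(2)[OF triv_closed[OF w that(2)]]] \<Phi>l]
    by (simp add: sw_def o_def)
  have yZ: "y \<xi> \<in> Z" if \<xi>: "\<xi> \<in> X" for \<xi>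
  proof -
    have yc: "y \<xi> \<in> carrier A" using corner_c y(1)[OF \<xi>] .
    have base: "\<Phi> (sw s (y \<xi>) s') = \<zero>\<^bsub>K\<^esub>" if "s \<in> U" "s' \<in> U'" for s s'
      using \<omega>(3)[of "(\<xi>, s, s')"] \<xi> that by (simp add: c_def \<Phi>_def)
    \<comment> \<open>The product is linear in each outer factor, so vanishing extends from the
      basis elements to all of \<open>B w\<close> and afterwards to all of
      \<open>B v\<close>.\<close>
    have step1: "\<Phi> (sw s (y \<xi>) b') = \<zero>\<^bsub>K\<^esub>" if s: "s \<in> U" and b': "b' \<in> carrier (B w)" for s b'
    proof -
      have sc: "x (Triv v s) \<otimes>\<^bsub>A\<^esub> y \<xi> \<in> carrier A" using s U(2) triv_closed[OF v] yc by auto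
      have "(\<lambda>b'. \<Phi> (sw s (y \<xi>) b')) \<in> lin_maps K (B w) (field_module K)"
        using lin_maps_comp[OF lin_maps_comp[OF triv_lin[OF w] A_mult_lin(1)[OF sc]] \<Phi>l] by (simp add: sw_def o_def)
      from lin_span_least[OF lin_maps_kernel_submodule[OF B_module[OF w] KM this], of U']
      show ?thesis using U'(2,3) base[OF s] b' by auto
    qed
    have "\<Phi> (sw b (y \<xi>) b') = \<zero>\<^bsub>K\<^esub>" if b: "b \<in> carrier (B v)" and b': "b' \<in> carrier (B w)" for b b'
    proof -
      have "(\<lambda>b. \<Phi> (sw b (y \<xi>) b')) \<in> lin_maps K (B v) (field_module K)"
        using lin_maps_comp[OF lin_maps_comp[OF lin_maps_comp[OF triv_lin[OF v] A_mult_lin(2)[OF yc]]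
              A_mult_lin(2)[OF triv_closed[OF w b']]] \<Phi>l] by (simp add: sw_def o_def)
      from lin_span_least[OF lin_maps_kernel_submodule[OF B_module[OF v] KM this], of U]
      show ?thesis using U(2,3) step1[OF _ b'] b by auto
    qed
    then show ?thesis using corner_R[OF y(1)[OF \<xi>]] by (simp add: Z_def)
  qed
  have Zsub: "submodule Z K A"
  proof -
    note R1 = submodule_memD[OF A_module ideal_submodule[OF A_alg R_ideal[of 1]]]
    note sl = sw_lin
    show ?thesis
    proof (rule Am.submoduleI)
      show "Z \<subseteq> carrier A" using R_closed by (auto simp: Z_def)
      show "\<zero>\<^bsub>A\<^esub> \<in> Z" using R1(1) lin_maps_zero[OF A_module KM sl] by (simp add: Z_def)
      fix a assume a: "a \<in> Z"
      have ac: "a \<in> carrier A" using a R_closed by (auto simp: Z_def)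
      show sm: "k \<odot>\<^bsub>A\<^esub> a \<in> Z" if "k \<in> carrier K" for k
        using a R1(6)[OF that, of a] lin_maps_smult[OF sl that ac] that by (simp add: Z_def)
      have "\<ominus>\<^bsub>A\<^esub> a = (\<ominus>\<^bsub>K\<^esub> \<one>\<^bsub>K\<^esub>) \<odot>\<^bsub>A\<^esub> a" using ac by (simp add: Am.smult_l_minus)
      then show "\<ominus>\<^bsub>A\<^esub> a \<in> Z" using sm[of "\<ominus>\<^bsub>K\<^esub> \<one>\<^bsub>K\<^esub>"] by simp
      fix b assume b: "b \<in> Z"
      have bc: "b \<in> carrier A" using b R_closed by (auto simp: Z_def)
      show "a \<oplus>\<^bsub>A\<^esub> b \<in> Z" using a b R1(3)[of a b] lin_maps_add[OF sl ac bc] by (simp add: Z_def)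
    qed
  qed
  have "sub_bim (r2 ` Z)"
  proof (rule sub_bim_image[OF Zsub])
    show "Z \<subseteq> R 1" by (auto simp: Z_def)
    show "x (Triv v b) \<otimes>\<^bsub>A\<^esub> z \<in> Z" if b: "b \<in> carrier (B v)" and z: "z \<in> Z" for b z
    proof -
      have zR: "z \<in> R 1" using z by (simp add: Z_def)
      have "sw b0 (x (Triv v b) \<otimes>\<^bsub>A\<^esub> z) b' = sw (b0 \<otimes>\<^bsub>B v\<^esub> b) z b'"
        if "b0 \<in> carrier (B v)" "b' \<in> carrier (B w)" for b0 b'
        using that b R_closed[OF zR] triv_closed[OF v] triv_closed[OF w]
        by (simp add: sw_def triv_mult[OF v, symmetric] A.m_assoc)
      then show ?thesis using z b R_1_mult(1)[OF zR triv_closed[OF v b]] by (simp add: Z_def)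
    qed
    show "z \<otimes>\<^bsub>A\<^esub> x (Triv w b) \<in> Z" if b: "b \<in> carrier (B w)" and z: "z \<in> Z" for b z
    proof -
      have zR: "z \<in> R 1" using z by (simp add: Z_def)
      have "sw b0 (z \<otimes>\<^bsub>A\<^esub> x (Triv w b)) b' = sw b0 z (b \<otimes>\<^bsub>B w\<^esub> b')"
        if "b0 \<in> carrier (B v)" "b' \<in> carrier (B w)" for b0 b'
        using that b R_closed[OF zR] triv_closed[OF v] triv_closed[OF w]
        by (simp add: sw_def triv_mult[OF w, symmetric] A.m_assoc)
      then show ?thesis using z b R_1_mult(2)[OF zR triv_closed[OF w b]] by (simp add: Z_def)
    qed
  qed
  moreover have "X \<subseteq> r2 ` Z" using yZ y(2) by (metis imageI subsetI)
  ultimately have sub: "r2 ` corner \<subseteq> r2 ` Z" using X(3) by blast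
  obtain \<beta> u u' where i: "\<beta> \<in> arrows" "u \<in> U" "u' \<in> U'" "\<omega> (\<beta>, u, u') \<noteq> \<zero>\<^bsub>K\<^esub>" using \<omega>(2) by auto
  \<comment> \<open>A path whose coefficient in \<open>\<omega>\<close> is nonzero. It lies in the
    corner, so modulo \<open>R 2\<close> it agrees with an element of \<open>Z\<close> and
    \<open>\<Phi>\<close> must kill it; but its value under \<open>\<Phi>\<close> is that
    coefficient.\<close>
  let ?p = "Step u \<beta> (Triv w u')"
  have uc: "u \<in> carrier (B v)" "u' \<in> carrier (B w)" using i U(2) U'(2) by auto
  have bp: "bp ?p" by (rule arrow_bp[OF i(1) uc])
  have pc: "x ?p \<in> corner" by (rule arrow_corner[OF i(1) uc])
  then obtain z where z: "z \<in> Z" "r2 (x ?p) = r2 z" using sub by blast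
  have zc: "z \<in> carrier A" using z(1) R_closed by (auto simp: Z_def)
  have xc: "x ?p \<in> carrier A" by (rule x_closed[OF bp])
  have d2: "x ?p \<ominus>\<^bsub>A\<^esub> z \<in> R 2" using z(2) r2_eq_iff[OF xc zc] by simp
  let ?h = "\<lambda>a. \<Phi> (sw \<one>\<^bsub>B v\<^esub> a \<one>\<^bsub>B w\<^esub>)"
  note hl = sw_lin[OF Bv.one_closed Bw.one_closed]
  have "sw \<one>\<^bsub>B v\<^esub> (x ?p \<ominus>\<^bsub>A\<^esub> z) \<one>\<^bsub>B w\<^esub> \<in> R 2"
    unfolding sw_def by (rule ideal.I_r_closed[OF R_ideal ideal.I_l_closed[OF R_ideal d2 evw_closed(1)] evw_closed(2)])
  then have "?h (x ?p \<ominus>\<^bsub>A\<^esub> z) = \<zero>\<^bsub>K\<^esub>" by (rule \<Phi>2)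
  moreover have "?h z = \<zero>\<^bsub>K\<^esub>" using z(1) by (simp add: Z_def)
  moreover have "?h ((x ?p \<ominus>\<^bsub>A\<^esub> z) \<oplus>\<^bsub>A\<^esub> z) = ?h (x ?p \<ominus>\<^bsub>A\<^esub> z) \<oplus>\<^bsub>field_module K\<^esub> ?h z"
    by (rule lin_maps_add[OF hl]) (use xc zc in auto)
  moreover have "(x ?p \<ominus>\<^bsub>A\<^esub> z) \<oplus>\<^bsub>A\<^esub> z = x ?p" using xc zc by (simp add: A.minus_eq A.a_assoc A.l_neg)
  ultimately have "?h (x ?p) = \<zero>\<^bsub>K\<^esub>" by simp
  moreover have "sw \<one>\<^bsub>B v\<^esub> (x ?p) \<one>\<^bsub>B w\<^esub> = x ?p" using corner_absorb[OF pc] by (simp only: sw_def)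
  ultimately have "\<Phi> (x ?p) = \<zero>\<^bsub>K\<^esub>" by simp
  moreover have "\<Phi> (x ?p) = \<omega> (\<beta>, u, u')"
  proof -
    have "\<Phi> (x ?p) = \<phi> (\<beta>, u, u') (x ?p) \<otimes>\<^bsub>K\<^esub> \<omega> (\<beta>, u, u')"
      unfolding \<Phi>_def
    proof (rule K.finsum_single[OF finI])
      show "\<phi> j (x ?p) \<otimes>\<^bsub>K\<^esub> \<omega> j \<in> carrier K" if "j \<in> ?I" for j using \<phi>c[OF that xc] \<omega>(1)[OF that] by simp
      show "\<phi> j (x ?p) \<otimes>\<^bsub>K\<^esub> \<omega> j = \<zero>\<^bsub>K\<^esub>" if j: "j \<in> ?I" "j \<noteq> (\<beta>, u, u')" for j
      proof -
        obtain \<gamma> s s' where js: "j = (\<gamma>, s, s')" "s \<in> U" "s' \<in> U'" using j(1) by auto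
        have "\<phi> j (x ?p) = \<zero>\<^bsub>K\<^esub>"
          using \<phi>x[OF j(1) bp] j(2) js fd[OF js(2) i(2)] fd'[OF js(3) i(3)] by auto
        then show ?thesis using \<omega>(1)[OF j(1)] by simp
      qed
    qed (use i in simp)
    moreover have "\<phi> (\<beta>, u, u') (x ?p) = \<one>\<^bsub>K\<^esub>"
      using \<phi>x[OF _ bp, of "(\<beta>, u, u')"] i fd[OF i(2) i(2)] fd'[OF i(3) i(3)] by simp
    ultimately show ?thesis using \<omega>(1)[of "(\<beta>, u, u')"] i by simp
  qed
  ultimately show False using i(4) by simp
qed

lemma component_rank:
  assumes fd: "finite_dimensional K A"
  shows "bimodule_rank (ideal_algebra S (T v)) (ideal_algebra S (T w)) Q2 (rad_lact A) (rad_ract A)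
    (rad_component A (T v) (T w)) = card arrows"
  unfolding bimodule_rank_def component_eq
proof (rule Least_equality)
  let ?X = "(\<lambda>\<beta>. r2 (x (arrow \<beta>))) ` arrows"
  have X: "finite ?X" "?X \<subseteq> r2 ` corner"
    using arrows_finite arrow_corner[OF _ Bv.one_closed Bw.one_closed] by auto
  have gen: "\<Inter>{N. sub_bim N \<and> ?X \<subseteq> N} = r2 ` corner"
  proof
    show "\<Inter>{N. sub_bim N \<and> ?X \<subseteq> N} \<subseteq> r2 ` corner" using sub_bim_corner X(2) by blast
    show "r2 ` corner \<subseteq> \<Inter>{N. sub_bim N \<and> ?X \<subseteq> N}"
    proof (rule Inter_greatest)
      fix N assume "N \<in> {N. sub_bim N \<and> ?X \<subseteq> N}"
      then show "r2 ` corner \<subseteq> N" by (intro sub_bim_contains_corner) auto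
    qed
  qed
  \<comment> \<open>The lower bound, applied to the arrows themselves, shows that they remain
    distinct modulo \<open>R 2\<close>.\<close>
  have "card ?X = card arrows"
    using generating_set_card[OF fd X gen] card_image_le[OF arrows_finite] by (intro antisym)
  then show "\<exists>X. finite X \<and> card X = card arrows \<and> X \<subseteq> r2 ` corner \<and> \<Inter>{N. sub_bim N \<and> X \<subseteq> N} = r2 ` corner"
    using X gen by (intro exI[of _ ?X] conjI)
  fix n assume "\<exists>X. finite X \<and> card X = n \<and> X \<subseteq> r2 ` corner \<and> \<Inter>{N. sub_bim N \<and> X \<subseteq> N} = r2 ` corner"
  then obtain X where "finite X" "card X = n" "X \<subseteq> r2 ` corner" "\<Inter>{N. sub_bim N \<and> X \<subseteq> N} = r2 ` corner"
    by (elim exE conjE)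
  then show "card arrows \<le> n" using generating_set_card[OF fd, of X] by simp
qed

end

end

section \<open>Assembling the isomorphism of quivers\<close>

theorem theorem4p4:
  fixes K :: "'k ring"
    and A :: "('k, 'a) module"
    and p :: nat
    and Abar :: "nat \<Rightarrow> 'a set set"
    and \<Delta> :: "('v, 'e) pre_digraph"
    and B :: "'v \<Rightarrow> ('k, 'b) module"
    and \<rho> :: "(('v, 'e, 'b) bpath \<Rightarrow> 'k) set set"
    and t :: nat
  assumes "field K"
    and "k_algebra K A"
    and "finite_dimensional K A"
    and "is_direct_sum_of_ideals (quot_algebra A (radical A)) {1..p} Abar"
    and "\<forall>i\<in>{1..p}. simple_algebra K (ideal_algebra (quot_algebra A (radical A)) (Abar i))"
    and "fin_digraph \<Delta>"
    and "\<forall>v\<in>verts \<Delta>. simple_algebra K (B v)"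
    and "\<rho> \<subseteq> gpa_relations K \<Delta> B"
    and "algebra_isomorphic K A (gen_path_algebra_rel K \<Delta> B \<rho>)"
    and "ideal_power (gen_path_algebra K \<Delta> B) (arrow_ideal K \<Delta> B) t
           \<subseteq> genideal (gen_path_algebra K \<Delta> B) \<rho>"
    and "genideal (gen_path_algebra K \<Delta> B) \<rho>
           \<subseteq> ideal_power (gen_path_algebra K \<Delta> B) (arrow_ideal K \<Delta> B) 2"
  shows "p = card (verts \<Delta>) \<and>
    (\<exists>hom. pre_digraph.digraph_isomorphism (quiver_of A p Abar) hom \<and>
           \<Delta> = app_iso hom (quiver_of A p Abar) \<and>
           (\<forall>i\<in>{1..p}. algebra_isomorphic K
              (ideal_algebra (quot_algebra A (radical A)) (Abar i)) (B (iso_verts hom i))))"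
proof -
  interpret path_data K \<Delta> B
    by (rule path_data.intro[OF assms(1,6)]) (use assms(7) in \<open>simp add: simple_algebra_def\<close>)
  obtain \<pi> where \<pi>: "\<pi> \<in> lin_maps K F A" "\<pi> \<in> ring_hom F A" "\<pi> ` carrier F = carrier A"
    "\<And>x. x \<in> mlin \<Longrightarrow> \<pi> x = \<zero>\<^bsub>A\<^esub>" "\<And>x. x \<in> F_ge t \<Longrightarrow> \<pi> x = \<zero>\<^bsub>A\<^esub>"
    "\<And>f. f \<in> carrier F \<Longrightarrow> \<pi> f = \<zero>\<^bsub>A\<^esub> \<Longrightarrow> \<exists>x\<in>F_ge 2. f \<ominus>\<^bsub>F\<^esub> x \<in> mlin"
    by (rule presentation[OF assms(2,8-11)]) (rule that; blast)
  interpret presented_algebra K \<Delta> B A \<pi> t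
    by (intro presented_algebra.intro presented_algebra_axioms.intro path_data_axioms)
      (fact assms(2) \<pi> | use assms(7) in simp)+
  have S: "quot_algebra A (radical A) = S" by (simp only: radical_eq Rad_def)
  obtain \<sigma> where \<sigma>: "bij_betw \<sigma> {1..p} (verts \<Delta>)" "\<And>i. i \<in> {1..p} \<Longrightarrow> Abar i = T (\<sigma> i)"
    using components_bij[of p Abar] assms(4,5) unfolding S by blast
  have \<sigma>v: "\<sigma> i \<in> verts \<Delta>" if "i \<in> {1..p}" for i using \<sigma>(1) that by (auto simp: bij_betw_def)
  define E where "E i j = {\<beta> \<in> arcs \<Delta>. tail \<Delta> \<beta> = \<sigma> i \<and> head \<Delta> \<beta> = \<sigma> j}" for i j
  have fE: "finite (E i j)" for i j by (simp add: E_def)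
  have num: "quiver_arrow_number A Abar i j = card (E i j)" if "i \<in> {1..p}" "j \<in> {1..p}" for i j
    using component_rank[OF \<sigma>v[OF that(1)] \<sigma>v[OF that(2)] assms(3)] \<sigma>(2) that
    by (simp add: quiver_arrow_number_def S rad_sq_eq arrows_def[OF \<sigma>v[OF that(1)] \<sigma>v[OF that(2)]] E_def)
  have "\<exists>h. bij_betw h {..<card (E i j)} (E i j)" for i j
    using ex_bij_betw_nat_finite[OF fE[of i j]] by (simp add: atLeast0LessThan)
  \<comment> \<open>Numbers the arrows between each pair of vertices, to match the triples
    \<open>(i, j, l)\<close> that are the arrows of \<open>quiver_of\<close>.\<close>
  then obtain h where h: "\<And>i j. bij_betw (h i j) {..<card (E i j)} (E i j)" by metis
  let ?Q = "quiver_of A p Abar"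
  \<comment> \<open>Head and tail maps are those of \<open>\<Delta>\<close> itself, so that applying
    the isomorphism returns \<open>\<Delta>\<close> literally, with the same functions even off its
    arcs.\<close>
  let ?hom = "\<lparr>iso_verts = \<sigma>, iso_arcs = (\<lambda>(i, j, l). h i j l), iso_head = head \<Delta>, iso_tail = tail \<Delta>\<rparr>"
  have arcs: "(i, j, l) \<in> arcs ?Q \<longleftrightarrow> i \<in> {1..p} \<and> j \<in> {1..p} \<and> l < card (E i j)" for i j l
    using num by (auto simp: quiver_of_def)
  have hE: "h i j l \<in> E i j" if "l < card (E i j)" for i j l
    using h[of i j] that by (auto simp: bij_betw_def)
  have inj_\<sigma>: "inj_on \<sigma> {1..p}" using \<sigma>(1) by (simp add: bij_betw_def)
  have "pre_digraph.digraph_isomorphism ?Q ?hom"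
    unfolding pre_digraph.digraph_isomorphism_def
  proof (intro conjI ballI)
    show "wf_digraph ?Q" by unfold_locales (auto simp: quiver_of_def)
    show "inj_on (iso_verts ?hom) (verts ?Q)" using inj_\<sigma> by (simp add: quiver_of_def)
    show "inj_on (iso_arcs ?hom) (arcs ?Q)"
    proof (rule inj_onI)
      fix a b assume ab: "a \<in> arcs ?Q" "b \<in> arcs ?Q" "iso_arcs ?hom a = iso_arcs ?hom b"
      obtain i j l i' j' l' where [simp]: "a = (i, j, l)" "b = (i', j', l')" by (cases a; cases b)
      have a: "i \<in> {1..p}" "j \<in> {1..p}" "l < card (E i j)" and b: "i' \<in> {1..p}" "j' \<in> {1..p}" "l' < card (E i' j')"
        using ab(1,2) by (simp_all only: arcs \<open>a = (i, j, l)\<close> \<open>b = (i', j', l')\<close>)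
      have e: "h i j l = h i' j' l'" using ab(3) by simp
      \<comment> \<open>The end points of the common arrow recover \<open>i\<close> and
        \<open>j\<close>; only then do \<open>l\<close> and \<open>l'\<close> number the same set of
        arrows.\<close>
      have "\<sigma> i = \<sigma> i'" "\<sigma> j = \<sigma> j'" using hE[OF a(3)] hE[OF b(3)] e by (auto simp: E_def)
      then have ij: "i = i'" "j = j'" using inj_onD[OF inj_\<sigma>] a b by auto
      have "inj_on (h i j) {..<card (E i j)}" using h[of i j] by (simp add: bij_betw_def)
      then have "l = l'" using e a(3) b(3) ij by (auto dest: inj_onD)
      then show "a = b" using ij by simp
    qed
    fix a assume a: "a \<in> arcs ?Q"
    obtain i j l where e: "a = (i, j, l)" by (cases a)
    have "h i j l \<in> E i j" using a hE unfolding e arcs by blast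
    then show "iso_verts ?hom (tail ?Q a) = iso_tail ?hom (iso_arcs ?hom a)"
      "iso_verts ?hom (head ?Q a) = iso_head ?hom (iso_arcs ?hom a)"
      by (simp_all add: e E_def quiver_of_def)
  qed
  moreover have "\<Delta> = app_iso ?hom ?Q"
  proof (rule pre_digraph.equality)
    show "verts \<Delta> = verts (app_iso ?hom ?Q)" using \<sigma>(1) by (simp add: quiver_of_def bij_betw_def)
    show "arcs \<Delta> = arcs (app_iso ?hom ?Q)"
    proof
      show "arcs (app_iso ?hom ?Q) \<subseteq> arcs \<Delta>"
      proof
        fix \<beta> assume "\<beta> \<in> arcs (app_iso ?hom ?Q)"
        then obtain a where a: "a \<in> arcs ?Q" "\<beta> = iso_arcs ?hom a" by auto
        obtain i j l where e: "a = (i, j, l)" by (cases a)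
        have "h i j l \<in> E i j" using a(1) hE unfolding e arcs by blast
        then show "\<beta> \<in> arcs \<Delta>" by (simp add: a(2) e E_def)
      qed
      show "arcs \<Delta> \<subseteq> arcs (app_iso ?hom ?Q)"
      proof
        fix \<beta> assume \<beta>: "\<beta> \<in> arcs \<Delta>"
        have "tail \<Delta> \<beta> \<in> \<sigma> ` {1..p}" "head \<Delta> \<beta> \<in> \<sigma> ` {1..p}" using \<beta> \<sigma>(1) by (simp_all add: bij_betw_def)
        then obtain i j where ij: "i \<in> {1..p}" "j \<in> {1..p}" "tail \<Delta> \<beta> = \<sigma> i" "head \<Delta> \<beta> = \<sigma> j" by blast
        then have "\<beta> \<in> E i j" using \<beta> by (simp add: E_def)
        then obtain l where l: "l < card (E i j)" "\<beta> = h i j l" using h[of i j] by (auto simp: bij_betw_def)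
        then have "(i, j, l) \<in> arcs ?Q" using ij arcs by blast
        then have "iso_arcs ?hom (i, j, l) \<in> iso_arcs ?hom ` arcs ?Q" by (rule imageI)
        then show "\<beta> \<in> arcs (app_iso ?hom ?Q)" using l(2) by simp
      qed
    qed
  qed simp_all
  moreover have "algebra_isomorphic K (ideal_algebra (quot_algebra A (radical A)) (Abar i)) (B (iso_verts ?hom i))"
    if i: "i \<in> {1..p}" for i
  proof -
    have "k_algebra K (ideal_algebra S (T (\<sigma> i)))"
      using bspec[OF assms(5) i] unfolding S \<sigma>(2)[OF i] simple_algebra_def by simp
    then show ?thesis using T_isomorphic[OF \<sigma>v[OF i]] unfolding S \<sigma>(2)[OF i] by simp
  qed
  moreover have "p = card (verts \<Delta>)" using bij_betw_same_card[OF \<sigma>(1)] by simp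
  ultimately show ?thesis by blast
qed

end
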